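(* Let $n\in\{1,2,3\}$, $0<r<R$, $\beta>0$, and let $f\in C^1(\mathbb{R})\cap C^2(\mathbb{R}\setminus\{0\})$ be strictly increasing with $f(0)=0$. For a target $z\in L^2(B(0,R)\setminus B(0,r))$ consider the functional $$J:L^2(B(0,r))\to\mathbb{R},\qquad J(u)=\frac12\int_{B(0,r)}|u|^2\,dx+\frac{\beta}{2}\int_{B(0,R)\setminus B(0,r)}|y_u-z|^2\,dx,$$ where $y_u$ is the solution of $$-\Delta y_u+f(y_u)=u\chi_{B(0,r)} \ \text{ in } B(0,R),\qquad y_u=0\ \text{ on }\partial B(0,R).$$ Then: 1. if $f$ is linear, $J$ is convex for every target $z\in L^2(B(0,R)\setminus B(0,r))$; 2. if $f$ is not linear, there exists a target $z\in L^2(B(0,R)\setminus B(0,r))$ such that the corresponding $J$ is not convex.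
   Context: $B(0,\rho)$ is the ball of $\mathbb{R}^n$ centered at the origin with radius $\rho$; $\chi_{B(0,r)}$ is the characteristic function of $B(0,r)$. Notion of solution: for $u\in L^2(B(0,r))$, $y\in H^1_0(B(0,R))$ is a solution of the state equation if $f(y)\in L^1(B(0,R))$ and for every $\varphi\in H^1_0(B(0,R))\cap L^\infty(B(0,R))$, $$\int_{B(0,R)}\left[\nabla y\cdot\nabla\varphi+f(y)\varphi\right]dx=\int_{B(0,r)} u\varphi\,dx .$$ There is exactly one solution for each $u\in L^2(B(0,r))$. *)

theory Defs
  imports "HOL-Analysis.Analysis"
begin

(* Elements of the Lebesgue and Sobolev spaces are represented by functions on the whole of
   R^n, of which only the values on the set S matter (and these up to null sets); the spaces
   below are therefore sets of representatives rather than quotients. *)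

definition L2 :: "(real^'n) set \<Rightarrow> (real^'n \<Rightarrow> real) set" where
  "L2 S = {u \<in> borel_measurable (lebesgue_on S). integrable (lebesgue_on S) (\<lambda>x. (u x)\<^sup>2)}"

definition Linfty :: "(real^'n) set \<Rightarrow> (real^'n \<Rightarrow> real) set" where
  "Linfty S = {u \<in> borel_measurable (lebesgue_on S). \<exists>C. AE x in lebesgue_on S. \<bar>u x\<bar> \<le> C}"

definition partial_deriv :: "'n \<Rightarrow> (real^'n \<Rightarrow> real) \<Rightarrow> real^'n \<Rightarrow> real" where
  "partial_deriv i \<phi> x = frechet_derivative \<phi> (at x) (axis i 1)"

primrec Ck :: "nat \<Rightarrow> (real^'n \<Rightarrow> real) \<Rightarrow> bool" where
  "Ck 0 \<phi> \<longleftrightarrow> continuous_on UNIV \<phi>"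
| "Ck (Suc k) \<phi> \<longleftrightarrow> (\<forall>x. \<phi> differentiable (at x)) \<and> (\<forall>i. Ck k (partial_deriv i \<phi>))"

(* C_c^infinity(S), every function being extended by 0 outside S. *)
definition test_functions :: "(real^'n) set \<Rightarrow> (real^'n \<Rightarrow> real) set" where
  "test_functions S = {\<phi>. (\<forall>k. Ck k \<phi>) \<and> (\<exists>K. compact K \<and> K \<subseteq> S \<and> (\<forall>x. x \<notin> K \<longrightarrow> \<phi> x = 0))}"

definition has_weak_gradient ::
  "(real^'n) set \<Rightarrow> (real^'n \<Rightarrow> real) \<Rightarrow> (real^'n \<Rightarrow> real^'n) \<Rightarrow> bool" where
  "has_weak_gradient S y g \<longleftrightarrow>
     (\<forall>i. (\<lambda>x. g x $ i) \<in> L2 S) \<and>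
     (\<forall>\<phi>\<in>test_functions S. \<forall>i.
        (LINT x|lebesgue_on S. y x * partial_deriv i \<phi> x) = - (LINT x|lebesgue_on S. g x $ i * \<phi> x))"

definition H1 :: "(real^'n) set \<Rightarrow> (real^'n \<Rightarrow> real) set" where
  "H1 S = {y \<in> L2 S. \<exists>g. has_weak_gradient S y g}"

(* On an open set the weak gradient is unique almost everywhere, so the choice of
   representative is immaterial. *)
definition weak_gradient :: "(real^'n) set \<Rightarrow> (real^'n \<Rightarrow> real) \<Rightarrow> real^'n \<Rightarrow> real^'n" where
  "weak_gradient S y = (SOME g. has_weak_gradient S y g)"

definition H1_norm :: "(real^'n) set \<Rightarrow> (real^'n \<Rightarrow> real) \<Rightarrow> real" where
  "H1_norm S y = sqrt ((LINT x|lebesgue_on S. (y x)\<^sup>2) +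
                       (LINT x|lebesgue_on S. (norm (weak_gradient S y x))\<^sup>2))"

(* The closure of C_c^infinity(S) in H^1(S). *)
definition H10 :: "(real^'n) set \<Rightarrow> (real^'n \<Rightarrow> real) set" where
  "H10 S = {y \<in> H1 S. \<forall>e>0. \<exists>\<phi>\<in>test_functions S. H1_norm S (\<lambda>x. y x - \<phi> x) < e}"

definition is_state_solution ::
  "(real \<Rightarrow> real) \<Rightarrow> real \<Rightarrow> real \<Rightarrow> (real^'n \<Rightarrow> real) \<Rightarrow> (real^'n \<Rightarrow> real) \<Rightarrow> bool" where
  "is_state_solution f r R u y \<longleftrightarrow>
     y \<in> H10 (ball 0 R) \<and>
     integrable (lebesgue_on (ball 0 R)) (\<lambda>x. f (y x)) \<and>
     (\<forall>\<phi> \<in> H10 (ball 0 R) \<inter> Linfty (ball 0 R).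
        (LINT x|lebesgue_on (ball 0 R).
           weak_gradient (ball 0 R) y x \<bullet> weak_gradient (ball 0 R) \<phi> x + f (y x) * \<phi> x)
        = (LINT x|lebesgue_on (ball 0 r). u x * \<phi> x))"

(* Under the standing assumptions on n, f, r and R, a solution exists for every u in L2 (ball 0 r)
   and is unique almost everywhere; this picks a representative of it. *)
definition state ::
  "(real \<Rightarrow> real) \<Rightarrow> real \<Rightarrow> real \<Rightarrow> (real^'n \<Rightarrow> real) \<Rightarrow> real^'n \<Rightarrow> real" where
  "state f r R u = (SOME y. is_state_solution f r R u y)"

definition cost ::
  "(real \<Rightarrow> real) \<Rightarrow> real \<Rightarrow> real \<Rightarrow> real \<Rightarrow> (real^'n \<Rightarrow> real) \<Rightarrow> (real^'n \<Rightarrow> real) \<Rightarrow> real" where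
  "cost f r R \<beta> z u =
     1/2 * (LINT x|lebesgue_on (ball 0 r). \<bar>u x\<bar>\<^sup>2) +
     \<beta>/2 * (LINT x|lebesgue_on (ball 0 R - ball 0 r). \<bar>state f r R u x - z x\<bar>\<^sup>2)"

(* Convexity for functionals on a set of functions; convex_on is not applicable because the
   type of all functions is not an instance of the class real_vector. *)
definition convex_functional_on :: "('a \<Rightarrow> real) set \<Rightarrow> (('a \<Rightarrow> real) \<Rightarrow> real) \<Rightarrow> bool" where
  "convex_functional_on X J \<longleftrightarrow>
     (\<forall>u\<in>X. \<forall>v\<in>X. \<forall>t\<in>{0..1}.
        J (\<lambda>x. (1 - t) * u x + t * v x) \<le> (1 - t) * J u + t * J v)"

end

theory Submission
  imports Defs
begin

text \<open>
  Fix controls $u$, $v$ and $t \<in> [0,1]$, and let $w$ be the difference between the state of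
  $(1-t)u + tv$ and the corresponding combination of the states. The part of $J$ that depends on
  the target is affine in the state, so the convexity defect of $J$ contains the term
  $\<beta> \<integral> w z$ over the annulus, and large multiples of $w$ as targets show: if $J$ is
  convex for all targets, then $w = 0$ in the annulus. For the constant controls this gives
  $y_s = s y_1$ there, and the equation, which has no source in the annulus, turns it into
  $f(s y_1) = s f(y_1)$. One nonzero value of $y_1$ in the annulus therefore makes $f$ linear.

  Such a value exists: if $y_1$ vanished in the annulus, testing the equation with $f(y_1)$ and with a
  cutoff function that is 1 on the inner ball would give
  $\<integral> f'(y_1) |\<nabla> y_1|^2 + \<integral> (f(y_1) - 1)^2 = 0$ over the inner ball, so $y_1$ would be
  a nonzero constant in the inner ball and zero elsewhere, which is impossible in $H^1_0$.
\<close>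

section \<open>Square integrable functions\<close>

text \<open>Two gaps shape the proof. \<open>state\<close> is a choice among solutions, so nothing
  is known about it for a control until a solution has been constructed; for a nonlinear
  \<open>f\<close> without growth condition this is done for bounded controls, where a comparison
  bound allows \<open>f\<close> to be replaced by a Lipschitz function. This is why the nonlinear
  direction works with constant controls: they form a convex family, and affinity of the state on
  segments, together with the zero state of the zero control, yields homogeneity for every real
  factor. Likewise \<open>weak_gradient\<close> is a choice, so the work is done with explicit
  gradients that are limits of gradients of test functions. Nonlinear functions of a solution become
  admissible in the equation through a chain rule for functions with bounded continuous derivative,
  which is why truncations of \<open>f\<close> and a smooth substitute for the positive part appear.
  Finally, every identity holds only almost everywhere, with an exceptional set that depends on the
  factor s; rational factors leave one common null set, and continuity of \<open>f\<close> recovers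
  the reals.\<close>

definition square_integrable :: "'a measure \<Rightarrow> ('a \<Rightarrow> real) \<Rightarrow> bool" where
  "square_integrable M u \<longleftrightarrow> u \<in> borel_measurable M \<and> integrable M (\<lambda>x. (u x)\<^sup>2)"

definition norm_L2 :: "'a measure \<Rightarrow> ('a \<Rightarrow> real) \<Rightarrow> real" where
  "norm_L2 M u = sqrt (\<integral>x. (u x)\<^sup>2 \<partial>M)"

lemma L2_iff_square_integrable: "u \<in> L2 S \<longleftrightarrow> square_integrable (lebesgue_on S) u"
  by (simp add: L2_def square_integrable_def)

lemma square_integrable_measurable [measurable_dest]:
  "square_integrable M u \<Longrightarrow> u \<in> borel_measurable M"
  by (simp add: square_integrable_def)

lemma square_integrable_power2: "square_integrable M u \<Longrightarrow> integrable M (\<lambda>x. (u x)\<^sup>2)"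
  by (simp add: square_integrable_def)

lemma norm_L2_nonneg [simp]: "0 \<le> norm_L2 M u"
  by (simp add: norm_L2_def)

lemma norm_L2_power2: "(norm_L2 M u)\<^sup>2 = (\<integral>x. (u x)\<^sup>2 \<partial>M)"
  by (simp add: norm_L2_def)

lemma integrable_mult_L2:
  assumes "square_integrable M u" "square_integrable M v"
  shows "integrable M (\<lambda>x. u x * v x)"
proof (rule Bochner_Integration.integrable_bound)
  note [measurable] = square_integrable_measurable[OF assms(1)] square_integrable_measurable[OF assms(2)]
  show "integrable M (\<lambda>x. (u x)\<^sup>2 + (v x)\<^sup>2)"
    using assms by (auto simp: square_integrable_def)
  show "(\<lambda>x. u x * v x) \<in> borel_measurable M"
    by measurable
  have "\<bar>a * b\<bar> \<le> a\<^sup>2 + b\<^sup>2" for a b :: real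
    using zero_le_power2[of "\<bar>a\<bar> - \<bar>b\<bar>"] mult_nonneg_nonneg[OF abs_ge_zero[of a] abs_ge_zero[of b]]
    unfolding power2_diff abs_mult power2_abs by linarith
  then show "AE x in M. norm (u x * v x) \<le> norm ((u x)\<^sup>2 + (v x)\<^sup>2)"
    by auto
qed

lemma square_integrable_cong_AE:
  assumes "square_integrable M u" "AE x in M. u x = v x" "v \<in> borel_measurable M"
  shows "square_integrable M v"
proof -
  note [measurable] = square_integrable_measurable[OF assms(1)] assms(3)
  have "integrable M (\<lambda>x. (v x)\<^sup>2) = integrable M (\<lambda>x. (u x)\<^sup>2)"
    by (rule integrable_cong_AE) (use assms(2) in auto)
  then show ?thesis
    using assms by (simp add: square_integrable_def)
qed

lemma square_integrable_bound:
  assumes "square_integrable M u" "v \<in> borel_measurable M" "AE x in M. \<bar>v x\<bar> \<le> \<bar>u x\<bar>"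
  shows "square_integrable M v"
  unfolding square_integrable_def
proof
  note [measurable] = assms(2)
  show "integrable M (\<lambda>x. (v x)\<^sup>2)"
  proof (rule Bochner_Integration.integrable_bound)
    show "integrable M (\<lambda>x. (u x)\<^sup>2)"
      by (rule square_integrable_power2[OF assms(1)])
    show "AE x in M. norm ((v x)\<^sup>2) \<le> norm ((u x)\<^sup>2)"
      using assms(3) by eventually_elim (simp add: abs_le_square_iff)
  qed simp
qed fact

lemma square_integrable_cmult:
  assumes "square_integrable M u"
  shows "square_integrable M (\<lambda>x. c * u x)"
  using assms by (auto simp: square_integrable_def power_mult_distrib)

lemma square_integrable_add:
  assumes "square_integrable M u" "square_integrable M v"
  shows "square_integrable M (\<lambda>x. u x + v x)"
  using assms integrable_mult_L2[OF assms]
  by (auto simp: square_integrable_def power2_sum mult.assoc)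

lemma square_integrable_uminus:
  assumes "square_integrable M u"
  shows "square_integrable M (\<lambda>x. - u x)"
  using square_integrable_cmult[OF assms, of "-1"] by simp

lemma square_integrable_diff:
  assumes "square_integrable M u" "square_integrable M v"
  shows "square_integrable M (\<lambda>x. u x - v x)"
  using square_integrable_add[OF assms(1) square_integrable_uminus[OF assms(2)]] by simp

lemma square_integrable_zero [simp]: "square_integrable M (\<lambda>x. 0)"
  by (simp add: square_integrable_def)

lemma square_integrable_abs:
  assumes "square_integrable M u"
  shows "square_integrable M (\<lambda>x. \<bar>u x\<bar>)"
  using assms by (auto simp: square_integrable_def)

lemma square_integrable_bounded:
  assumes "finite_measure M" "v \<in> borel_measurable M" "AE x in M. \<bar>v x\<bar> \<le> C"
  shows "square_integrable M v"
proof (rule square_integrable_bound)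
  interpret finite_measure M by fact
  show "square_integrable M (\<lambda>x. C)"
    by (simp add: square_integrable_def)
  show "AE x in M. \<bar>v x\<bar> \<le> \<bar>C\<bar>"
    using assms(3) by eventually_elim simp
qed fact

lemma square_integrable_mult_bounded:
  assumes "square_integrable M u" "v \<in> borel_measurable M" "AE x in M. \<bar>v x\<bar> \<le> C"
  shows "square_integrable M (\<lambda>x. v x * u x)"
proof (rule square_integrable_bound)
  note [measurable] = square_integrable_measurable[OF assms(1)] assms(2)
  show "square_integrable M (\<lambda>x. C * u x)"
    by (rule square_integrable_cmult) fact
  show "(\<lambda>x. v x * u x) \<in> borel_measurable M"
    by measurable
  show "AE x in M. \<bar>v x * u x\<bar> \<le> \<bar>C * u x\<bar>"
    using assms(3) by eventually_elim (auto simp: abs_mult intro!: mult_right_mono)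
qed

lemma square_integrable_integrable:
  assumes "finite_measure M" "square_integrable M u"
  shows "integrable M u"
proof -
  interpret finite_measure M by fact
  have "square_integrable M (\<lambda>x. 1)"
    by (simp add: square_integrable_def)
  from integrable_mult_L2[OF assms(2) this] show ?thesis
    by simp
qed

text \<open>The integral of (t u + v)^2 is a polynomial in t without negative values; its value at
  the minimizer -C/A gives the discriminant inequality. For A = 0 the polynomial is affine, and C
  has to vanish.\<close>

lemma Cauchy_Schwarz_L2:
  assumes "square_integrable M u" "square_integrable M v"
  shows "\<bar>\<integral>x. u x * v x \<partial>M\<bar> \<le> norm_L2 M u * norm_L2 M v"
proof -
  define A B C where "A = (\<integral>x. (u x)\<^sup>2 \<partial>M)" and "B = (\<integral>x. (v x)\<^sup>2 \<partial>M)"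
    and "C = (\<integral>x. u x * v x \<partial>M)"
  note int = square_integrable_power2[OF assms(1)] square_integrable_power2[OF assms(2)]
    integrable_mult_L2[OF assms]
  have q: "0 \<le> A * t\<^sup>2 + 2 * C * t + B" for t
  proof -
    have "(\<integral>x. (t * u x + v x)\<^sup>2 \<partial>M) = (\<integral>x. t\<^sup>2 * (u x)\<^sup>2 + (2 * t) * (u x * v x) + (v x)\<^sup>2 \<partial>M)"
      by (intro Bochner_Integration.integral_cong) (auto simp: power2_eq_square algebra_simps)
    also have "\<dots> = A * t\<^sup>2 + 2 * C * t + B"
      using int by (simp add: A_def B_def C_def)
    finally show ?thesis
      by (metis (no_types, lifting) Bochner_Integration.integral_nonneg zero_le_power2)
  qed
  have A: "A \<ge> 0" and B: "B \<ge> 0"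
    by (auto simp: A_def B_def)
  have "C\<^sup>2 \<le> A * B"
  proof (cases "A = 0")
    case True
    have "C = 0"
    proof (rule ccontr)
      assume "C \<noteq> 0"
      \<comment> \<open>For A = 0 this value of t makes the polynomial equal to -1.\<close>
      with q[of "- (B + 1) / (2 * C)"] True show False
        by (simp add: field_simps)
    qed
    then show ?thesis
      using True by simp
  next
    case False
    have "0 \<le> A * (- C / A)\<^sup>2 + 2 * C * (- C / A) + B"
      by (rule q)
    also have "\<dots> = B - C\<^sup>2 / A"
      using False by (simp add: power2_eq_square field_simps)
    finally show ?thesis
      using False A by (simp add: field_simps)
  qed
  then have "\<bar>C\<bar> \<le> sqrt (A * B)"
    by (metis real_sqrt_abs real_sqrt_le_iff)
  then show ?thesis
    by (simp add: A_def B_def C_def norm_L2_def real_sqrt_mult)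
qed

lemma norm_L2_cmult: "norm_L2 M (\<lambda>x. c * u x) = \<bar>c\<bar> * norm_L2 M u"
  by (simp add: norm_L2_def power_mult_distrib real_sqrt_mult)

lemma norm_L2_triangle:
  assumes "square_integrable M u" "square_integrable M v"
  shows "norm_L2 M (\<lambda>x. u x + v x) \<le> norm_L2 M u + norm_L2 M v"
proof (rule power2_le_imp_le)
  note int = square_integrable_power2[OF assms(1)] square_integrable_power2[OF assms(2)]
    integrable_mult_L2[OF assms]
  have "(norm_L2 M (\<lambda>x. u x + v x))\<^sup>2 = (\<integral>x. (u x)\<^sup>2 + (v x)\<^sup>2 + 2 * (u x * v x) \<partial>M)"
    by (simp add: norm_L2_power2 power2_sum mult.assoc)
  also have "\<dots> = (norm_L2 M u)\<^sup>2 + (norm_L2 M v)\<^sup>2 + 2 * (\<integral>x. u x * v x \<partial>M)"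
    using int by (simp add: norm_L2_power2)
  also have "\<dots> \<le> (norm_L2 M u + norm_L2 M v)\<^sup>2"
    using Cauchy_Schwarz_L2[OF assms] by (simp add: power2_sum)
  finally show "(norm_L2 M (\<lambda>x. u x + v x))\<^sup>2 \<le> (norm_L2 M u + norm_L2 M v)\<^sup>2" .
qed simp

lemma norm_L2_mono:
  assumes "square_integrable M v" "u \<in> borel_measurable M" "AE x in M. \<bar>u x\<bar> \<le> \<bar>v x\<bar>"
  shows "norm_L2 M u \<le> norm_L2 M v"
  unfolding norm_L2_def real_sqrt_le_iff
proof (rule integral_mono_AE)
  show "integrable M (\<lambda>x. (u x)\<^sup>2)"
    by (rule square_integrable_power2[OF square_integrable_bound[OF assms]])
  show "integrable M (\<lambda>x. (v x)\<^sup>2)"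
    by (rule square_integrable_power2[OF assms(1)])
  show "AE x in M. (u x)\<^sup>2 \<le> (v x)\<^sup>2"
    using assms(3) by eventually_elim (simp add: abs_le_square_iff)
qed

lemma norm_L2_le_bound:
  assumes "finite_measure M" "u \<in> borel_measurable M" "AE x in M. \<bar>u x\<bar> \<le> C" "0 \<le> C"
  shows "norm_L2 M u \<le> C * sqrt (measure M (space M))"
proof -
  interpret finite_measure M by fact
  have "norm_L2 M u \<le> norm_L2 M (\<lambda>x. C)"
    by (rule norm_L2_mono) (use assms in \<open>auto simp: square_integrable_def\<close>)
  also have "\<dots> = C * sqrt (measure M (space M))"
    using assms(4) by (simp add: norm_L2_def real_sqrt_mult)
  finally show ?thesis .
qed

subsection \<open>Convergence and completeness\<close>

lemma tendsto_norm_L2_add: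
  assumes "\<And>k. square_integrable M (u k)" "\<And>k. square_integrable M (v k)"
    and "(\<lambda>k. norm_L2 M (u k)) \<longlonglongrightarrow> 0" "(\<lambda>k. norm_L2 M (v k)) \<longlonglongrightarrow> 0"
  shows "(\<lambda>k. norm_L2 M (\<lambda>x. u k x + v k x)) \<longlonglongrightarrow> 0"
proof (rule tendsto_sandwich[OF _ _ tendsto_const])
  show "(\<lambda>k. norm_L2 M (u k) + norm_L2 M (v k)) \<longlonglongrightarrow> 0"
    using tendsto_add[OF assms(3,4)] by simp
qed (use norm_L2_triangle[OF assms(1,2)] in auto)

lemma tendsto_norm_L2_mono:
  assumes "\<And>k. square_integrable M (v k)" "\<And>k. u k \<in> borel_measurable M"
    and "\<And>k. AE x in M. \<bar>u k x\<bar> \<le> \<bar>v k x\<bar>" "(\<lambda>k. norm_L2 M (v k)) \<longlonglongrightarrow> 0"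
  shows "(\<lambda>k. norm_L2 M (u k)) \<longlonglongrightarrow> 0"
  by (rule tendsto_sandwich[OF _ _ tendsto_const assms(4)]) (use norm_L2_mono[OF assms(1-3)] in auto)

text \<open>Cauchy-Schwarz bounds the difference of the integrals by the distance of
  \<open>u k\<close> from v times the norm of w.\<close>

lemma tendsto_integral_mult_L2:
  assumes "\<And>k. square_integrable M (u k)" "square_integrable M v" "square_integrable M w"
    and "(\<lambda>k. norm_L2 M (\<lambda>x. v x - u k x)) \<longlonglongrightarrow> 0"
  shows "(\<lambda>k. \<integral>x. u k x * w x \<partial>M) \<longlonglongrightarrow> (\<integral>x. v x * w x \<partial>M)"
proof -
  have "(\<lambda>k. (\<integral>x. v x * w x \<partial>M) - (\<integral>x. u k x * w x \<partial>M)) \<longlonglongrightarrow> 0"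
  proof (rule Lim_null_comparison)
    show "(\<lambda>k. norm_L2 M (\<lambda>x. v x - u k x) * norm_L2 M w) \<longlonglongrightarrow> 0"
      using tendsto_mult_right[OF assms(4), of "norm_L2 M w"] by simp
    have "(\<integral>x. v x * w x \<partial>M) - (\<integral>x. u k x * w x \<partial>M) = (\<integral>x. (v x - u k x) * w x \<partial>M)" for k
      using integrable_mult_L2[OF assms(2,3)] integrable_mult_L2[OF assms(1,3)]
      by (simp add: left_diff_distrib)
    then show "\<forall>\<^sub>F k in sequentially. norm ((\<integral>x. v x * w x \<partial>M) - (\<integral>x. u k x * w x \<partial>M))
        \<le> norm_L2 M (\<lambda>x. v x - u k x) * norm_L2 M w"
      using Cauchy_Schwarz_L2[OF square_integrable_diff[OF assms(2,1)] assms(3)] by simp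
  qed
  from tendsto_diff[OF tendsto_const[of "\<integral>x. v x * w x \<partial>M"] this] show ?thesis
    by simp
qed

text \<open>The squared differences tend to 0 in L^1, which yields an almost everywhere convergent
  subsequence. Pointwise convergence is needed where a merely continuous function is applied to
  approximating test functions.\<close>

lemma tendsto_norm_L2_AE_subseq:
  assumes "\<And>k. square_integrable M (u k)" "square_integrable M v"
    and "(\<lambda>k. norm_L2 M (\<lambda>x. v x - u k x)) \<longlonglongrightarrow> 0"
  shows "\<exists>r::nat\<Rightarrow>nat. strict_mono r \<and> (AE x in M. (\<lambda>k. u (r k) x) \<longlonglongrightarrow> v x)"
proof -
  have "(\<lambda>k. (norm_L2 M (\<lambda>x. v x - u k x))\<^sup>2) \<longlonglongrightarrow> 0"
    using tendsto_power[OF assms(3), of 2] by simp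
  then have "(\<lambda>k. \<integral>x. norm ((v x - u k x)\<^sup>2) \<partial>M) \<longlonglongrightarrow> 0"
    by (simp add: norm_L2_power2)
  from tendsto_L1_AE_subseq[OF _ this] square_integrable_power2[OF square_integrable_diff[OF assms(2,1)]]
  obtain r where r: "strict_mono r" "AE x in M. (\<lambda>k. (v x - u (r k) x)\<^sup>2) \<longlonglongrightarrow> 0"
    by blast
  from r(2) have "AE x in M. (\<lambda>k. u (r k) x) \<longlonglongrightarrow> v x"
  proof eventually_elim
    case (elim x)
    then have "(\<lambda>k. v x - u (r k) x) \<longlonglongrightarrow> 0"
      by simp
    from tendsto_diff[OF tendsto_const[of "v x"] this] show ?case
      by simp
  qed
  with r(1) show ?thesis
    by blast
qed

lemma tendsto_norm_L2_dominated:
  assumes "\<And>k. u k \<in> borel_measurable M" "square_integrable M w"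
    and "AE x in M. (\<lambda>k. u k x) \<longlonglongrightarrow> 0" "\<And>k. AE x in M. \<bar>u k x\<bar> \<le> \<bar>w x\<bar>"
  shows "(\<lambda>k. norm_L2 M (u k)) \<longlonglongrightarrow> 0"
proof -
  note [measurable] = assms(1)
  have "(\<lambda>k. \<integral>x. (u k x)\<^sup>2 \<partial>M) \<longlonglongrightarrow> (\<integral>x. 0 \<partial>M)"
  proof (rule integral_dominated_convergence)
    show "integrable M (\<lambda>x. (w x)\<^sup>2)"
      by (rule square_integrable_power2[OF assms(2)])
    show "AE x in M. (\<lambda>k. (u k x)\<^sup>2) \<longlonglongrightarrow> 0"
      using assms(3) by eventually_elim (simp)
    show "AE x in M. norm ((u k x)\<^sup>2) \<le> (w x)\<^sup>2" for k
      using assms(4)[of k] by eventually_elim (simp add: abs_le_square_iff)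
  qed simp_all
  then have "(\<lambda>k. sqrt (\<integral>x. (u k x)\<^sup>2 \<partial>M)) \<longlonglongrightarrow> sqrt 0"
    by (intro tendsto_real_sqrt) simp
  then show ?thesis
    by (simp add: norm_L2_def)
qed

text \<open>Fatou's lemma for the squares. Square integrability of the limit is part of the
  conclusion, as the construction of a limit in a completeness proof demands.\<close>

lemma norm_L2_Fatou:
  assumes u: "\<And>m::nat. square_integrable M (u m)" and v: "v \<in> borel_measurable M"
    and lim: "AE x in M. (\<lambda>m. u m x) \<longlonglongrightarrow> v x"
    and bd: "\<And>m. m \<ge> N \<Longrightarrow> norm_L2 M (u m) \<le> C"
  shows "square_integrable M v" "norm_L2 M v \<le> C"
proof -
  note [measurable] = v square_integrable_measurable[OF u]
  have C: "0 \<le> C"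
    using bd[of N] norm_L2_nonneg[of M "u N"] by linarith
  have "(\<integral>\<^sup>+x. ennreal ((v x)\<^sup>2) \<partial>M) = (\<integral>\<^sup>+x. liminf (\<lambda>m. ennreal ((u m x)\<^sup>2)) \<partial>M)"
  proof (rule nn_integral_cong_AE, use lim in eventually_elim)
    case (elim x)
    then have "(\<lambda>m. ennreal ((u m x)\<^sup>2)) \<longlonglongrightarrow> ennreal ((v x)\<^sup>2)"
      by (intro tendsto_ennrealI tendsto_power)
    then show ?case
      by (metis lim_imp_Liminf trivial_limit_sequentially)
  qed
  also have "\<dots> \<le> liminf (\<lambda>m. \<integral>\<^sup>+x. ennreal ((u m x)\<^sup>2) \<partial>M)"
    by (rule nn_integral_liminf) measurable
  also have "\<dots> \<le> ennreal (C\<^sup>2)"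
  proof (rule Liminf_le)
    show "\<forall>\<^sub>F m in sequentially. (\<integral>\<^sup>+x. ennreal ((u m x)\<^sup>2) \<partial>M) \<le> ennreal (C\<^sup>2)"
      using eventually_ge_at_top[of N]
    proof eventually_elim
      case (elim m)
      have "(\<integral>\<^sup>+x. ennreal ((u m x)\<^sup>2) \<partial>M) = ennreal ((norm_L2 M (u m))\<^sup>2)"
        unfolding norm_L2_power2
        by (rule nn_integral_eq_integral) (use square_integrable_power2[OF u] in auto)
      also have "\<dots> \<le> ennreal (C\<^sup>2)"
        using bd[OF elim] by (intro ennreal_leI power_mono) auto
      finally show ?case .
    qed
  qed simp
  finally have le: "(\<integral>\<^sup>+x. ennreal ((v x)\<^sup>2) \<partial>M) \<le> ennreal (C\<^sup>2)" .
  then have "integrable M (\<lambda>x. (v x)\<^sup>2)"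
    by (intro integrableI_bounded) (auto simp: le_less_trans[OF le])
  then show v2: "square_integrable M v"
    by (simp add: square_integrable_def)
  have "ennreal ((norm_L2 M v)\<^sup>2) \<le> ennreal (C\<^sup>2)"
    using le nn_integral_eq_integral[OF square_integrable_power2[OF v2]] by (simp add: norm_L2_power2)
  then have "(norm_L2 M v)\<^sup>2 \<le> C\<^sup>2"
    by (simp add: ennreal_le_iff)
  then show "norm_L2 M v \<le> C"
    using C by (rule power2_le_imp_le)
qed

lemma norm_L2_sum_le:
  assumes "\<And>i. i \<in> I \<Longrightarrow> square_integrable M (u i)" "finite I"
  shows "square_integrable M (\<lambda>x. \<Sum>i\<in>I. u i x) \<and> norm_L2 M (\<lambda>x. \<Sum>i\<in>I. u i x) \<le> (\<Sum>i\<in>I. norm_L2 M (u i))"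
  using assms(2,1)
proof (induction I rule: finite_induct)
  case empty
  then show ?case
    by (simp add: norm_L2_def)
next
  case (insert i I)
  then have "square_integrable M (u i)"
    and IH: "square_integrable M (\<lambda>x. \<Sum>i\<in>I. u i x)" "norm_L2 M (\<lambda>x. \<Sum>i\<in>I. u i x) \<le> (\<Sum>i\<in>I. norm_L2 M (u i))"
    by auto
  with insert.hyps show ?case
    using square_integrable_add[of M "u i" "\<lambda>x. \<Sum>i\<in>I. u i x"]
      norm_L2_triangle[of M "u i" "\<lambda>x. \<Sum>i\<in>I. u i x"] by (auto intro: order_trans)
qed

text \<open>The Riesz-Fischer argument: along a subsequence whose consecutive distances are at most
  (1/2)^j, the telescoping series converges absolutely almost everywhere.\<close>

lemma complete_L2:
  assumes u: "\<And>k::nat. square_integrable M (u k)"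
    and Cauchy: "\<And>e. e > 0 \<Longrightarrow> \<exists>N. \<forall>k\<ge>N. \<forall>m\<ge>N. norm_L2 M (\<lambda>x. u k x - u m x) < e"
  obtains v where "square_integrable M v" "(\<lambda>k. norm_L2 M (\<lambda>x. v x - u k x)) \<longlonglongrightarrow> 0"
proof -
  have "\<forall>j. \<exists>N. \<forall>k\<ge>N. \<forall>m\<ge>N. norm_L2 M (\<lambda>x. u k x - u m x) < (1/2) ^ j"
    by (intro allI Cauchy) simp
  then obtain N where N: "\<And>j k m. k \<ge> N j \<Longrightarrow> m \<ge> N j \<Longrightarrow> norm_L2 M (\<lambda>x. u k x - u m x) < (1/2) ^ j"
    unfolding choice_iff by blast
  \<comment> \<open>The sum dominates every \<open>N i\<close> with i \<le> j, so from position i on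
    the subsequence stays in the range governed by \<open>N i\<close>.\<close>
  define s where "s j = (\<Sum>i\<le>j. N i) + j" for j
  have sN: "N j \<le> s i" if "j \<le> i" for i j
  proof -
    have "N j \<le> (\<Sum>i\<le>i. N i)"
      using that by (intro member_le_sum) auto
    then show ?thesis
      by (simp add: s_def)
  qed
  define d where "d j x = \<bar>u (s (Suc j)) x - u (s j) x\<bar>" for j x
  have d: "square_integrable M (d j)" for j
    unfolding d_def by (intro square_integrable_abs square_integrable_diff u)
  note [measurable] = square_integrable_measurable[OF u] square_integrable_measurable[OF d]
  have dn: "norm_L2 M (d j) \<le> (1/2) ^ j" for j
    using N[OF sN[of j "Suc j"] sN[of j j]] by (simp add: norm_L2_def d_def)
  define G where "G m x = (\<Sum>j<m. d j x)" for m x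
  \<comment> \<open>The bound 2 is the sum of the geometric series; monotone convergence turns it
    below into almost everywhere finiteness of the whole series of increments.\<close>
  have G: "square_integrable M (G m)" "norm_L2 M (G m) \<le> 2" for m
  proof -
    have "norm_L2 M (G m) \<le> (\<Sum>j<m. norm_L2 M (d j))" and "square_integrable M (G m)"
      using norm_L2_sum_le[of "{..<m}" M d] d by (auto simp: G_def[abs_def])
    moreover have "(\<Sum>j<m. norm_L2 M (d j)) \<le> (\<Sum>j<m. (1/2) ^ j)"
      by (intro sum_mono dn)
    moreover have "(\<Sum>j<m. (1/2) ^ j) \<le> (\<Sum>j. (1/2::real) ^ j)"
      by (rule sum_le_suminf) (auto simp: summable_geometric)
    moreover have "(\<Sum>j. (1/2::real) ^ j) = 2"
      using suminf_geometric[of "1/2::real"] by simp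
    ultimately show "square_integrable M (G m)" "norm_L2 M (G m) \<le> 2"
      by linarith+
  qed
  have [measurable]: "G m \<in> borel_measurable M" for m
    using G(1) by (rule square_integrable_measurable)
  have "(\<integral>\<^sup>+x. (SUP m. ennreal ((G m x)\<^sup>2)) \<partial>M) = (SUP m. \<integral>\<^sup>+x. ennreal ((G m x)\<^sup>2) \<partial>M)"
  proof (rule nn_integral_monotone_convergence_SUP)
    have "G m x \<le> G (Suc m) x" "0 \<le> G m x" for m x
      by (auto simp: G_def d_def intro: sum_nonneg)
    then show "incseq (\<lambda>m x. ennreal ((G m x)\<^sup>2))"
      by (intro incseq_SucI le_funI ennreal_leI power_mono) auto
  qed measurable
  also have "\<dots> \<le> ennreal 4"
  proof (rule SUP_least)
    fix m
    have "(\<integral>\<^sup>+x. ennreal ((G m x)\<^sup>2) \<partial>M) = ennreal ((norm_L2 M (G m))\<^sup>2)"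
      unfolding norm_L2_power2
      by (rule nn_integral_eq_integral) (use square_integrable_power2[OF G(1)] in auto)
    also have "\<dots> \<le> ennreal (2\<^sup>2)"
      by (intro ennreal_leI power_mono G) auto
    finally show "(\<integral>\<^sup>+x. ennreal ((G m x)\<^sup>2) \<partial>M) \<le> ennreal 4"
      by simp
  qed
  finally have "(\<integral>\<^sup>+x. (SUP m. ennreal ((G m x)\<^sup>2)) \<partial>M) \<noteq> \<infinity>"
    by (auto simp: top_unique)
  then have "AE x in M. (SUP m. ennreal ((G m x)\<^sup>2)) \<noteq> \<infinity>"
    by (intro nn_integral_noteq_infinite) auto
  then have conv: "AE x in M. convergent (\<lambda>j. u (s j) x)"
  proof eventually_elim
    case (elim x)
    then obtain c where c: "(SUP m. ennreal ((G m x)\<^sup>2)) = ennreal c" "c \<ge> 0"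
      by (metis ennreal_cases infinity_ennreal_def)
    have "summable (\<lambda>j. d j x)"
    proof (rule bounded_imp_summable)
      show "0 \<le> d j x" for j
        by (simp add: d_def)
      fix m
      have "ennreal ((G (Suc m) x)\<^sup>2) \<le> ennreal c"
        unfolding c(1)[symmetric] by (rule SUP_upper) simp
      then have "(G (Suc m) x)\<^sup>2 \<le> c"
        using c(2) by (simp add: ennreal_le_iff)
      then have "G (Suc m) x \<le> sqrt c"
        by (rule real_le_rsqrt)
      then show "(\<Sum>j\<le>m. d j x) \<le> sqrt c"
        by (simp add: G_def lessThan_Suc_atMost)
    qed
    then have "summable (\<lambda>j. u (s (Suc j)) x - u (s j) x)"
      unfolding d_def by (rule summable_rabs_cancel)
    then have "convergent (\<lambda>m. \<Sum>j<m. u (s (Suc j)) x - u (s j) x)"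
      by (simp add: summable_iff_convergent)
    then have "convergent (\<lambda>m. u (s m) x - u (s 0) x)"
      by (subst (asm) sum_lessThan_telescope)
    then have "convergent (\<lambda>m. (u (s m) x - u (s 0) x) + u (s 0) x)"
      by (intro convergent_add convergent_const)
    then show ?case
      by simp
  qed
  define v where "v x = lim (\<lambda>j. u (s j) x)" for x
  have [measurable]: "v \<in> borel_measurable M"
    unfolding v_def by measurable
  have lim: "AE x in M. (\<lambda>j. u (s j) x) \<longlonglongrightarrow> v x"
    using conv by eventually_elim (simp add: v_def convergent_LIMSEQ_iff)
  \<comment> \<open>The limit is compared with every \<open>u k\<close> past \<open>N j\<close> and
    not only with the subsequence, so convergence of the full sequence follows at once.\<close>
  have bd: "square_integrable M (\<lambda>x. v x - u k x) \<and> norm_L2 M (\<lambda>x. v x - u k x) \<le> (1/2) ^ j"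
    if "k \<ge> N j" for k j
  proof -
    have 1: "square_integrable M (\<lambda>x. u (s m) x - u k x)" for m
      by (intro square_integrable_diff u)
    have 2: "AE x in M. (\<lambda>m. u (s m) x - u k x) \<longlonglongrightarrow> v x - u k x"
      using lim by eventually_elim (intro tendsto_diff tendsto_const)
    have 3: "norm_L2 M (\<lambda>x. u (s m) x - u k x) \<le> (1/2) ^ j" if "m \<ge> j" for m
      using N[OF sN[OF that] \<open>k \<ge> N j\<close>] by simp
    show ?thesis
      using norm_L2_Fatou[OF 1 _ 2 3] by simp
  qed
  show ?thesis
  proof
    from bd[of 0 "N 0"] have "square_integrable M (\<lambda>x. v x - u (N 0) x)"
      by simp
    from square_integrable_add[OF this u[of "N 0"]] show "square_integrable M v"
      by simp
    show "(\<lambda>k. norm_L2 M (\<lambda>x. v x - u k x)) \<longlonglongrightarrow> 0"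
    proof (rule LIMSEQ_I)
      fix e :: real
      assume "e > 0"
      then obtain j where j: "(1/2) ^ j < e"
        using real_arch_pow_inv[of e "1/2"] by auto
      show "\<exists>no. \<forall>k\<ge>no. norm (norm_L2 M (\<lambda>x. v x - u k x) - 0) < e"
        using bd[of j] j by (intro exI[of _ "N j"]) (auto intro: le_less_trans)
    qed
  qed
qed

section \<open>Smooth functions and test functions\<close>

lemma partial_deriv_eqI:
  assumes "(\<phi> has_derivative \<phi>') (at x)"
  shows "partial_deriv i \<phi> x = \<phi>' (axis i 1)"
  using frechet_derivative_at[OF assms] by (simp add: partial_deriv_def)

lemma has_derivative_frechet: "\<phi> differentiable (at x) \<Longrightarrow> (\<phi> has_derivative frechet_derivative \<phi> (at x)) (at x)"
  by (simp add: frechet_derivative_works)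

lemma partial_deriv_add:
  assumes "\<phi> differentiable (at x)" "\<psi> differentiable (at x)"
  shows "partial_deriv i (\<lambda>x. \<phi> x + \<psi> x) x = partial_deriv i \<phi> x + partial_deriv i \<psi> x"
  using partial_deriv_eqI[OF has_derivative_add[OF assms[THEN has_derivative_frechet]]]
  by (simp add: partial_deriv_def)

lemma partial_deriv_mult:
  assumes "\<phi> differentiable (at x)" "\<psi> differentiable (at x)"
  shows "partial_deriv i (\<lambda>x. \<phi> x * \<psi> x) x = \<phi> x * partial_deriv i \<psi> x + partial_deriv i \<phi> x * \<psi> x"
  using partial_deriv_eqI[OF has_derivative_mult[OF assms[THEN has_derivative_frechet]]]
  by (simp add: partial_deriv_def)

lemma partial_deriv_const [simp]: "partial_deriv i (\<lambda>x. c) = (\<lambda>x. 0)"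
  by (intro ext partial_deriv_eqI[OF has_derivative_const])

lemma partial_deriv_coord [simp]: "partial_deriv i (\<lambda>x. x $ j) = (\<lambda>x. if i = j then 1 else 0)"
proof (intro ext)
  fix x :: "real^'a"
  have "((\<lambda>x. x $ j) has_derivative (\<lambda>x. x $ j)) (at x)"
    by (rule bounded_linear_imp_has_derivative[OF bounded_linear_vec_nth])
  from partial_deriv_eqI[OF this] show "partial_deriv i (\<lambda>x. x $ j) x = (if i = j then 1 else 0)"
    by (auto simp: axis_def)
qed

lemma partial_deriv_compose:
  assumes "(h has_real_derivative h') (at (\<phi> x))" "\<phi> differentiable (at x)"
  shows "partial_deriv i (\<lambda>x. h (\<phi> x)) x = h' * partial_deriv i \<phi> x"
    and "(\<lambda>x. h (\<phi> x)) differentiable (at x)"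
proof -
  have "((\<lambda>x. h (\<phi> x)) has_derivative (\<lambda>v. h' * frechet_derivative \<phi> (at x) v)) (at x)"
    using has_derivative_compose[OF has_derivative_frechet[OF assms(2)] assms(1)[unfolded has_field_derivative_def]]
    by (simp add: o_def)
  from partial_deriv_eqI[OF this] this
  show "partial_deriv i (\<lambda>x. h (\<phi> x)) x = h' * partial_deriv i \<phi> x"
    and "(\<lambda>x. h (\<phi> x)) differentiable (at x)"
    by (auto simp: partial_deriv_def differentiable_def)
qed

lemma Ck_Suc_imp: "Ck (Suc k) \<phi> \<Longrightarrow> Ck k \<phi>"
proof (induction k arbitrary: \<phi>)
  case 0
  then show ?case
    by (auto simp: continuous_on_eq_continuous_at differentiable_imp_continuous_within)
next
  case (Suc k)
  then show ?case
    by simp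
qed

lemma Ck_const [simp]: "Ck k (\<lambda>x. c)"
  by (induction k arbitrary: c) auto

lemma Ck_coord [simp]: "Ck k (\<lambda>x. x $ j)"
proof (cases k)
  case 0
  then show ?thesis
    by (auto intro!: continuous_intros)
next
  case (Suc m)
  have "(\<lambda>x::real^'a. x $ j) differentiable (at x)" for x
    by (rule bounded_linear_imp_differentiable[OF bounded_linear_vec_nth])
  with Suc show ?thesis
    by simp
qed

lemma Ck_add: "Ck k \<phi> \<Longrightarrow> Ck k \<psi> \<Longrightarrow> Ck k (\<lambda>x. \<phi> x + \<psi> x)"
proof (induction k arbitrary: \<phi> \<psi>)
  case 0
  then show ?case
    by (auto intro!: continuous_intros)
next
  case (Suc k)
  have "partial_deriv i (\<lambda>x. \<phi> x + \<psi> x) = (\<lambda>x. partial_deriv i \<phi> x + partial_deriv i \<psi> x)" for i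
    using Suc.prems by (auto simp: partial_deriv_add)
  with Suc show ?case
    by (auto intro!: differentiable_add)
qed

lemma Ck_mult: "Ck k \<phi> \<Longrightarrow> Ck k \<psi> \<Longrightarrow> Ck k (\<lambda>x. \<phi> x * \<psi> x)"
proof (induction k arbitrary: \<phi> \<psi>)
  case 0
  then show ?case
    by (auto intro!: continuous_intros)
next
  case (Suc k)
  have "partial_deriv i (\<lambda>x. \<phi> x * \<psi> x) = (\<lambda>x. \<phi> x * partial_deriv i \<psi> x + partial_deriv i \<phi> x * \<psi> x)" for i
    using Suc.prems by (auto simp: partial_deriv_mult)
  moreover have "Ck k \<phi>" "Ck k \<psi>"
    using Suc.prems Ck_Suc_imp by blast+
  ultimately show ?case
    using Suc by (auto intro!: differentiable_mult Ck_add)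
qed

definition smooth :: "(real^'n \<Rightarrow> real) \<Rightarrow> bool" where
  "smooth \<phi> \<longleftrightarrow> (\<forall>k. Ck k \<phi>)"

lemma smooth_const [simp]: "smooth (\<lambda>x. c)" and smooth_coord [simp]: "smooth (\<lambda>x. x $ i)"
  by (auto simp: smooth_def)

lemma smooth_add: "smooth \<phi> \<Longrightarrow> smooth \<psi> \<Longrightarrow> smooth (\<lambda>x. \<phi> x + \<psi> x)"
  and smooth_mult: "smooth \<phi> \<Longrightarrow> smooth \<psi> \<Longrightarrow> smooth (\<lambda>x. \<phi> x * \<psi> x)"
  by (auto simp: smooth_def Ck_add Ck_mult)

lemma smooth_uminus: "smooth \<phi> \<Longrightarrow> smooth (\<lambda>x. - \<phi> x)"
  using smooth_mult[OF smooth_const[of "-1"], of \<phi>] by simp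

lemma smooth_diff: "smooth \<phi> \<Longrightarrow> smooth \<psi> \<Longrightarrow> smooth (\<lambda>x. \<phi> x - \<psi> x)"
  using smooth_add[OF _ smooth_uminus, of \<phi> \<psi>] by simp

lemma smooth_power: "smooth \<phi> \<Longrightarrow> smooth (\<lambda>x. \<phi> x ^ k)"
  by (induction k) (auto intro: smooth_mult)

lemma smooth_sum: "finite I \<Longrightarrow> (\<And>i. i \<in> I \<Longrightarrow> smooth (\<phi> i)) \<Longrightarrow> smooth (\<lambda>x. \<Sum>i\<in>I. \<phi> i x)"
  by (induction I rule: finite_induct) (auto intro: smooth_add)

lemma smooth_differentiable: "smooth \<phi> \<Longrightarrow> \<phi> differentiable (at x)"
  unfolding smooth_def by (metis Ck.simps(2))

lemma smooth_partial_deriv: "smooth \<phi> \<Longrightarrow> smooth (partial_deriv i \<phi>)"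
  unfolding smooth_def by (metis Ck.simps(2))

lemma smooth_continuous: "smooth \<phi> \<Longrightarrow> continuous_on A \<phi>"
  unfolding smooth_def by (metis Ck.simps(1) continuous_on_subset subset_UNIV)

lemma continuous_measurable_lebesgue_on:
  fixes \<phi> :: "'a::euclidean_space \<Rightarrow> real"
  assumes "continuous_on UNIV \<phi>"
  shows "\<phi> \<in> borel_measurable (lebesgue_on S)"
  by (intro measurable_restrict_space1 measurable_completion) (use borel_measurable_continuous_onI[OF assms] in simp)

lemma smooth_measurable: "smooth \<phi> \<Longrightarrow> \<phi> \<in> borel_measurable (lebesgue_on S)"
  by (intro continuous_measurable_lebesgue_on smooth_continuous)

lemma test_functions_smooth: "\<phi> \<in> test_functions S \<Longrightarrow> smooth \<phi>"
  by (auto simp: test_functions_def smooth_def)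

lemma test_functionsI:
  assumes "smooth \<phi>" "compact K" "K \<subseteq> S" "\<And>x. x \<notin> K \<Longrightarrow> \<phi> x = 0"
  shows "\<phi> \<in> test_functions S"
  using assms by (auto simp: test_functions_def smooth_def)

lemma test_functionsE:
  assumes "\<phi> \<in> test_functions S"
  obtains K where "smooth \<phi>" "compact K" "K \<subseteq> S" "\<And>x. x \<notin> K \<Longrightarrow> \<phi> x = 0"
  using assms by (auto simp: test_functions_def smooth_def)

lemma test_functions_eq_0: "\<phi> \<in> test_functions S \<Longrightarrow> x \<notin> S \<Longrightarrow> \<phi> x = 0"
  by (auto simp: test_functions_def)

lemma test_functions_mono: "\<phi> \<in> test_functions S \<Longrightarrow> S \<subseteq> T \<Longrightarrow> \<phi> \<in> test_functions T"
  by (auto simp: test_functions_def)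

lemma test_functions_zero: "(\<lambda>x. 0) \<in> test_functions S"
  by (rule test_functionsI[of _ "{}"]) auto

lemma test_functions_add:
  assumes "\<phi> \<in> test_functions S" "\<psi> \<in> test_functions S"
  shows "(\<lambda>x. \<phi> x + \<psi> x) \<in> test_functions S"
proof -
  obtain K where K: "smooth \<phi>" "compact K" "K \<subseteq> S" "\<And>x. x \<notin> K \<Longrightarrow> \<phi> x = 0"
    using test_functionsE[OF assms(1)] by blast
  obtain L where L: "smooth \<psi>" "compact L" "L \<subseteq> S" "\<And>x. x \<notin> L \<Longrightarrow> \<psi> x = 0"
    using test_functionsE[OF assms(2)] by blast
  show ?thesis
    by (rule test_functionsI[of _ "K \<union> L"]) (use K L in \<open>auto intro: smooth_add\<close>)
qed

lemma test_functions_smooth_mult: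
  assumes "smooth \<theta>" "\<phi> \<in> test_functions S"
  shows "(\<lambda>x. \<theta> x * \<phi> x) \<in> test_functions S"
proof -
  obtain K where K: "smooth \<phi>" "compact K" "K \<subseteq> S" "\<And>x. x \<notin> K \<Longrightarrow> \<phi> x = 0"
    using test_functionsE[OF assms(2)] by blast
  show ?thesis
    by (rule test_functionsI[of _ K]) (use assms K in \<open>auto intro: smooth_mult\<close>)
qed

lemma test_functions_cmult: "\<phi> \<in> test_functions S \<Longrightarrow> (\<lambda>x. c * \<phi> x) \<in> test_functions S"
  by (intro test_functions_smooth_mult smooth_const)

lemma test_functions_diff:
  "\<phi> \<in> test_functions S \<Longrightarrow> \<psi> \<in> test_functions S \<Longrightarrow> (\<lambda>x. \<phi> x - \<psi> x) \<in> test_functions S"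
  using test_functions_add[of \<phi> S "\<lambda>x. (-1) * \<psi> x"] test_functions_cmult[of \<psi> S "-1"] by simp

lemma test_functions_partial_deriv:
  assumes "\<phi> \<in> test_functions S"
  shows "partial_deriv i \<phi> \<in> test_functions S"
proof -
  obtain K where K: "smooth \<phi>" "compact K" "K \<subseteq> S" "\<And>x. x \<notin> K \<Longrightarrow> \<phi> x = 0"
    using test_functionsE[OF assms] by blast
  have "partial_deriv i \<phi> x = 0" if "x \<notin> K" for x
  proof -
    have "((\<lambda>x. 0) has_derivative (\<lambda>x. 0)) (at x)"
      by simp
    then have "(\<phi> has_derivative (\<lambda>x. 0)) (at x)"
      by (rule has_derivative_transform_within_open[of _ _ _ _ "- K"])
        (use K that compact_imp_closed in auto)
    from partial_deriv_eqI[OF this] show ?thesis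
      by simp
  qed
  then show ?thesis
    by (intro test_functionsI[of _ K] smooth_partial_deriv K)
qed

text \<open>1 - ab = (1 - a) + (1 - b) - (1 - a)(1 - b). Functions that equal 1 outside a compact
  subset of S are thus closed under products, which is how indicators of open sets are approximated
  later.\<close>

lemma test_functions_compl_mult:
  assumes "(\<lambda>x. 1 - \<phi> x) \<in> test_functions S" "(\<lambda>x. 1 - \<psi> x) \<in> test_functions S"
  shows "(\<lambda>x. 1 - \<phi> x * \<psi> x) \<in> test_functions S"
proof -
  have "(\<lambda>x. ((1 - \<phi> x) + (1 - \<psi> x)) - (1 - \<phi> x) * (1 - \<psi> x)) \<in> test_functions S"
    by (intro test_functions_diff test_functions_add test_functions_smooth_mult assms
        test_functions_smooth[OF assms(1)])
  then show ?thesis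
    by (simp add: algebra_simps)
qed

lemma test_functions_compl_power:
  assumes "(\<lambda>x. 1 - \<phi> x) \<in> test_functions S"
  shows "(\<lambda>x. 1 - \<phi> x ^ k) \<in> test_functions S"
  by (induction k) (auto simp: test_functions_zero intro: test_functions_compl_mult assms)

lemma test_functions_compl_prod:
  assumes "finite I" "\<And>i. i \<in> I \<Longrightarrow> (\<lambda>x. 1 - \<phi> i x) \<in> test_functions S"
  shows "(\<lambda>x. 1 - (\<Prod>i\<in>I. \<phi> i x)) \<in> test_functions S"
  using assms by (induction I rule: finite_induct) (auto simp: test_functions_zero intro: test_functions_compl_mult)

lemma test_functions_bounded:
  assumes "\<phi> \<in> test_functions S"
  obtains C where "C > 0" "\<And>x. \<bar>\<phi> x\<bar> \<le> C"
proof -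
  obtain K where K: "smooth \<phi>" "compact K" "K \<subseteq> S" "\<And>x. x \<notin> K \<Longrightarrow> \<phi> x = 0"
    using test_functionsE[OF assms] by blast
  have "bounded (\<phi> ` K)"
    by (intro compact_imp_bounded compact_continuous_image smooth_continuous K)
  then obtain C where C: "C > 0" "\<And>x. x \<in> K \<Longrightarrow> \<bar>\<phi> x\<bar> \<le> C"
    by (auto simp: bounded_pos)
  have "\<bar>\<phi> x\<bar> \<le> C" for x
    using C K(4)[of x] by (cases "x \<in> K") auto
  with C(1) that show ?thesis
    by blast
qed

section \<open>Square integrability on bounded sets\<close>

lemma finite_measure_lebesgue_on_bounded:
  fixes S :: "'a::euclidean_space set"
  assumes "bounded S" "S \<in> sets lebesgue"
  shows "finite_measure (lebesgue_on S)"
proof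
  have "emeasure lebesgue S < \<infinity>"
    using fmeasurableD2[OF bounded_set_imp_lmeasurable[OF assms]] unfolding infinity_ennreal_def less_top .
  then show "emeasure (lebesgue_on S) (space (lebesgue_on S)) \<noteq> \<infinity>"
    using assms(2) by (simp add: emeasure_restrict_space del: emeasure_completion)
qed

lemma test_functions_square_integrable:
  assumes "\<phi> \<in> test_functions T" "bounded S" "S \<in> sets lebesgue"
  shows "square_integrable (lebesgue_on S) \<phi>"
proof -
  obtain C where "\<And>x. \<bar>\<phi> x\<bar> \<le> C"
    using test_functions_bounded[OF assms(1)] by blast
  then show ?thesis
    by (intro square_integrable_bounded[of _ _ C] finite_measure_lebesgue_on_bounded assms
        smooth_measurable test_functions_smooth[OF assms(1)]) auto
qed

lemma smooth_bounded_on: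
  assumes "smooth \<phi>" "bounded S"
  obtains C where "C > 0" "\<And>x. x \<in> S \<Longrightarrow> \<bar>\<phi> x\<bar> \<le> C"
proof -
  have "bounded (\<phi> ` closure S)"
    by (intro compact_imp_bounded compact_continuous_image smooth_continuous assms) (simp add: assms(2))
  then obtain C where "C > 0" "\<And>x. x \<in> closure S \<Longrightarrow> \<bar>\<phi> x\<bar> \<le> C"
    by (auto simp: bounded_pos)
  with that closure_subset[of S] show ?thesis
    by blast
qed

lemma smooth_square_integrable:
  assumes "smooth \<phi>" "bounded S" "S \<in> sets lebesgue"
  shows "square_integrable (lebesgue_on S) \<phi>"
proof -
  obtain C where "\<And>x. x \<in> S \<Longrightarrow> \<bar>\<phi> x\<bar> \<le> C"
    using smooth_bounded_on[OF assms(1,2)] by blast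
  then show ?thesis
    by (intro square_integrable_bounded[of _ _ C] finite_measure_lebesgue_on_bounded assms smooth_measurable AE_I2) auto
qed

subsection \<open>Integration by parts\<close>

text \<open>Lebesgue measure on S is a restricted completion, whereas translation invariance is
  applied to \<open>lborel\<close>; for Borel functions that vanish outside S the passage costs
  nothing.\<close>

lemma integral_lebesgue_on_eq_lborel:
  fixes f :: "real^'n \<Rightarrow> real"
  assumes "S \<in> sets lebesgue" "f \<in> borel_measurable borel" "\<And>x. x \<notin> S \<Longrightarrow> f x = 0"
  shows "(LINT x|lebesgue_on S. f x) = (LINT x|lborel. f x)"
proof -
  have "(LINT x|lebesgue_on S. f x) = (LINT x|lebesgue. indicator S x *\<^sub>R f x)"
    by (rule integral_restrict_space) (use assms(1) in auto)
  also have "(\<lambda>x. indicator S x *\<^sub>R f x) = f"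
    using assms(3) by (intro ext) (auto simp: indicator_def)
  also have "(LINT x|lebesgue. f x) = (LINT x|lborel. f x)"
    by (rule integral_completion) (use assms(2) in simp)
  finally show ?thesis .
qed

lemma partial_deriv_line:
  assumes "\<phi> differentiable (at (x + t *\<^sub>R axis i 1))"
  shows "((\<lambda>s. \<phi> (x + s *\<^sub>R axis i 1)) has_real_derivative partial_deriv i \<phi> (x + t *\<^sub>R axis i 1)) (at t)"
proof -
  have "((\<lambda>s::real. x + s *\<^sub>R axis i 1) has_derivative (\<lambda>s. s *\<^sub>R axis i 1)) (at t)"
    by (auto intro!: derivative_eq_intros)
  from has_derivative_compose[OF this has_derivative_frechet[OF assms]]
  have "((\<lambda>s. \<phi> (x + s *\<^sub>R axis i 1)) has_derivative
      (\<lambda>s. frechet_derivative \<phi> (at (x + t *\<^sub>R axis i 1)) (s *\<^sub>R axis i 1))) (at t)" .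
  moreover have "frechet_derivative \<phi> (at (x + t *\<^sub>R axis i 1)) (s *\<^sub>R axis i 1) = partial_deriv i \<phi> (x + t *\<^sub>R axis i 1) * s" for s
    using linear_scale[OF linear_frechet_derivative[OF assms]] by (simp add: partial_deriv_def)
  ultimately show ?thesis
    by (simp add: has_field_derivative_def)
qed

text \<open>By translation invariance the integral of every difference quotient vanishes; dominated
  convergence then passes to the derivative.\<close>

lemma integral_partial_deriv_test:
  assumes "S \<in> sets lebesgue" and \<phi>: "\<phi> \<in> test_functions S"
  shows "(LINT x|lebesgue_on S. partial_deriv i \<phi> x) = 0"
proof -
  let ?e = "axis i 1 :: real^'a"
  obtain K where K: "smooth \<phi>" "compact K" "K \<subseteq> S" "\<And>x. x \<notin> K \<Longrightarrow> \<phi> x = 0"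
    using test_functionsE[OF \<phi>] by blast
  have d: "\<phi> differentiable (at x)" for x
    by (rule smooth_differentiable[OF K(1)])
  have [measurable]: "\<phi> \<in> borel_measurable borel" "partial_deriv i \<phi> \<in> borel_measurable borel"
    by (auto intro!: borel_measurable_continuous_onI smooth_continuous smooth_partial_deriv K)
  obtain C where C: "C > 0" "\<And>x. \<bar>partial_deriv i \<phi> x\<bar> \<le> C"
    using test_functions_bounded[OF test_functions_partial_deriv[OF \<phi>]] by blast
  obtain \<rho> where \<rho>: "\<And>x. x \<in> K \<Longrightarrow> norm x \<le> \<rho>"
    using compact_imp_bounded[OF K(2)] by (auto simp: bounded_iff)
  \<comment> \<open>All increments are at most 1, so every difference quotient vanishes outside the
    ball of radius \<open>\<rho> + 1\<close>, which carries the dominating function.\<close>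
  define h where "h m = 1 / (real m + 1)" for m
  have h: "0 < h m" "h m \<le> 1" for m
    by (auto simp: h_def)
  define D where "D m x = (\<phi> (x + h m *\<^sub>R ?e) - \<phi> x) / h m" for m x
  have [measurable]: "D m \<in> borel_measurable borel" for m
    unfolding D_def by measurable
  have integrable: "integrable lborel \<phi>"
  proof -
    obtain B where B: "\<And>x. \<bar>\<phi> x\<bar> \<le> B"
      using test_functions_bounded[OF \<phi>] by blast
    show ?thesis
    proof (rule Bochner_Integration.integrable_bound)
      show "AE x in lborel. norm (\<phi> x) \<le> norm (B * indicator K x)"
        using B K(4) by (intro AE_I2) (auto simp: indicator_def intro: order_trans[OF _ abs_ge_self])
      show "integrable lborel (\<lambda>x. B * indicator K x)"
        using K(2) by (intro integrable_mult_right) (simp add: integrable_indicator_iff emeasure_bounded_finite[unfolded infinity_ennreal_def] compact_imp_bounded borel_compact)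
    qed simp
  qed
  have D0: "(LINT x|lborel. D m x) = 0" for m
  proof -
    have dist: "distr lborel borel (\<lambda>x. h m *\<^sub>R ?e + x) = lborel"
      by (rule lborel_distr_plus)
    have "integrable (distr lborel borel (\<lambda>x. h m *\<^sub>R ?e + x)) \<phi>"
      unfolding dist by (rule integrable)
    then have i: "integrable lborel (\<lambda>x. \<phi> (x + h m *\<^sub>R ?e))"
      by (subst (asm) integrable_distr_eq) (auto simp: add.commute)
    have "(LINT x|lborel. \<phi> (x + h m *\<^sub>R ?e)) = (LINT x|distr lborel borel (\<lambda>x. h m *\<^sub>R ?e + x). \<phi> x)"
      by (subst integral_distr) (auto simp: add.commute)
    then show ?thesis
      unfolding D_def using i integrable by (simp add: dist)
  qed
  have "(\<lambda>m. LINT x|lborel. D m x) \<longlonglongrightarrow> (LINT x|lborel. partial_deriv i \<phi> x)"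
  proof (rule integral_dominated_convergence)
    show "integrable lborel (\<lambda>x. C * indicator (cball (0::real^'a) (\<rho> + 1)) x)"
      by (intro integrable_mult_right) (simp add: integrable_indicator_iff emeasure_bounded_finite[unfolded infinity_ennreal_def])
    show "AE x in lborel. (\<lambda>m. D m x) \<longlonglongrightarrow> partial_deriv i \<phi> x"
    proof (rule AE_I2)
      fix x
      have "((\<lambda>s. (\<phi> (x + s *\<^sub>R ?e) - \<phi> x) / s) \<longlongrightarrow> partial_deriv i \<phi> x) (at 0)"
        using partial_deriv_line[of \<phi> x 0 i] d by (simp add: DERIV_def)
      moreover have "filterlim h (at 0) sequentially"
      proof -
        have "h \<longlonglongrightarrow> 0"
          unfolding h_def using LIMSEQ_inverse_real_of_nat by (simp add: field_simps)
        then show ?thesis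
          using h by (auto simp: filterlim_at intro!: always_eventually) (metis less_irrefl)
      qed
      ultimately show "(\<lambda>m. D m x) \<longlonglongrightarrow> partial_deriv i \<phi> x"
        unfolding D_def by (rule filterlim_compose)
    qed
    show "AE x in lborel. norm (D m x) \<le> C * indicator (cball (0::real^'a) (\<rho> + 1)) x" for m
    proof (rule AE_I2)
      fix x
      show "norm (D m x) \<le> C * indicator (cball (0::real^'a) (\<rho> + 1)) x"
      proof (cases "x \<in> cball 0 (\<rho> + 1)")
        case False
        then have "x \<notin> K" "x + h m *\<^sub>R ?e \<notin> K"
          using \<rho>[of x] \<rho>[of "x + h m *\<^sub>R ?e"] norm_triangle_ineq2[of x "- h m *\<^sub>R ?e"] h[of m]
          by (auto simp: norm_axis_1)
        then show ?thesis
          using False K(4) by (simp add: D_def)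
      next
        case True
        obtain z where "\<phi> (x + h m *\<^sub>R ?e) - \<phi> (x + 0 *\<^sub>R ?e) = (h m - 0) * partial_deriv i \<phi> (x + z *\<^sub>R ?e)"
          using MVT2[OF h(1)[of m], of "\<lambda>s. \<phi> (x + s *\<^sub>R ?e)" "\<lambda>s. partial_deriv i \<phi> (x + s *\<^sub>R ?e)"]
            partial_deriv_line d by blast
        then have "D m x = partial_deriv i \<phi> (x + z *\<^sub>R ?e)"
          using h(1)[of m] by (simp add: D_def)
        then show ?thesis
          using True C(2) by simp
      qed
    qed
  qed measurable
  then have "(LINT x|lborel. partial_deriv i \<phi> x) = 0"
    using D0 by (simp add: LIMSEQ_const_iff)
  moreover have "(LINT x|lebesgue_on S. partial_deriv i \<phi> x) = (LINT x|lborel. partial_deriv i \<phi> x)"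
    by (rule integral_lebesgue_on_eq_lborel)
      (auto intro: assms test_functions_eq_0 test_functions_partial_deriv)
  ultimately show ?thesis
    by simp
qed

text \<open>The product of \<open>\<theta>\<close> and \<open>\<phi>\<close> is again a test
  function, so its partial derivatives have integral 0. Since \<open>\<theta>\<close> may be nonzero
  at the boundary, coordinate functions can take its place.\<close>

lemma integration_by_parts_test:
  assumes S: "bounded S" "S \<in> sets lebesgue" and "smooth \<theta>" "\<phi> \<in> test_functions S"
  shows "(LINT x|lebesgue_on S. \<theta> x * partial_deriv i \<phi> x) = - (LINT x|lebesgue_on S. partial_deriv i \<theta> x * \<phi> x)"
proof -
  have eq: "partial_deriv i (\<lambda>x. \<theta> x * \<phi> x) = (\<lambda>x. \<theta> x * partial_deriv i \<phi> x + partial_deriv i \<theta> x * \<phi> x)"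
    by (intro ext partial_deriv_mult smooth_differentiable assms(3) test_functions_smooth[OF assms(4)])
  have "(LINT x|lebesgue_on S. partial_deriv i (\<lambda>x. \<theta> x * \<phi> x) x) = 0"
    by (intro integral_partial_deriv_test test_functions_smooth_mult assms)
  moreover have "integrable (lebesgue_on S) (\<lambda>x. \<theta> x * partial_deriv i \<phi> x)"
    "integrable (lebesgue_on S) (\<lambda>x. partial_deriv i \<theta> x * \<phi> x)"
    by (intro integrable_mult_L2 smooth_square_integrable smooth_partial_deriv S assms(3)
        test_functions_smooth[OF assms(4)])+
  ultimately show ?thesis
    unfolding eq by simp
qed

subsection \<open>Bump functions\<close>

text \<open>For j = 0 this is the classical smooth function exp(-1/t), extended by 0. The powers of
  1/t are present because differentiation produces them: up to linear combinations the family is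
  closed under derivatives.\<close>

definition flat :: "nat \<Rightarrow> real \<Rightarrow> real" where
  "flat j t = (if t > 0 then (1 / t) ^ j * exp (- (1 / t)) else 0)"

lemma flat_tendsto_0: "(flat j \<longlongrightarrow> 0) (at 0)"
proof -
  have "((\<lambda>s::real. s ^ j / exp s) \<longlongrightarrow> 0) at_top"
    by (rule tendsto_power_div_exp_0)
  moreover have "filterlim (\<lambda>t::real. 1 / t) at_top (at_right 0)"
    using filterlim_inverse_at_top_right by (simp add: inverse_eq_divide)
  ultimately have "((\<lambda>t::real. (1 / t) ^ j / exp (1 / t)) \<longlongrightarrow> 0) (at_right 0)"
    by (rule filterlim_compose)
  moreover have "\<forall>\<^sub>F t in at_right 0. (1 / t) ^ j / exp (1 / t) = flat j t"
    using eventually_at_right_less[of 0]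
    by eventually_elim (simp add: flat_def exp_minus divide_inverse)
  ultimately have "(flat j \<longlongrightarrow> 0) (at_right 0)"
    by (rule Lim_transform_eventually)
  moreover have "(flat j \<longlongrightarrow> 0) (at_left 0)"
  proof (rule Lim_transform_eventually[OF tendsto_const])
    have "\<forall>\<^sub>F t in at_left 0. t < (0::real)"
      by (simp add: eventually_at_filter)
    then show "\<forall>\<^sub>F t in at_left 0. 0 = flat j t"
      by eventually_elim (simp add: flat_def)
  qed
  ultimately show ?thesis
    by (simp add: filterlim_at_split)
qed

lemma flat_deriv: "(flat j has_real_derivative flat (j + 2) t - real j * flat (j + 1) t) (at t)"
proof -
  consider "t < 0" | "t = 0" | "t > 0"
    by linarith
  then show ?thesis
  proof cases
    case 1
    have "((\<lambda>t. 0) has_real_derivative 0) (at t)"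
      by simp
    then have "(flat j has_real_derivative 0) (at t)"
      by (rule has_field_derivative_transform_within_open[of _ _ _ "{..<0}"]) (use 1 in \<open>auto simp: flat_def\<close>)
    then show ?thesis
      using 1 by (simp add: flat_def)
  next
    case 2
    \<comment> \<open>At 0 the difference quotient of \<open>flat j\<close> is
      \<open>flat (Suc j)\<close>, whose limit is known to be 0.\<close>
    have "((\<lambda>h. (flat j (0 + h) - flat j 0) / h) \<longlongrightarrow> 0) (at 0)"
      by (rule Lim_transform_eventually[OF flat_tendsto_0[of "Suc j"]])
        (auto simp: flat_def eventually_at_filter field_simps)
    then show ?thesis
      using 2 by (simp add: DERIV_def flat_def)
  next
    case 3
    have d: "((\<lambda>t::real. 1 / t) has_real_derivative - (1 / t)\<^sup>2) (at t)"
      using DERIV_inverse[of t UNIV] 3 by (simp add: inverse_eq_divide power2_eq_square)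
    have "(1 / t) ^ j * (exp (- (1 / t)) * - (- (1 / t)\<^sup>2)) + real j * (- (1 / t)\<^sup>2 * (1 / t) ^ (j - Suc 0)) * exp (- (1 / t))
        = flat (j + 2) t - real j * flat (j + 1) t"
      using 3 by (cases j) (simp_all add: flat_def power2_eq_square)
    with DERIV_mult'[OF DERIV_power[OF d, of j] DERIV_fun_exp[OF DERIV_minus[OF d]]]
    have "((\<lambda>t. (1 / t) ^ j * exp (- (1 / t))) has_real_derivative flat (j + 2) t - real j * flat (j + 1) t) (at t)"
      by (simp only: of_nat_eq_iff)
    then show ?thesis
      by (rule has_field_derivative_transform_within_open[of _ _ _ "{0<..}"]) (use 3 in \<open>auto simp: flat_def\<close>)
  qed
qed

text \<open>Differentiation trades \<open>flat j\<close> for \<open>flat (j + 2)\<close> and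
  \<open>flat (j + 1)\<close>, so the induction on k runs over all j simultaneously.\<close>

lemma Ck_flat_compose: "smooth q \<Longrightarrow> Ck k (\<lambda>x. flat j (q x))"
proof (induction k arbitrary: j)
  case 0
  have "continuous_on UNIV (flat j)"
    by (intro continuous_at_imp_continuous_on ballI DERIV_isCont[OF flat_deriv])
  then show ?case
    using smooth_continuous[OF 0, of UNIV] by (auto intro: continuous_on_compose2)
next
  case (Suc k)
  have q: "q differentiable (at x)" for x
    by (rule smooth_differentiable[OF Suc.prems])
  have eq: "partial_deriv i (\<lambda>x. flat j (q x)) =
      (\<lambda>x. (flat (j + 2) (q x) + (- real j) * flat (j + 1) (q x)) * partial_deriv i q x)" for i
    by (intro ext, subst partial_deriv_compose(1)[OF flat_deriv q]) simp
  have "Ck k (partial_deriv i q)" for i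
    using smooth_partial_deriv[OF Suc.prems] by (simp add: smooth_def)
  then have "Ck k (partial_deriv i (\<lambda>x. flat j (q x)))" for i
    unfolding eq by (intro Ck_mult Ck_add Ck_const Suc)
  then show ?case
    using partial_deriv_compose(2)[OF flat_deriv q] by simp
qed

text \<open>The squared distance is a polynomial in the coordinates, so the composition stays smooth
  at the center as well.\<close>

definition bump :: "real^'n \<Rightarrow> real \<Rightarrow> real^'n \<Rightarrow> real" where
  "bump a \<rho> x = flat 0 (\<rho>\<^sup>2 - (norm (x - a))\<^sup>2)"

lemma bump_pos: "x \<in> ball a \<rho> \<Longrightarrow> 0 < bump a \<rho> x"
proof -
  assume x: "x \<in> ball a \<rho>"
  then have "(norm (x - a))\<^sup>2 < \<rho>\<^sup>2"
    by (intro power_strict_mono) (auto simp: dist_norm norm_minus_commute)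
  then show ?thesis
    by (simp add: bump_def flat_def)
qed

lemma bump_eq_0: "0 \<le> \<rho> \<Longrightarrow> x \<notin> ball a \<rho> \<Longrightarrow> bump a \<rho> x = 0"
proof -
  assume "0 \<le> \<rho>" "x \<notin> ball a \<rho>"
  then have "\<rho>\<^sup>2 \<le> (norm (x - a))\<^sup>2"
    by (intro power_mono) (auto simp: dist_norm norm_minus_commute)
  then show ?thesis
    by (simp add: bump_def flat_def)
qed

lemma bump_nonneg: "0 \<le> bump a \<rho> x" and bump_le_1: "bump a \<rho> x \<le> 1"
  by (auto simp: bump_def flat_def)

lemma smooth_norm_power2: "smooth (\<lambda>x. (norm (x - a))\<^sup>2)"
proof -
  have eq: "(\<lambda>x. (norm (x - a))\<^sup>2) = (\<lambda>x. \<Sum>i\<in>UNIV. (x $ i - a $ i) ^ 2)"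
    unfolding power2_norm_eq_inner inner_vec_def by (simp add: power2_eq_square)
  show ?thesis
    unfolding eq by (intro smooth_sum smooth_power smooth_diff) auto
qed

lemma bump_test: 
  assumes "cball a \<rho> \<subseteq> S" "0 \<le> \<rho>"
  shows "bump a \<rho> \<in> test_functions S"
proof (rule test_functionsI)
  have "smooth (\<lambda>x. \<rho>\<^sup>2 - (norm (x - a))\<^sup>2)"
    by (intro smooth_diff smooth_const smooth_norm_power2)
  then show "smooth (bump a \<rho>)"
    unfolding bump_def[abs_def] smooth_def[of "\<lambda>x. flat 0 (\<rho>\<^sup>2 - (norm (x - a))\<^sup>2)"]
    by (intro allI Ck_flat_compose)
  show "bump a \<rho> x = 0" if "x \<notin> cball a \<rho>" for x
    using bump_eq_0[of \<rho> x a] that assms(2) by auto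
qed (use assms in auto)

section \<open>The fundamental lemma of the calculus of variations\<close>

text \<open>By Lindelof, countably many balls whose closures lie in U cover U. Finite products of
  powers of 1 - bump are 1 outside these balls and tend to 0 inside; subtracting them from 1 leaves
  test functions.\<close>

lemma test_functions_approximate_open:
  fixes U :: "(real^'n) set"
  assumes "open U"
  obtains \<theta> :: "nat \<Rightarrow> real^'n \<Rightarrow> real" where "\<And>k. \<theta> k \<in> test_functions U" "\<And>k x. \<bar>\<theta> k x\<bar> \<le> 1"
    "\<And>x. (\<lambda>k. \<theta> k x) \<longlonglongrightarrow> indicator U x"
proof (cases "U = {}")
  case True
  show ?thesis
  proof (rule that[of "\<lambda>k x. 0"])
    show "(\<lambda>x. 0) \<in> test_functions U"
      by (rule test_functions_zero)
    show "(\<lambda>k. 0) \<longlonglongrightarrow> (indicator U x :: real)" for x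
      unfolding True by simp
  qed simp
next
  case False
  define F where "F = {B. \<exists>a \<rho>. 0 < \<rho> \<and> cball a \<rho> \<subseteq> U \<and> B = ball a \<rho>}"
  have "open B" if "B \<in> F" for B
    using that by (auto simp: F_def)
  from Lindelof[OF this] obtain F' where F': "F' \<subseteq> F" "countable F'" "\<Union>F' = \<Union>F"
    by blast
  have "x \<in> \<Union>F" if "x \<in> U" for x
  proof -
    obtain e where "0 < e" "cball x e \<subseteq> U"
      using assms[unfolded open_contains_cball] \<open>x \<in> U\<close> by meson
    then have "ball x e \<in> F"
      by (auto simp: F_def)
    moreover have "x \<in> ball x e"
      using \<open>0 < e\<close> by simp
    ultimately show ?thesis
      by blast
  qed
  moreover have "\<Union>F \<subseteq> U"
  proof (rule Union_least)
    fix B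
    assume "B \<in> F"
    then obtain a \<rho> where "cball a \<rho> \<subseteq> U" "B = ball a \<rho>"
      by (auto simp: F_def)
    then show "B \<subseteq> U"
      using ball_subset_cball[of a \<rho>] by blast
  qed
  ultimately have U: "\<Union>F' = U"
    using F' by blast
  then have "F' \<noteq> {}"
    using False by auto
  define B where "B n = from_nat_into F' n" for n
  have B: "B n \<in> F" for n
    using F'(1) from_nat_into[OF \<open>F' \<noteq> {}\<close>, of n] by (auto simp: B_def)
  have UB: "U = (\<Union>n. B n)"
    using U range_from_nat_into[OF \<open>F' \<noteq> {}\<close> F'(2)] unfolding B_def by simp
  have "\<exists>p. 0 < snd p \<and> cball (fst p) (snd p) \<subseteq> U \<and> B n = ball (fst p) (snd p)" for n
    using B[of n] by (auto simp: F_def)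
  then have "\<forall>n. \<exists>p. 0 < snd p \<and> cball (fst p) (snd p) \<subseteq> U \<and> B n = ball (fst p) (snd p)"
    by (rule allI)
  from choice[OF this] obtain p where
    p: "\<forall>n. 0 < snd (p n) \<and> cball (fst (p n)) (snd (p n)) \<subseteq> U \<and> B n = ball (fst (p n)) (snd (p n))"
    by (rule exE)
  define a \<rho> where "a n = fst (p n)" and "\<rho> n = snd (p n)" for n
  have a\<rho>: "0 < \<rho> n" "cball (a n) (\<rho> n) \<subseteq> U" "B n = ball (a n) (\<rho> n)" for n
    using p by (simp_all add: a_def \<rho>_def)
  define c where "c n x = 1 - bump (a n) (\<rho> n) x" for n x
  have c: "0 \<le> c n x" "c n x \<le> 1" for n x
    using bump_nonneg[of "a n" "\<rho> n" x] bump_le_1[of "a n" "\<rho> n" x] by (auto simp: c_def)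
  \<comment> \<open>The index k does two jobs: it admits one more ball at each stage, and as an
    exponent it drives a factor below 1 to 0.\<close>
  define \<theta> where "\<theta> k x = 1 - (\<Prod>j\<le>k. c j x ^ k)" for k x
  have P: "0 \<le> (\<Prod>j\<le>k. c j x ^ k)" "(\<Prod>j\<le>k. c j x ^ k) \<le> 1" for k x
    using c by (simp_all add: prod_nonneg prod_le_1 power_le_one)
  show ?thesis
  proof (rule that[of \<theta>])
    fix k
    have "(\<lambda>x. 1 - c j x) \<in> test_functions U" for j
      using bump_test[OF a\<rho>(2)[of j]] less_imp_le[OF a\<rho>(1)[of j]] by (simp add: c_def)
    then show "\<theta> k \<in> test_functions U"
      unfolding \<theta>_def[abs_def]
      by (intro test_functions_compl_prod test_functions_compl_power) auto
  next
    fix k x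
    show "\<bar>\<theta> k x\<bar> \<le> 1"
      using P[where k = k and x = x] by (simp add: \<theta>_def)
  next
    fix x
    show "(\<lambda>k. \<theta> k x) \<longlonglongrightarrow> indicator U x"
    proof (cases "x \<in> U")
      case True
      then obtain n where "x \<in> B n"
        using UB by blast
      then have "c n x < 1"
        using bump_pos[of x "a n" "\<rho> n"] a\<rho> by (simp add: c_def)
      have "(\<lambda>k. \<Prod>j\<le>k. c j x ^ k) \<longlonglongrightarrow> 0"
      proof (rule tendsto_sandwich[OF _ _ tendsto_const])
        show "(\<lambda>k. c n x ^ k) \<longlonglongrightarrow> 0"
          using c \<open>c n x < 1\<close> by (intro LIMSEQ_realpow_zero) auto
        show "\<forall>\<^sub>F k in sequentially. (\<Prod>j\<le>k. c j x ^ k) \<le> c n x ^ k"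
          using eventually_ge_at_top[of n]
        proof eventually_elim
          case (elim k)
          have "(\<Prod>j\<le>k. c j x ^ k) = c n x ^ k * (\<Prod>j\<in>{..k} - {n}. c j x ^ k)"
            using elim by (intro prod.remove) auto
          also have "\<dots> \<le> c n x ^ k * 1"
            using c by (intro mult_left_mono prod_le_1) (auto intro: power_le_one)
          finally show ?case
            by simp
        qed
      qed (use P in auto)
      from tendsto_diff[OF tendsto_const[of 1] this] show ?thesis
        using True by (simp add: \<theta>_def)
    next
      case False
      have "c j x = 1" for j
        using False UB bump_eq_0[of "\<rho> j" x "a j"] a\<rho>(1)[of j] a\<rho>(3)[of j] by (auto simp: c_def)
      then show ?thesis
        using False by (simp add: \<theta>_def)
    qed
  qed
qed

text \<open>Up to a null set, the set where g is positive is a countable intersection of open sets.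
  The integrals over the decreasing finite intersections vanish, and in the limit so does the
  integral of the positive part. It is applied to g and to -g.\<close>

lemma AE_eq_0_if_integral_indicator_open:
  fixes g :: "real^'n \<Rightarrow> real"
  assumes S: "open S" and g: "integrable (lebesgue_on S) g"
    and zero: "\<And>U. open U \<Longrightarrow> U \<subseteq> S \<Longrightarrow> (LINT x|lebesgue_on S. g x * indicator U x) = 0"
  shows "AE x in lebesgue_on S. g x \<le> 0"
proof -
  let ?M = "lebesgue_on S"
  have S_lebesgue: "S \<in> sets lebesgue"
    using S by auto
  have [measurable]: "g \<in> borel_measurable ?M"
    using g by (rule borel_measurable_integrable)
  define E where "E = {x \<in> S. g x > 0}"
  have "{x \<in> space ?M. g x > 0} \<in> sets ?M"
    by measurable
  then have "E \<in> sets ?M"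
    by (simp add: E_def)
  then have E: "E \<in> sets lebesgue"
    using S_lebesgue by (simp add: sets_restrict_space_iff)
  then obtain C T where C: "gdelta C" "T \<in> null_sets lebesgue" "E \<union> T = C" "disjnt E T"
    by (rule lebesgue_set_almost_gdelta)
  from C(1) obtain F :: "nat \<Rightarrow> (real^'n) set" where F: "\<And>n. open (F n)" "C = (\<Inter>n. F n)"
    by (cases rule: gdelta.cases) blast
  define U where "U k = S \<inter> (\<Inter>j\<le>k. F j)" for k
  have U: "open (U k)" "U k \<subseteq> S" for k
    unfolding U_def by (intro open_Int S open_INT F(1) ballI finite_atMost) blast
  have ind: "(\<lambda>k. indicator (U k) x :: real) \<longlonglongrightarrow> indicator (S \<inter> C) x" for x
  proof (cases "x \<in> S \<inter> C")
    case True
    then have "x \<in> U k" for k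
      using True F(2) by (auto simp: U_def)
    then show ?thesis
      using True by simp
  next
    case False
    show ?thesis
    proof (cases "x \<in> S")
      case True
      with False obtain n where n: "x \<notin> F n"
        using F by auto
      have "\<forall>\<^sub>F k in sequentially. indicator (U k) x = (0::real)"
        using eventually_ge_at_top[of n] by eventually_elim (use n in \<open>auto simp: U_def indicator_def\<close>)
      then show ?thesis
        using False by (simp add: tendsto_eventually)
    qed (auto simp: U_def)
  qed
  have C_S: "S \<inter> C \<in> sets ?M"
  proof -
    have "C \<in> sets lebesgue"
      unfolding F(2) by (intro sets.countable_INT) (use F in auto)
    then show ?thesis
      by (auto simp: sets_restrict_space)
  qed
  have U_sets [measurable]: "U k \<in> sets ?M" for k
    using U[of k] S_lebesgue by (auto simp: sets_restrict_space_iff)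
  note C_S [measurable]
  have "(\<lambda>k. LINT x|?M. g x * indicator (U k) x) \<longlonglongrightarrow> (LINT x|?M. g x * indicator (S \<inter> C) x)"
  proof (rule integral_dominated_convergence)
    show "integrable ?M (\<lambda>x. norm (g x))"
      using g by simp
    show "AE x in ?M. (\<lambda>k. g x * indicator (U k) x) \<longlonglongrightarrow> g x * indicator (S \<inter> C) x"
      by (intro AE_I2 tendsto_mult tendsto_const ind)
    show "AE x in ?M. norm (g x * indicator (U k) x) \<le> norm (g x)" for k
      by (intro AE_I2) (auto simp: indicator_def)
  qed measurable
  then have "(LINT x|?M. g x * indicator (S \<inter> C) x) = 0"
    by (simp add: zero U LIMSEQ_const_iff)
  \<comment> \<open>Outside the null set \<open>T\<close> the set \<open>C\<close> is exactly the
    positivity set \<open>E\<close>, so multiplying by its indicator produces the positive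
    part.\<close>
  moreover have AE: "AE x in ?M. g x * indicator (S \<inter> C) x = max (g x) 0"
  proof -
    have "AE x in lebesgue. x \<notin> T"
      using C(2) by (rule AE_not_in)
    then have "AE x in lebesgue. x \<in> S \<longrightarrow> x \<notin> T"
      by eventually_elim simp
    then have "AE x in ?M. x \<notin> T"
      using S_lebesgue by (simp add: AE_restrict_space_iff)
    moreover have "AE x in ?M. x \<in> S"
      by (rule AE_I2) simp
    ultimately show ?thesis
      by eventually_elim (use C(3) in \<open>auto simp: E_def indicator_def max_def\<close>)
  qed
  ultimately have "(LINT x|?M. max (g x) 0) = 0"
    by (subst integral_cong_AE[of _ _ "\<lambda>x. g x * indicator (S \<inter> C) x"]) auto
  moreover have "integrable ?M (\<lambda>x. max (g x) 0)"
    using g by simp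
  ultimately have "AE x in ?M. max (g x) 0 = 0"
    by (subst (asm) integral_nonneg_eq_0_iff_AE) auto
  then show ?thesis
    by eventually_elim (simp add: max_def split: if_splits)
qed

text \<open>Uniformly bounded test functions that converge to the indicator of an open set carry the
  hypothesis over to integrals on open sets, by dominated convergence.\<close>

lemma AE_eq_0_if_integral_test_functions:
  fixes g :: "real^'n \<Rightarrow> real"
  assumes S: "open S" and g: "integrable (lebesgue_on S) g"
    and zero: "\<And>\<theta>. \<theta> \<in> test_functions S \<Longrightarrow> (LINT x|lebesgue_on S. g x * \<theta> x) = 0"
  shows "AE x in lebesgue_on S. g x = 0"
proof -
  let ?M = "lebesgue_on S"
  note [measurable] = borel_measurable_integrable[OF g]
  have zero_open: "(LINT x|?M. g x * indicator U x) = 0" if U: "open U" "U \<subseteq> S" for U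
  proof -
    obtain \<theta> where \<theta>: "\<And>k::nat. \<theta> k \<in> test_functions U" "\<And>k x. \<bar>\<theta> k x\<bar> \<le> 1"
      "\<And>x. (\<lambda>k. \<theta> k x) \<longlonglongrightarrow> indicator U x"
      using test_functions_approximate_open[OF U(1)] by blast
    have [measurable]: "\<theta> k \<in> borel_measurable ?M" for k
      by (rule smooth_measurable[OF test_functions_smooth[OF \<theta>(1)]])
    have [measurable]: "U \<in> sets ?M"
      using U S by (auto simp: sets_restrict_space_iff)
    have "(\<lambda>k. LINT x|?M. g x * \<theta> k x) \<longlonglongrightarrow> (LINT x|?M. g x * indicator U x)"
    proof (rule integral_dominated_convergence)
      show "integrable ?M (\<lambda>x. norm (g x))"
        using g by simp
      show "AE x in ?M. (\<lambda>k. g x * \<theta> k x) \<longlonglongrightarrow> g x * indicator U x"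
        by (intro AE_I2 tendsto_mult tendsto_const \<theta>(3))
      show "AE x in ?M. norm (g x * \<theta> k x) \<le> norm (g x)" for k
        using \<theta>(2) by (intro AE_I2) (simp add: abs_mult mult_left_le)
    qed measurable
    moreover have "(LINT x|?M. g x * \<theta> k x) = 0" for k
      using test_functions_mono[OF \<theta>(1)[of k] U(2)] by (rule zero)
    ultimately show ?thesis
      by (simp add: LIMSEQ_const_iff)
  qed
  have "AE x in ?M. g x \<le> 0"
    by (rule AE_eq_0_if_integral_indicator_open[OF S g zero_open])
  moreover have "AE x in ?M. - g x \<le> 0"
    by (rule AE_eq_0_if_integral_indicator_open[OF S]) (use g zero_open in auto)
  ultimately show ?thesis
    by eventually_elim simp
qed

section \<open>The space $H^1_0$\<close>

definition grad :: "(real^'n \<Rightarrow> real) \<Rightarrow> real^'n \<Rightarrow> real^'n" where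
  "grad \<phi> x = (\<chi> i. partial_deriv i \<phi> x)"

lemma grad_nth [simp]: "grad \<phi> x $ i = partial_deriv i \<phi> x"
  by (simp add: grad_def)

text \<open>Membership in \<^const>\<open>H10\<close> together with a weak gradient, which is an argument here instead of
  being chosen by \<^const>\<open>weak_gradient\<close>.\<close>

definition H10_grad :: "(real^'n) set \<Rightarrow> (real^'n \<Rightarrow> real) \<Rightarrow> (real^'n \<Rightarrow> real^'n) \<Rightarrow> bool" where
  "H10_grad S y g \<longleftrightarrow>
     square_integrable (lebesgue_on S) y \<and> (\<forall>i. square_integrable (lebesgue_on S) (\<lambda>x. g x $ i)) \<and>
     (\<exists>\<phi>. (\<forall>k::nat. \<phi> k \<in> test_functions S) \<and>
        (\<lambda>k. norm_L2 (lebesgue_on S) (\<lambda>x. y x - \<phi> k x)) \<longlonglongrightarrow> 0 \<and>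
        (\<forall>i. (\<lambda>k. norm_L2 (lebesgue_on S) (\<lambda>x. g x $ i - partial_deriv i (\<phi> k) x)) \<longlonglongrightarrow> 0))"

lemma integrable_inner_L2:
  fixes g h :: "'a \<Rightarrow> real^'n"
  assumes "\<And>i. square_integrable M (\<lambda>x. g x $ i)" "\<And>i. square_integrable M (\<lambda>x. h x $ i)"
  shows "integrable M (\<lambda>x. g x \<bullet> h x)"
    and "(LINT x|M. g x \<bullet> h x) = (\<Sum>i\<in>UNIV. LINT x|M. g x $ i * h x $ i)"
proof -
  have eq: "(\<lambda>x. g x \<bullet> h x) = (\<lambda>x. \<Sum>i\<in>UNIV. g x $ i * h x $ i)"
    by (simp add: inner_vec_def)
  have *: "integrable M (\<lambda>x. g x $ i * h x $ i)" for i
    by (intro integrable_mult_L2 assms)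
  show "integrable M (\<lambda>x. g x \<bullet> h x)"
    unfolding eq using * by simp
  show "(LINT x|M. g x \<bullet> h x) = (\<Sum>i\<in>UNIV. LINT x|M. g x $ i * h x $ i)"
    unfolding eq using * by simp
qed

lemma vec_measurable:
  fixes g :: "'a \<Rightarrow> real^'n"
  assumes "\<And>i. square_integrable M (\<lambda>x. g x $ i)"
  shows "g \<in> borel_measurable M"
proof (rule borel_measurable_euclidean_space[THEN iffD2], intro ballI)
  fix b :: "real^'n"
  assume "b \<in> Basis"
  then obtain i where "b = axis i 1"
    by (auto simp: Basis_vec_def)
  then show "(\<lambda>x. g x \<bullet> b) \<in> borel_measurable M"
    using square_integrable_measurable[OF assms[of i]] by (simp add: inner_axis)
qed

text \<open>Boundedness makes the measure \<open>M\<close> finite: square integrable functions are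
  then integrable, and smooth functions that do not vanish at the boundary are square integrable on
  S.\<close>

locale bounded_open =
  fixes S :: "(real^'n) set"
  assumes open_S: "open S" and bounded_S: "bounded S"
begin

abbreviation "M \<equiv> lebesgue_on S"

lemma S_lebesgue: "S \<in> sets lebesgue"
  using open_S by auto

lemma finite_M: "finite_measure M"
  by (rule finite_measure_lebesgue_on_bounded[OF bounded_S S_lebesgue])

lemma test_square_integrable: "\<phi> \<in> test_functions S \<Longrightarrow> square_integrable M \<phi>"
  by (rule test_functions_square_integrable[OF _ bounded_S S_lebesgue])

lemma smooth_square_integrable': "smooth \<phi> \<Longrightarrow> square_integrable M \<phi>"
  by (rule smooth_square_integrable[OF _ bounded_S S_lebesgue])

lemma H10_grad_L2: "H10_grad S y g \<Longrightarrow> square_integrable M y"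
  and H10_grad_grad_L2: "H10_grad S y g \<Longrightarrow> square_integrable M (\<lambda>x. g x $ i)"
  by (auto simp: H10_grad_def)

lemma H10_grad_measurable: "H10_grad S y g \<Longrightarrow> g \<in> borel_measurable M"
  by (rule vec_measurable) (rule H10_grad_grad_L2)

lemma H10_gradE:
  assumes "H10_grad S y g"
  obtains \<phi> where "\<And>k::nat. \<phi> k \<in> test_functions S" "(\<lambda>k. norm_L2 M (\<lambda>x. y x - \<phi> k x)) \<longlonglongrightarrow> 0"
    "\<And>i. (\<lambda>k. norm_L2 M (\<lambda>x. g x $ i - partial_deriv i (\<phi> k) x)) \<longlonglongrightarrow> 0"
  using assms by (auto simp: H10_grad_def)

lemma H10_gradI:
  assumes "square_integrable M y" "\<And>i. square_integrable M (\<lambda>x. g x $ i)"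
    "\<And>k::nat. \<phi> k \<in> test_functions S" "(\<lambda>k. norm_L2 M (\<lambda>x. y x - \<phi> k x)) \<longlonglongrightarrow> 0"
    "\<And>i. (\<lambda>k. norm_L2 M (\<lambda>x. g x $ i - partial_deriv i (\<phi> k) x)) \<longlonglongrightarrow> 0"
  shows "H10_grad S y g"
  unfolding H10_grad_def by (intro conjI exI[of _ \<phi>] allI assms)

lemma H10_grad_test:
  assumes "\<phi> \<in> test_functions S"
  shows "H10_grad S \<phi> (grad \<phi>)"
  by (rule H10_gradI[of _ _ "\<lambda>k. \<phi>"])
    (simp_all add: norm_L2_def assms test_square_integrable test_functions_partial_deriv)

lemma H10_grad_add:
  assumes "H10_grad S y g" "H10_grad S z h"
  shows "H10_grad S (\<lambda>x. y x + z x) (\<lambda>x. g x + h x)"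
proof -
  obtain \<phi> where \<phi>: "\<And>k::nat. \<phi> k \<in> test_functions S" "(\<lambda>k. norm_L2 M (\<lambda>x. y x - \<phi> k x)) \<longlonglongrightarrow> 0"
    "\<And>i. (\<lambda>k. norm_L2 M (\<lambda>x. g x $ i - partial_deriv i (\<phi> k) x)) \<longlonglongrightarrow> 0"
    using H10_gradE[OF assms(1)] by blast
  obtain \<psi> where \<psi>: "\<And>k::nat. \<psi> k \<in> test_functions S" "(\<lambda>k. norm_L2 M (\<lambda>x. z x - \<psi> k x)) \<longlonglongrightarrow> 0"
    "\<And>i. (\<lambda>k. norm_L2 M (\<lambda>x. h x $ i - partial_deriv i (\<psi> k) x)) \<longlonglongrightarrow> 0"
    using H10_gradE[OF assms(2)] by blast
  have d: "partial_deriv i (\<lambda>x. \<phi> k x + \<psi> k x) x = partial_deriv i (\<phi> k) x + partial_deriv i (\<psi> k) x" for i k x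
    by (intro partial_deriv_add smooth_differentiable test_functions_smooth[OF \<phi>(1)] test_functions_smooth[OF \<psi>(1)])
  show ?thesis
  proof (rule H10_gradI[of _ _ "\<lambda>k x. \<phi> k x + \<psi> k x"])
    show "square_integrable M (\<lambda>x. y x + z x)" "square_integrable M (\<lambda>x. (g x + h x) $ i)" for i
      using assms by (auto intro!: square_integrable_add intro: H10_grad_L2 H10_grad_grad_L2)
    show "(\<lambda>x. \<phi> k x + \<psi> k x) \<in> test_functions S" for k
      by (intro test_functions_add \<phi> \<psi>)
    have "(\<lambda>k. norm_L2 M (\<lambda>x. (y x - \<phi> k x) + (z x - \<psi> k x))) \<longlonglongrightarrow> 0"
      by (intro tendsto_norm_L2_add \<phi>(2) \<psi>(2) square_integrable_diff test_square_integrable \<phi>(1) \<psi>(1)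
          H10_grad_L2[OF assms(1)] H10_grad_L2[OF assms(2)])
    then show "(\<lambda>k. norm_L2 M (\<lambda>x. y x + z x - (\<phi> k x + \<psi> k x))) \<longlonglongrightarrow> 0"
      by (simp add: algebra_simps)
    fix i
    have "(\<lambda>k. norm_L2 M (\<lambda>x. (g x $ i - partial_deriv i (\<phi> k) x) + (h x $ i - partial_deriv i (\<psi> k) x))) \<longlonglongrightarrow> 0"
      by (intro tendsto_norm_L2_add \<phi>(3) \<psi>(3) square_integrable_diff test_square_integrable
          test_functions_partial_deriv \<phi>(1) \<psi>(1) H10_grad_grad_L2[OF assms(1)] H10_grad_grad_L2[OF assms(2)])
    then show "(\<lambda>k. norm_L2 M (\<lambda>x. (g x + h x) $ i - partial_deriv i (\<lambda>x. \<phi> k x + \<psi> k x) x)) \<longlonglongrightarrow> 0"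
      by (simp add: d algebra_simps)
  qed
qed

lemma H10_grad_cmult:
  assumes "H10_grad S y g"
  shows "H10_grad S (\<lambda>x. c * y x) (\<lambda>x. c *\<^sub>R g x)"
proof -
  obtain \<phi> where \<phi>: "\<And>k::nat. \<phi> k \<in> test_functions S" "(\<lambda>k. norm_L2 M (\<lambda>x. y x - \<phi> k x)) \<longlonglongrightarrow> 0"
    "\<And>i. (\<lambda>k. norm_L2 M (\<lambda>x. g x $ i - partial_deriv i (\<phi> k) x)) \<longlonglongrightarrow> 0"
    using H10_gradE[OF assms(1)] by blast
  have d: "partial_deriv i (\<lambda>x. c * \<phi> k x) x = c * partial_deriv i (\<phi> k) x" for i k x
    using partial_deriv_mult[OF smooth_differentiable[OF smooth_const[of c], of x]
        smooth_differentiable[OF test_functions_smooth[OF \<phi>(1)], of k x]] by simp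
  show ?thesis
  proof (rule H10_gradI[of _ _ "\<lambda>k x. c * \<phi> k x"])
    show "square_integrable M (\<lambda>x. c * y x)" "square_integrable M (\<lambda>x. (c *\<^sub>R g x) $ i)" for i
      using assms by (auto intro!: square_integrable_cmult intro: H10_grad_L2 H10_grad_grad_L2)
    show "(\<lambda>x. c * \<phi> k x) \<in> test_functions S" for k
      by (intro test_functions_cmult \<phi>)
    have "(\<lambda>k. norm_L2 M (\<lambda>x. c * (y x - \<phi> k x))) \<longlonglongrightarrow> 0"
      unfolding norm_L2_cmult using tendsto_mult_right_zero[OF \<phi>(2)] by blast
    then show "(\<lambda>k. norm_L2 M (\<lambda>x. c * y x - c * \<phi> k x)) \<longlonglongrightarrow> 0"
      by (simp add: right_diff_distrib)
    fix i
    have "(\<lambda>k. norm_L2 M (\<lambda>x. c * (g x $ i - partial_deriv i (\<phi> k) x))) \<longlonglongrightarrow> 0"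
      unfolding norm_L2_cmult using tendsto_mult_right_zero[OF \<phi>(3)] by blast
    then show "(\<lambda>k. norm_L2 M (\<lambda>x. (c *\<^sub>R g x) $ i - partial_deriv i (\<lambda>x. c * \<phi> k x) x)) \<longlonglongrightarrow> 0"
      by (simp add: d right_diff_distrib)
  qed
qed

lemma H10_grad_diff:
  assumes "H10_grad S y g" "H10_grad S z h"
  shows "H10_grad S (\<lambda>x. y x - z x) (\<lambda>x. g x - h x)"
  using H10_grad_add[OF assms(1) H10_grad_cmult[OF assms(2), of "-1"]] by simp

text \<open>A diagonal choice: within 1/(k+1) of the k-th pair there is a test function that is
  close in value and in all of the finitely many derivatives.\<close>

lemma H10_grad_limit:
  assumes yg: "\<And>k::nat. H10_grad S (y k) (g k)"
    and z: "square_integrable M z" and h: "\<And>i. square_integrable M (\<lambda>x. h x $ i)"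
    and lim: "(\<lambda>k. norm_L2 M (\<lambda>x. z x - y k x)) \<longlonglongrightarrow> 0"
      "\<And>i. (\<lambda>k. norm_L2 M (\<lambda>x. h x $ i - g k x $ i)) \<longlonglongrightarrow> 0"
  shows "H10_grad S z h"
proof -
  have "\<forall>k. \<exists>\<phi>. \<phi> \<in> test_functions S \<and> norm_L2 M (\<lambda>x. y k x - \<phi> x) < inverse (real (Suc k)) \<and>
    (\<forall>i. norm_L2 M (\<lambda>x. g k x $ i - partial_deriv i \<phi> x) < inverse (real (Suc k)))"
  proof
    fix k
    obtain \<phi> where \<phi>: "\<And>j::nat. \<phi> j \<in> test_functions S" "(\<lambda>j. norm_L2 M (\<lambda>x. y k x - \<phi> j x)) \<longlonglongrightarrow> 0"
      "\<And>i. (\<lambda>j. norm_L2 M (\<lambda>x. g k x $ i - partial_deriv i (\<phi> j) x)) \<longlonglongrightarrow> 0"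
      using H10_gradE[OF yg[of k]] by blast
    have pos: "0 < inverse (real (Suc k))"
      by simp
    have "\<forall>\<^sub>F j in sequentially. norm_L2 M (\<lambda>x. y k x - \<phi> j x) < inverse (real (Suc k)) \<and>
      (\<forall>i. norm_L2 M (\<lambda>x. g k x $ i - partial_deriv i (\<phi> j) x) < inverse (real (Suc k)))"
      by (intro eventually_conj eventually_all_finite order_tendstoD(2)[OF \<phi>(2) pos] order_tendstoD(2)[OF \<phi>(3) pos])
    from eventually_happens'[OF sequentially_bot this] obtain j where
      "norm_L2 M (\<lambda>x. y k x - \<phi> j x) < inverse (real (Suc k)) \<and>
      (\<forall>i. norm_L2 M (\<lambda>x. g k x $ i - partial_deriv i (\<phi> j) x) < inverse (real (Suc k)))"
      by blast
    with \<phi>(1)[of j] show "\<exists>\<phi>. \<phi> \<in> test_functions S \<and> norm_L2 M (\<lambda>x. y k x - \<phi> x) < inverse (real (Suc k)) \<and>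
      (\<forall>i. norm_L2 M (\<lambda>x. g k x $ i - partial_deriv i \<phi> x) < inverse (real (Suc k)))"
      by (intro exI[of _ "\<phi> j"]) simp
  qed
  from choice[OF this] obtain \<phi> where \<phi>: "\<And>k. \<phi> k \<in> test_functions S" "\<And>k. norm_L2 M (\<lambda>x. y k x - \<phi> k x) < inverse (real (Suc k))"
    "\<And>k i. norm_L2 M (\<lambda>x. g k x $ i - partial_deriv i (\<phi> k) x) < inverse (real (Suc k))"
    by auto
  show ?thesis
  proof (rule H10_gradI[OF z h \<phi>(1)])
    have "(\<lambda>k. norm_L2 M (\<lambda>x. y k x - \<phi> k x)) \<longlonglongrightarrow> 0"
      by (rule tendsto_sandwich[OF _ _ tendsto_const LIMSEQ_inverse_real_of_nat])
        (use less_imp_le[OF \<phi>(2)] in auto)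
    with lim(1) have "(\<lambda>k. norm_L2 M (\<lambda>x. (z x - y k x) + (y k x - \<phi> k x))) \<longlonglongrightarrow> 0"
      by (intro tendsto_norm_L2_add square_integrable_diff z H10_grad_L2[OF yg] test_square_integrable \<phi>(1))
    then show "(\<lambda>k. norm_L2 M (\<lambda>x. z x - \<phi> k x)) \<longlonglongrightarrow> 0"
      by simp
    fix i
    have "(\<lambda>k. norm_L2 M (\<lambda>x. g k x $ i - partial_deriv i (\<phi> k) x)) \<longlonglongrightarrow> 0"
      by (rule tendsto_sandwich[OF _ _ tendsto_const LIMSEQ_inverse_real_of_nat])
        (use less_imp_le[OF \<phi>(3)] in auto)
    with lim(2)[of i] have "(\<lambda>k. norm_L2 M (\<lambda>x. (h x $ i - g k x $ i) + (g k x $ i - partial_deriv i (\<phi> k) x))) \<longlonglongrightarrow> 0"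
      by (intro tendsto_norm_L2_add square_integrable_diff h H10_grad_grad_L2[OF yg] test_square_integrable
          test_functions_partial_deriv \<phi>(1))
    then show "(\<lambda>k. norm_L2 M (\<lambda>x. h x $ i - partial_deriv i (\<phi> k) x)) \<longlonglongrightarrow> 0"
      by simp
  qed
qed

text \<open>The identity holds for test functions in place of y and survives the limit. Only y has
  to vanish at the boundary; with a coordinate function as \<open>\<theta>\<close> the left-hand
  side becomes the plain integral of y.\<close>

lemma H10_grad_integration_by_parts:
  assumes yg: "H10_grad S y g" and \<theta>: "smooth \<theta>"
  shows "(LINT x|M. y x * partial_deriv i \<theta> x) = - (LINT x|M. g x $ i * \<theta> x)"
proof -
  obtain \<phi> where \<phi>: "\<And>k::nat. \<phi> k \<in> test_functions S" "(\<lambda>k. norm_L2 M (\<lambda>x. y x - \<phi> k x)) \<longlonglongrightarrow> 0"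
    "\<And>i. (\<lambda>k. norm_L2 M (\<lambda>x. g x $ i - partial_deriv i (\<phi> k) x)) \<longlonglongrightarrow> 0"
    using H10_gradE[OF yg] by blast
  have "(\<lambda>k. LINT x|M. \<phi> k x * partial_deriv i \<theta> x) \<longlonglongrightarrow> (LINT x|M. y x * partial_deriv i \<theta> x)"
    by (intro tendsto_integral_mult_L2 test_square_integrable \<phi> H10_grad_L2[OF yg]
        smooth_square_integrable' smooth_partial_deriv \<theta>)
  moreover have "(\<lambda>k. LINT x|M. partial_deriv i (\<phi> k) x * \<theta> x) \<longlonglongrightarrow> (LINT x|M. g x $ i * \<theta> x)"
    by (intro tendsto_integral_mult_L2 test_square_integrable test_functions_partial_deriv \<phi> H10_grad_grad_L2[OF yg]
        smooth_square_integrable' \<theta>)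
  moreover have "(LINT x|M. \<phi> k x * partial_deriv i \<theta> x) = - (LINT x|M. partial_deriv i (\<phi> k) x * \<theta> x)" for k
    using integration_by_parts_test[OF bounded_S S_lebesgue \<theta> \<phi>(1)[of k], of i] by (simp add: mult.commute)
  ultimately have "(\<lambda>k. - (LINT x|M. partial_deriv i (\<phi> k) x * \<theta> x)) \<longlonglongrightarrow> (LINT x|M. y x * partial_deriv i \<theta> x)"
    and "(\<lambda>k. - (LINT x|M. partial_deriv i (\<phi> k) x * \<theta> x)) \<longlonglongrightarrow> - (LINT x|M. g x $ i * \<theta> x)"
    by (auto intro: tendsto_minus)
  then show ?thesis
    by (rule LIMSEQ_unique)
qed

section \<open>Uniqueness of weak gradients, and the agreement of \<open>H10\<close> with
  \<open>H10_grad\<close>\<close>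

lemma H10_grad_has_weak_gradient: "H10_grad S y g \<Longrightarrow> has_weak_gradient S y g"
  unfolding has_weak_gradient_def
  by (simp add: L2_iff_square_integrable H10_grad_grad_L2 H10_grad_integration_by_parts test_functions_smooth)

text \<open>The fundamental lemma, applied to each component of the difference.\<close>

lemma has_weak_gradient_unique:
  assumes "has_weak_gradient S y g" "has_weak_gradient S y h"
  shows "AE x in M. g x = h x"
proof -
  have sq: "square_integrable M (\<lambda>x. g x $ i)" "square_integrable M (\<lambda>x. h x $ i)" for i
    using assms by (auto simp: has_weak_gradient_def L2_iff_square_integrable)
  have "AE x in M. g x $ i - h x $ i = 0" for i
  proof (rule AE_eq_0_if_integral_test_functions[OF open_S])
    show "integrable M (\<lambda>x. g x $ i - h x $ i)"
      by (intro square_integrable_integrable[OF finite_M] square_integrable_diff sq)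
    fix \<theta> :: "real^'n \<Rightarrow> real"
    assume \<theta>: "\<theta> \<in> test_functions S"
    then have "(LINT x|M. g x $ i * \<theta> x) = (LINT x|M. h x $ i * \<theta> x)"
      using assms by (auto simp: has_weak_gradient_def)
    moreover have "integrable M (\<lambda>x. g x $ i * \<theta> x)" "integrable M (\<lambda>x. h x $ i * \<theta> x)"
      by (intro integrable_mult_L2 sq test_square_integrable \<theta>)+
    ultimately show "(LINT x|M. (g x $ i - h x $ i) * \<theta> x) = 0"
      by (simp add: left_diff_distrib)
  qed
  then have "AE x in M. \<forall>i. g x $ i - h x $ i = 0"
    by (intro eventually_all_finite)
  then show ?thesis
    by eventually_elim (simp add: vec_eq_iff)
qed

text \<open>\<open>H1_norm\<close> of a difference refers to a chosen weak gradient of that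
  difference; here one is exhibited, with which the chosen one can be compared.\<close>

lemma has_weak_gradient_diff_test:
  assumes y: "square_integrable M y" and g: "has_weak_gradient S y g" and \<phi>: "\<phi> \<in> test_functions S"
  shows "has_weak_gradient S (\<lambda>x. y x - \<phi> x) (\<lambda>x. g x - grad \<phi> x)"
  unfolding has_weak_gradient_def L2_iff_square_integrable
proof (intro conjI allI ballI)
  have sq: "square_integrable M (\<lambda>x. g x $ i)" for i
    using g by (auto simp: has_weak_gradient_def L2_iff_square_integrable)
  note \<phi>i = test_functions_partial_deriv[OF \<phi>]
  show "square_integrable M (\<lambda>x. (g x - grad \<phi> x) $ i)" for i
    by (simp, intro square_integrable_diff sq test_square_integrable \<phi>i)
  fix \<theta> :: "real^'n \<Rightarrow> real" and i
  assume \<theta>: "\<theta> \<in> test_functions S"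
  note int = integrable_mult_L2[OF y test_square_integrable[OF test_functions_partial_deriv[OF \<theta>]], of i]
    integrable_mult_L2[OF test_square_integrable[OF \<phi>] test_square_integrable[OF test_functions_partial_deriv[OF \<theta>]], of i]
    integrable_mult_L2[OF sq[of i] test_square_integrable[OF \<theta>]]
    integrable_mult_L2[OF test_square_integrable[OF \<phi>i[of i]] test_square_integrable[OF \<theta>]]
  have "(LINT x|M. y x * partial_deriv i \<theta> x) = - (LINT x|M. g x $ i * \<theta> x)"
    using g \<theta> by (simp add: has_weak_gradient_def)
  moreover have "(LINT x|M. \<phi> x * partial_deriv i \<theta> x) = - (LINT x|M. partial_deriv i \<phi> x * \<theta> x)"
    using H10_grad_integration_by_parts[OF H10_grad_test[OF \<phi>] test_functions_smooth[OF \<theta>]] by simp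
  ultimately show "(LINT x|M. (y x - \<phi> x) * partial_deriv i \<theta> x) = - (LINT x|M. (g x - grad \<phi> x) $ i * \<theta> x)"
    using int by (simp add: left_diff_distrib)
qed

lemma has_weak_gradient_weak_gradient:
  "has_weak_gradient S y g \<Longrightarrow> has_weak_gradient S y (weak_gradient S y)"
  unfolding weak_gradient_def by (rule someI[of "has_weak_gradient S y"])

text \<open>By uniqueness the chosen gradient may be replaced by any given one. Convergence in
  \<open>H1_norm\<close> thereby splits into convergence of the values and of each
  component.\<close>

lemma H1_norm_power2:
  assumes "has_weak_gradient S y g"
  shows "(H1_norm S y)\<^sup>2 = (norm_L2 M y)\<^sup>2 + (\<Sum>i\<in>UNIV. (norm_L2 M (\<lambda>x. g x $ i))\<^sup>2)"
proof -
  have sq: "square_integrable M (\<lambda>x. g x $ i)" for i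
    using assms by (auto simp: has_weak_gradient_def L2_iff_square_integrable)
  have w: "has_weak_gradient S y (weak_gradient S y)"
    by (rule has_weak_gradient_weak_gradient[OF assms])
  have sq': "square_integrable M (\<lambda>x. weak_gradient S y x $ i)" for i
    using w by (auto simp: has_weak_gradient_def L2_iff_square_integrable)
  note [measurable] = vec_measurable[OF sq] vec_measurable[OF sq']
  have "(LINT x|M. (norm (weak_gradient S y x))\<^sup>2) = (LINT x|M. (norm (g x))\<^sup>2)"
    by (rule integral_cong_AE) (use has_weak_gradient_unique[OF w assms] in auto)
  also have "\<dots> = (\<Sum>i\<in>UNIV. (norm_L2 M (\<lambda>x. g x $ i))\<^sup>2)"
    using integrable_inner_L2(2)[OF sq sq] by (simp add: power2_norm_eq_inner norm_L2_power2 power2_eq_square[of "_ $ _"])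
  finally have eq: "(LINT x|M. (norm (weak_gradient S y x))\<^sup>2) = (\<Sum>i\<in>UNIV. (norm_L2 M (\<lambda>x. g x $ i))\<^sup>2)" .
  show ?thesis
    by (simp add: H1_norm_def eq norm_L2_power2 sum_nonneg)
qed

text \<open>The squared \<open>H1_norm\<close> of the error is a finite sum of squares that tend to
  0. The second part lets integrals switch between g and the chosen gradient.\<close>

lemma H10_grad_imp_H10:
  assumes "H10_grad S y g"
  shows "y \<in> H10 S" "AE x in M. weak_gradient S y x = g x"
proof -
  have g: "has_weak_gradient S y g"
    by (rule H10_grad_has_weak_gradient[OF assms])
  show "AE x in M. weak_gradient S y x = g x"
    by (rule has_weak_gradient_unique[OF has_weak_gradient_weak_gradient[OF g] g])
  obtain \<phi> where \<phi>: "\<And>k::nat. \<phi> k \<in> test_functions S" "(\<lambda>k. norm_L2 M (\<lambda>x. y x - \<phi> k x)) \<longlonglongrightarrow> 0"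
    "\<And>i. (\<lambda>k. norm_L2 M (\<lambda>x. g x $ i - partial_deriv i (\<phi> k) x)) \<longlonglongrightarrow> 0"
    using H10_gradE[OF assms] by blast
  have eq: "(H1_norm S (\<lambda>x. y x - \<phi> k x))\<^sup>2 = (norm_L2 M (\<lambda>x. y x - \<phi> k x))\<^sup>2 +
      (\<Sum>i\<in>UNIV. (norm_L2 M (\<lambda>x. g x $ i - partial_deriv i (\<phi> k) x))\<^sup>2)" for k
    using H1_norm_power2[OF has_weak_gradient_diff_test[OF H10_grad_L2[OF assms] g \<phi>(1)]] by simp
  have "(\<lambda>k. (norm_L2 M (\<lambda>x. y x - \<phi> k x))\<^sup>2 +
      (\<Sum>i\<in>UNIV. (norm_L2 M (\<lambda>x. g x $ i - partial_deriv i (\<phi> k) x))\<^sup>2)) \<longlonglongrightarrow> 0\<^sup>2 + (\<Sum>i\<in>(UNIV::'n set). 0\<^sup>2)"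
    by (intro tendsto_intros \<phi>)
  then have lim: "(\<lambda>k. (H1_norm S (\<lambda>x. y x - \<phi> k x))\<^sup>2) \<longlonglongrightarrow> 0"
    by (simp add: eq)
  show "y \<in> H10 S"
    unfolding H10_def H1_def
  proof (intro CollectI conjI allI impI)
    show "y \<in> L2 S"
      using H10_grad_L2[OF assms] by (simp add: L2_iff_square_integrable)
    show "\<exists>g. has_weak_gradient S y g"
      using g by blast
    fix e :: real
    assume "e > 0"
    then have "\<forall>\<^sub>F k in sequentially. (H1_norm S (\<lambda>x. y x - \<phi> k x))\<^sup>2 < e\<^sup>2"
      by (intro order_tendstoD(2)[OF lim]) simp
    then obtain k where "(H1_norm S (\<lambda>x. y x - \<phi> k x))\<^sup>2 < e\<^sup>2"
      using eventually_happens'[OF sequentially_bot] by blast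
    then have "H1_norm S (\<lambda>x. y x - \<phi> k x) < e"
      by (rule power2_less_imp_less) (use \<open>e > 0\<close> in simp)
    then show "\<exists>\<phi>\<in>test_functions S. H1_norm S (\<lambda>x. y x - \<phi> x) < e"
      using \<phi>(1) by blast
  qed
qed

text \<open>Each summand of the squared \<open>H1_norm\<close> is dominated by the whole, so test
  functions at distance below 1/(k+1) converge in value and in every derivative.\<close>

lemma H10_imp_H10_grad:
  assumes "y \<in> H10 S"
  shows "H10_grad S y (weak_gradient S y)"
proof -
  let ?g = "weak_gradient S y"
  have y: "square_integrable M y"
    using assms by (simp add: H10_def H1_def L2_iff_square_integrable)
  obtain g where "has_weak_gradient S y g"
    using assms by (auto simp: H10_def H1_def)
  then have g: "has_weak_gradient S y ?g"
    by (rule has_weak_gradient_weak_gradient)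
  have sq: "square_integrable M (\<lambda>x. ?g x $ i)" for i
    using g by (auto simp: has_weak_gradient_def L2_iff_square_integrable)
  have "\<exists>\<phi>\<in>test_functions S. H1_norm S (\<lambda>x. y x - \<phi> x) < inverse (real (Suc k))" for k
  proof -
    have "0 < inverse (real (Suc k))"
      by simp
    with assms show ?thesis
      unfolding H10_def by blast
  qed
  then obtain \<phi> where \<phi>: "\<And>k. \<phi> k \<in> test_functions S" "\<And>k. H1_norm S (\<lambda>x. y x - \<phi> k x) < inverse (real (Suc k))"
    by metis
  have eq: "(H1_norm S (\<lambda>x. y x - \<phi> k x))\<^sup>2 = (norm_L2 M (\<lambda>x. y x - \<phi> k x))\<^sup>2 +
      (\<Sum>i\<in>UNIV. (norm_L2 M (\<lambda>x. ?g x $ i - partial_deriv i (\<phi> k) x))\<^sup>2)" for k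
    using H1_norm_power2[OF has_weak_gradient_diff_test[OF y g \<phi>(1)]] by simp
  have nonneg: "0 \<le> H1_norm S z" for z
    by (simp add: H1_norm_def)
  have "norm_L2 M (\<lambda>x. y x - \<phi> k x) \<le> H1_norm S (\<lambda>x. y x - \<phi> k x)" for k
    by (rule power2_le_imp_le[OF _ nonneg]) (simp add: eq sum_nonneg)
  then have 1: "norm_L2 M (\<lambda>x. y x - \<phi> k x) \<le> inverse (real (Suc k))" for k
    using \<phi>(2) by (meson less_eq_real_def order_trans)
  have "norm_L2 M (\<lambda>x. ?g x $ i - partial_deriv i (\<phi> k) x) \<le> H1_norm S (\<lambda>x. y x - \<phi> k x)" for k i
  proof (rule power2_le_imp_le[OF _ nonneg])
    have "(norm_L2 M (\<lambda>x. ?g x $ i - partial_deriv i (\<phi> k) x))\<^sup>2 \<le>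
      (\<Sum>i\<in>UNIV. (norm_L2 M (\<lambda>x. ?g x $ i - partial_deriv i (\<phi> k) x))\<^sup>2)"
      by (rule member_le_sum) auto
    then show "(norm_L2 M (\<lambda>x. ?g x $ i - partial_deriv i (\<phi> k) x))\<^sup>2 \<le> (H1_norm S (\<lambda>x. y x - \<phi> k x))\<^sup>2"
      unfolding eq using zero_le_power2[of "norm_L2 M (\<lambda>x. y x - \<phi> k x)"] by linarith
  qed
  then have 2: "norm_L2 M (\<lambda>x. ?g x $ i - partial_deriv i (\<phi> k) x) \<le> inverse (real (Suc k))" for k i
    using \<phi>(2) by (meson less_eq_real_def order_trans)
  show ?thesis
  proof (rule H10_gradI[OF y sq \<phi>(1)])
    show "(\<lambda>k. norm_L2 M (\<lambda>x. y x - \<phi> k x)) \<longlonglongrightarrow> 0"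
      by (rule tendsto_sandwich[OF _ _ tendsto_const LIMSEQ_inverse_real_of_nat]) (use 1 in auto)
    show "(\<lambda>k. norm_L2 M (\<lambda>x. ?g x $ i - partial_deriv i (\<phi> k) x)) \<longlonglongrightarrow> 0" for i
      by (rule tendsto_sandwich[OF _ _ tendsto_const LIMSEQ_inverse_real_of_nat]) (use 2 in auto)
  qed
qed

section \<open>Restriction to measurable subsets of the domain\<close>

lemma AE_subset_lebesgue_on:
  assumes "U \<subseteq> S" "U \<in> sets lebesgue"
  shows "(AE x in lebesgue_on U. P x) \<longleftrightarrow> (AE x in M. x \<in> U \<longrightarrow> P x)"
proof -
  have "(AE x in lebesgue_on U. P x) \<longleftrightarrow> (AE x in lebesgue. x \<in> U \<longrightarrow> P x)"
    by (rule AE_restrict_space_iff) (use assms in auto)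
  also have "\<dots> \<longleftrightarrow> (AE x in lebesgue. x \<in> S \<longrightarrow> x \<in> U \<longrightarrow> P x)"
    by (rule AE_cong) (use assms in auto)
  also have "\<dots> \<longleftrightarrow> (AE x in M. x \<in> U \<longrightarrow> P x)"
    by (rule AE_restrict_space_iff[symmetric]) (use S_lebesgue in auto)
  finally show ?thesis .
qed

lemma integral_subset_lebesgue_on:
  fixes f :: "real^'n \<Rightarrow> real"
  assumes "U \<subseteq> S" "U \<in> sets lebesgue"
  shows "(LINT x|lebesgue_on U. f x) = (LINT x|M. indicator U x * f x)"
proof -
  have "(LINT x|lebesgue_on U. f x) = (LINT x|lebesgue. indicator U x *\<^sub>R f x)"
    by (rule integral_restrict_space) (use assms in auto)
  also have "\<dots> = (LINT x|lebesgue. indicator S x *\<^sub>R (indicator U x * f x))"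
    using assms by (intro Bochner_Integration.integral_cong) (auto simp: indicator_def)
  also have "\<dots> = (LINT x|M. indicator U x * f x)"
    by (rule integral_restrict_space[symmetric]) (use S_lebesgue in auto)
  finally show ?thesis .
qed

lemma integrable_subset_lebesgue_on:
  fixes f :: "real^'n \<Rightarrow> real"
  assumes "U \<subseteq> S" "U \<in> sets lebesgue"
  shows "integrable (lebesgue_on U) f \<longleftrightarrow> integrable M (\<lambda>x. indicator U x * f x)"
proof -
  have "integrable (lebesgue_on U) f \<longleftrightarrow> integrable lebesgue (\<lambda>x. indicator U x *\<^sub>R f x)"
    by (rule integrable_restrict_space) (use assms in auto)
  also have "\<dots> \<longleftrightarrow> integrable lebesgue (\<lambda>x. indicator S x *\<^sub>R (indicator U x * f x))"
    using assms by (intro Bochner_Integration.integrable_cong) (auto simp: indicator_def)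
  also have "\<dots> \<longleftrightarrow> integrable M (\<lambda>x. indicator U x * f x)"
    by (rule integrable_restrict_space[symmetric]) (use S_lebesgue in auto)
  finally show ?thesis .
qed

text \<open>A test function supported in U sees only the constant value c, and its partial
  derivatives have integral 0; hence g is orthogonal to all of them on U.\<close>

lemma H10_grad_eq_0_on_constant:
  assumes yg: "H10_grad S y g" and U: "open U" "U \<subseteq> S" and c: "AE x in M. x \<in> U \<longrightarrow> y x = c"
  shows "AE x in M. x \<in> U \<longrightarrow> g x = 0"
proof -
  have U_sets: "U \<in> sets lebesgue"
    using U by auto
  have "AE x in lebesgue_on U. g x $ i = 0" for i
  proof (rule AE_eq_0_if_integral_test_functions[OF U(1)])
    have ind: "indicator U \<in> borel_measurable M"
      using U U_sets S_lebesgue by (intro borel_measurable_indicator) (simp add: sets_restrict_space_iff)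
    have "square_integrable M (\<lambda>x. indicator U x * g x $ i)"
      by (rule square_integrable_mult_bounded[OF H10_grad_grad_L2[OF yg] ind, of 1]) (auto simp: indicator_def)
    then show "integrable (lebesgue_on U) (\<lambda>x. g x $ i)"
      unfolding integrable_subset_lebesgue_on[OF U(2) U_sets] by (rule square_integrable_integrable[OF finite_M])
    fix \<theta> :: "real^'n \<Rightarrow> real"
    assume \<theta>: "\<theta> \<in> test_functions U"
    then have \<theta>S: "\<theta> \<in> test_functions S"
      using U(2) by (rule test_functions_mono)
    have "(LINT x|lebesgue_on U. g x $ i * \<theta> x) = (LINT x|M. g x $ i * \<theta> x)"
      unfolding integral_subset_lebesgue_on[OF U(2) U_sets]
      using test_functions_eq_0[OF \<theta>] by (intro Bochner_Integration.integral_cong) (auto simp: indicator_def)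
    also have "\<dots> = - (LINT x|M. y x * partial_deriv i \<theta> x)"
      using H10_grad_integration_by_parts[OF yg test_functions_smooth[OF \<theta>]] by simp
    also have "(LINT x|M. y x * partial_deriv i \<theta> x) = (LINT x|M. c * partial_deriv i \<theta> x)"
    proof (rule integral_cong_AE)
      show "AE x in M. y x * partial_deriv i \<theta> x = c * partial_deriv i \<theta> x"
        using c by eventually_elim (use test_functions_eq_0[OF test_functions_partial_deriv[OF \<theta>]] in auto)
      note [measurable] = square_integrable_measurable[OF H10_grad_L2[OF yg]]
        square_integrable_measurable[OF test_square_integrable[OF test_functions_partial_deriv[OF \<theta>S, of i]]]
      show "(\<lambda>x. y x * partial_deriv i \<theta> x) \<in> borel_measurable M" "(\<lambda>x. c * partial_deriv i \<theta> x) \<in> borel_measurable M"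
        by measurable
    qed
    also have "\<dots> = 0"
      using integral_partial_deriv_test[OF S_lebesgue \<theta>S, of i] by simp
    finally show "(LINT x|lebesgue_on U. g x $ i * \<theta> x) = 0"
      by simp
  qed
  then have "AE x in lebesgue_on U. \<forall>i. g x $ i = 0"
    by (intro eventually_all_finite)
  then show ?thesis
    unfolding AE_subset_lebesgue_on[OF U(2) U_sets] by eventually_elim (simp add: vec_eq_iff)
qed

end

subsection \<open>Chain rule\<close>

lemma partial_deriv_uminus:
  assumes "\<phi> differentiable (at x)"
  shows "partial_deriv i (\<lambda>x. - \<phi> x) x = - partial_deriv i \<phi> x"
  using partial_deriv_eqI[OF has_derivative_minus[OF has_derivative_frechet[OF assms]]]
  by (simp add: partial_deriv_def)

lemma partial_deriv_diff:
  assumes "\<phi> differentiable (at x)" "\<psi> differentiable (at x)"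
  shows "partial_deriv i (\<lambda>x. \<phi> x - \<psi> x) x = partial_deriv i \<phi> x - partial_deriv i \<psi> x"
  using partial_deriv_eqI[OF has_derivative_diff[OF assms[THEN has_derivative_frechet]]]
  by (simp add: partial_deriv_def)

text \<open>An antiderivative of a polynomial is a polynomial, so composing it with a smooth
  function stays smooth. The free value at 0 is there to match the function that is being
  approximated.\<close>

lemma polynomial_antiderivative:
  assumes "real_polynomial_function p"
  obtains P where "\<And>t::real. (P has_real_derivative p t) (at t)" "P 0 = c"
    "\<And>w :: real^'n \<Rightarrow> real. smooth w \<Longrightarrow> smooth (\<lambda>x. P (w x))"
proof -
  obtain a n where p: "p = (\<lambda>t. \<Sum>i\<le>n. a i * t ^ i)"
    using assms by (auto simp: real_polynomial_function_iff_sum)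
  define P where "P t = c + (\<Sum>i\<le>n. a i / real (Suc i) * t ^ Suc i)" for t
  show ?thesis
  proof (rule that)
    fix t
    have "((\<lambda>t. a i / real (Suc i) * t ^ Suc i) has_real_derivative a i * t ^ i) (at t)" for i
      using DERIV_cmult[OF DERIV_pow[of "Suc i" t UNIV], of "a i / real (Suc i)"] by simp
    then have "((\<lambda>t. c + (\<Sum>i\<le>n. a i / real (Suc i) * t ^ Suc i)) has_real_derivative 0 + (\<Sum>i\<le>n. a i * t ^ i)) (at t)"
      by (intro DERIV_add DERIV_const DERIV_sum)
    then show "(P has_real_derivative p t) (at t)"
      by (simp add: P_def[abs_def] p)
  next
    show "P 0 = c"
      by (simp add: P_def)
  next
    fix w :: "real^'n \<Rightarrow> real"
    assume "smooth w"
    then show "smooth (\<lambda>x. P (w x))"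
      unfolding P_def by (intro smooth_add smooth_sum smooth_mult smooth_const smooth_power) auto
  qed
qed

lemma lipschitz_from_bounded_deriv:
  assumes "\<And>t::real. (h has_real_derivative h' t) (at t)" "\<And>t. \<bar>h' t\<bar> \<le> C"
  shows "\<bar>h s - h t\<bar> \<le> C * \<bar>s - t\<bar>"
  using field_differentiable_bound[of UNIV h h' C s t] assms by simp

context bounded_open
begin

lemma continuous_square_integrable:
  assumes "continuous_on UNIV w"
  shows "square_integrable M w"
proof -
  have "bounded (w ` closure S)"
    using bounded_S by (intro compact_imp_bounded compact_continuous_image continuous_on_subset[OF assms]) auto
  then obtain C where C: "\<And>x. x \<in> closure S \<Longrightarrow> \<bar>w x\<bar> \<le> C"
    by (auto simp: bounded_iff)
  show ?thesis
    by (rule square_integrable_bounded[OF finite_M continuous_measurable_lebesgue_on[OF assms], of C])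
      (use C closure_subset[of S] in \<open>intro AE_I2, auto\<close>)
qed

lemma tendsto_norm_L2_uniform:
  assumes "\<And>k. square_integrable M (u k)" "\<And>k x. x \<in> S \<Longrightarrow> \<bar>u k x\<bar> \<le> c * inverse (real (Suc k))" "0 \<le> c"
  shows "(\<lambda>k. norm_L2 M (u k)) \<longlonglongrightarrow> 0"
proof (rule tendsto_sandwich[OF _ _ tendsto_const])
  show "\<forall>\<^sub>F k in sequentially. norm_L2 M (u k) \<le> c * inverse (real (Suc k)) * sqrt (measure M (space M))"
    by (intro always_eventually allI norm_L2_le_bound[OF finite_M square_integrable_measurable[OF assms(1)]] AE_I2)
      (use assms(2,3) in auto)
  show "(\<lambda>k. c * inverse (real (Suc k)) * sqrt (measure M (space M))) \<longlonglongrightarrow> 0"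
    by (intro tendsto_mult_left_zero tendsto_mult_right_zero LIMSEQ_inverse_real_of_nat)
qed auto

text \<open>Polynomials that approximate the outer function in $C^1$ produce test functions.\<close>

lemma H10_grad_compose_test:
  assumes \<phi>: "\<phi> \<in> test_functions S" and \<psi>: "smooth \<psi>"
    and h: "\<And>t. (h has_real_derivative h' t) (at t)" "continuous_on UNIV h'"
  shows "H10_grad S (\<lambda>x. h (\<phi> x - \<psi> x) - h (- \<psi> x))
    (\<lambda>x. h' (\<phi> x - \<psi> x) *\<^sub>R (grad \<phi> x - grad \<psi> x) + h' (- \<psi> x) *\<^sub>R grad \<psi> x)"
proof -
  have s\<phi>: "smooth \<phi>"
    by (rule test_functions_smooth[OF \<phi>])
  note sm = smooth_diff[OF s\<phi> \<psi>] smooth_uminus[OF \<psi>]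
  note cont = smooth_continuous[OF sm(1), of UNIV] smooth_continuous[OF sm(2), of UNIV]
  have ch: "continuous_on UNIV h"
    by (intro continuous_at_imp_continuous_on ballI DERIV_isCont[OF h(1)])
  have cd: "continuous_on UNIV (partial_deriv i \<phi>)" "continuous_on UNIV (partial_deriv i \<psi>)" for i
    by (intro smooth_continuous smooth_partial_deriv s\<phi> \<psi>)+
  have comp: "continuous_on UNIV (\<lambda>x. f (\<phi> x - \<psi> x))" "continuous_on UNIV (\<lambda>x. f (- \<psi> x))"
    if "continuous_on UNIV f" for f :: "real \<Rightarrow> real"
    by (rule continuous_on_compose2[OF that cont(1)], simp, rule continuous_on_compose2[OF that cont(2)], simp)
  obtain b where b: "b > 0" "\<And>x. \<bar>\<phi> x\<bar> \<le> b"
    using test_functions_bounded[OF \<phi>] by blast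
  obtain c where c: "c > 0" "\<And>x. x \<in> S \<Longrightarrow> \<bar>\<psi> x\<bar> \<le> c"
    using smooth_bounded_on[OF \<psi> bounded_S] by blast
  \<comment> \<open>On S both arguments \<open>\<phi> x - \<psi> x\<close> and
    \<open>- \<psi> x\<close> stay in [-a, a], so approximating \<open>h'\<close> on this compact
    interval is enough.\<close>
  define a where "a = b + c"
  have a: "a > 0" "x \<in> S \<Longrightarrow> \<phi> x - \<psi> x \<in> {-a..a}" "x \<in> S \<Longrightarrow> - \<psi> x \<in> {-a..a}" for x
    using b(1) c(1) abs_le_D1[OF b(2)[of x]] abs_le_D2[OF b(2)[of x]]
      abs_le_D1[OF c(2)[of x]] abs_le_D2[OF c(2)[of x]] unfolding a_def by simp_all
  have "\<forall>k. \<exists>p. real_polynomial_function p \<and> (\<forall>t\<in>{-a..a}. \<bar>h' t - p t\<bar> < inverse (real (Suc k)))"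
  proof
    fix k
    have "continuous_on {-a..a} h'"
      using h(2) continuous_on_subset by blast
    moreover have "0 < inverse (real (Suc k))"
      by simp
    ultimately show "\<exists>p. real_polynomial_function p \<and> (\<forall>t\<in>{-a..a}. \<bar>h' t - p t\<bar> < inverse (real (Suc k)))"
    proof (rule Stone_Weierstrass_real_polynomial_function[OF compact_Icc])
      fix q
      assume "real_polynomial_function q" "\<And>t. t \<in> {-a..a} \<Longrightarrow> \<bar>h' t - q t\<bar> < inverse (real (Suc k))"
      then show ?thesis
        by (intro exI[of _ q] conjI ballI)
    qed
  qed
  from choice[OF this] obtain p where
    p: "\<And>k. real_polynomial_function (p k)" "\<And>k t. t \<in> {-a..a} \<Longrightarrow> \<bar>h' t - p k t\<bar> < inverse (real (Suc k))"
    by blast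
  have "\<forall>k. \<exists>P. (\<forall>t. (P has_real_derivative p k t) (at t)) \<and> P 0 = h 0 \<and>
      (\<forall>w :: real^'n \<Rightarrow> real. smooth w \<longrightarrow> smooth (\<lambda>x. P (w x)))"
  proof
    fix k
    show "\<exists>P. (\<forall>t. (P has_real_derivative p k t) (at t)) \<and> P 0 = h 0 \<and>
      (\<forall>w :: real^'n \<Rightarrow> real. smooth w \<longrightarrow> smooth (\<lambda>x. P (w x)))"
    proof (rule polynomial_antiderivative[OF p(1)[of k], of "h 0"])
      fix Q
      assume "\<And>t. (Q has_real_derivative p k t) (at t)" "Q 0 = h 0"
        "\<And>w :: real^'n \<Rightarrow> real. smooth w \<Longrightarrow> smooth (\<lambda>x. Q (w x))"
      then show ?thesis
        by (intro exI[of _ Q]) simp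
    qed
  qed
  then have "\<exists>P. \<forall>k. (\<forall>t. (P k has_real_derivative p k t) (at t)) \<and> P k 0 = h 0 \<and>
      (\<forall>w :: real^'n \<Rightarrow> real. smooth w \<longrightarrow> smooth (\<lambda>x. P k (w x)))"
    by (rule choice)
  then obtain P where P0: "\<forall>k. (\<forall>t. (P k has_real_derivative p k t) (at t)) \<and> P k 0 = h 0 \<and>
      (\<forall>w :: real^'n \<Rightarrow> real. smooth w \<longrightarrow> smooth (\<lambda>x. P k (w x)))"
    by (rule exE)
  then have P: "(P k has_real_derivative p k t) (at t)" "P k 0 = h 0" for k t
    by simp_all
  have P_smooth: "smooth (\<lambda>x. P k (w x))" if "smooth w" for k and w :: "real^'n \<Rightarrow> real"
    using P0 that by simp
  \<comment> \<open>\<open>P k\<close> and h agree at 0, so the error of the derivatives is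
    integrated over a length of at most a.\<close>
  have Ph: "\<bar>h t - P k t\<bar> \<le> a * inverse (real (Suc k))" if t: "t \<in> {-a..a}" for k t
  proof -
    have "norm ((\<lambda>t. h t - P k t) t - (\<lambda>t. h t - P k t) 0) \<le> inverse (real (Suc k)) * norm (t - 0)"
    proof (rule field_differentiable_bound[where S = "{-a..a}" and f' = "\<lambda>t. h' t - p k t"])
      show "((\<lambda>t. h t - P k t) has_real_derivative (h' s - p k s)) (at s within {-a..a})" for s
        by (rule DERIV_diff[OF has_field_derivative_at_within[OF h(1)] has_field_derivative_at_within[OF P(1)]])
      show "norm (h' s - p k s) \<le> inverse (real (Suc k))" if "s \<in> {-a..a}" for s
        using less_imp_le[OF p(2)[OF that, of k]] unfolding real_norm_def .
      show "(0::real) \<in> {-a..a}"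
        using a(1) by simp
    qed (rule convex_real_interval t)+
    also have "\<dots> \<le> inverse (real (Suc k)) * a"
    proof (rule mult_left_mono)
      show "norm (t - 0) \<le> a"
        using t by (simp add: abs_le_iff)
    qed simp
    also have "inverse (real (Suc k)) * a = a * inverse (real (Suc k))"
      by (rule mult.commute)
    finally show ?thesis
      unfolding P(2) real_norm_def by (simp only: diff_self diff_0_right)
  qed
  \<comment> \<open>Where \<open>\<phi>\<close> vanishes the two terms coincide, so the support
    stays inside that of \<open>\<phi>\<close> although \<open>\<psi>\<close> is arbitrary.\<close>
  define \<Phi> where "\<Phi> k x = P k (\<phi> x - \<psi> x) - P k (- \<psi> x)" for k x
  have \<Phi>_test: "\<Phi> k \<in> test_functions S" for k
  proof -
    obtain K where K: "smooth \<phi>" "compact K" "K \<subseteq> S" "\<And>x. x \<notin> K \<Longrightarrow> \<phi> x = 0"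
      using test_functionsE[OF \<phi>] by blast
    show ?thesis
    proof (rule test_functionsI[OF _ K(2,3)])
      show "smooth (\<Phi> k)"
        unfolding \<Phi>_def[abs_def] by (rule smooth_diff[OF P_smooth[OF sm(1)] P_smooth[OF sm(2)]])
    qed (simp add: \<Phi>_def K(4))
  qed
  have d\<Phi>: "partial_deriv i (\<Phi> k) x = p k (\<phi> x - \<psi> x) * (partial_deriv i \<phi> x - partial_deriv i \<psi> x)
      + p k (- \<psi> x) * partial_deriv i \<psi> x" for i k x
  proof -
    note diff = smooth_differentiable[OF s\<phi>, of x] smooth_differentiable[OF \<psi>, of x]
      smooth_differentiable[OF sm(1), of x] smooth_differentiable[OF sm(2), of x]
    have 1: "partial_deriv i (\<lambda>x. \<phi> x - \<psi> x) x = partial_deriv i \<phi> x - partial_deriv i \<psi> x"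
      by (rule partial_deriv_diff[OF diff(1,2)])
    have 2: "partial_deriv i (\<Phi> k) x = partial_deriv i (\<lambda>x. P k (\<phi> x - \<psi> x)) x - partial_deriv i (\<lambda>x. P k (- \<psi> x)) x"
      unfolding \<Phi>_def[abs_def]
      by (intro partial_deriv_diff partial_deriv_compose(2)[OF P(1)] diff)
    show ?thesis
      unfolding 2 partial_deriv_compose(1)[OF P(1) diff(3)] partial_deriv_compose(1)[OF P(1) diff(4)] 1
        partial_deriv_uminus[OF diff(2)] by simp
  qed
  let ?y = "\<lambda>x. h (\<phi> x - \<psi> x) - h (- \<psi> x)"
  let ?g = "\<lambda>i x. h' (\<phi> x - \<psi> x) * (partial_deriv i \<phi> x - partial_deriv i \<psi> x) + h' (- \<psi> x) * partial_deriv i \<psi> x"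
  have y: "square_integrable M ?y"
    by (intro continuous_square_integrable continuous_on_diff comp ch)
  have g: "square_integrable M (?g i)" for i
    by (intro continuous_square_integrable continuous_on_diff continuous_on_add continuous_on_mult comp h(2) cd)
  show ?thesis
  proof (rule H10_gradI[of _ _ \<Phi>])
    show "square_integrable M ?y"
      by (rule y)
    show "square_integrable M (\<lambda>x. (h' (\<phi> x - \<psi> x) *\<^sub>R (grad \<phi> x - grad \<psi> x) + h' (- \<psi> x) *\<^sub>R grad \<psi> x) $ i)" for i
      using g[of i] by simp
    show "\<Phi> k \<in> test_functions S" for k
      by (rule \<Phi>_test)
    show "(\<lambda>k. norm_L2 M (\<lambda>x. ?y x - \<Phi> k x)) \<longlonglongrightarrow> 0"
    \<comment> \<open>One a for each of the two places where h is evaluated.\<close>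
    proof (rule tendsto_norm_L2_uniform[of _ "2 * a"])
      show "square_integrable M (\<lambda>x. ?y x - \<Phi> k x)" for k
        by (intro square_integrable_diff y test_square_integrable \<Phi>_test)
      show "\<bar>?y x - \<Phi> k x\<bar> \<le> 2 * a * inverse (real (Suc k))" if "x \<in> S" for k x
        using Ph[OF a(2)[OF that], of k] Ph[OF a(3)[OF that], of k] by (simp add: \<Phi>_def)
    qed (use a(1) in simp)
    fix i
    obtain b' where b': "b' > 0" "\<And>x. \<bar>partial_deriv i \<phi> x\<bar> \<le> b'"
      using test_functions_bounded[OF test_functions_partial_deriv[OF \<phi>]] by blast
    obtain c' where c': "c' > 0" "\<And>x. x \<in> S \<Longrightarrow> \<bar>partial_deriv i \<psi> x\<bar> \<le> c'"
      using smooth_bounded_on[OF smooth_partial_deriv[OF \<psi>] bounded_S] by blast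
    have "(\<lambda>k. norm_L2 M (\<lambda>x. ?g i x - partial_deriv i (\<Phi> k) x)) \<longlonglongrightarrow> 0"
    proof (rule tendsto_norm_L2_uniform[of _ "b' + c' + c'"])
      show "square_integrable M (\<lambda>x. ?g i x - partial_deriv i (\<Phi> k) x)" for k
        by (intro square_integrable_diff g test_square_integrable test_functions_partial_deriv \<Phi>_test)
      show "\<bar>?g i x - partial_deriv i (\<Phi> k) x\<bar> \<le> (b' + c' + c') * inverse (real (Suc k))" if x: "x \<in> S" for k x
      proof -
        let ?e = "inverse (real (Suc k))"
        have eq: "?g i x - partial_deriv i (\<Phi> k) x =
          (h' (\<phi> x - \<psi> x) - p k (\<phi> x - \<psi> x)) * (partial_deriv i \<phi> x - partial_deriv i \<psi> x)
          + (h' (- \<psi> x) - p k (- \<psi> x)) * partial_deriv i \<psi> x"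
          by (simp add: d\<Phi> algebra_simps)
        have "\<bar>(h' (\<phi> x - \<psi> x) - p k (\<phi> x - \<psi> x)) * (partial_deriv i \<phi> x - partial_deriv i \<psi> x)\<bar> \<le> ?e * (b' + c')"
          unfolding abs_mult
          using p(2)[OF a(2)[OF x], of k] b'(2)[of x] c'(2)[OF x] by (intro mult_mono) auto
        moreover have "\<bar>(h' (- \<psi> x) - p k (- \<psi> x)) * partial_deriv i \<psi> x\<bar> \<le> ?e * c'"
          unfolding abs_mult using p(2)[OF a(3)[OF x], of k] c'(2)[OF x] by (intro mult_mono) auto
        ultimately have "\<bar>?g i x - partial_deriv i (\<Phi> k) x\<bar> \<le> ?e * (b' + c') + ?e * c'"
          unfolding eq by linarith
        then show ?thesis
          by (simp add: algebra_simps)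
      qed
    qed (use b' c' in simp)
    then show "(\<lambda>k. norm_L2 M (\<lambda>x. (h' (\<phi> x - \<psi> x) *\<^sub>R (grad \<phi> x - grad \<psi> x) + h' (- \<psi> x) *\<^sub>R grad \<psi> x) $ i
        - partial_deriv i (\<Phi> k) x)) \<longlonglongrightarrow> 0"
      by simp
  qed
qed

text \<open>The subtracted \<open>h (- \<psi> x)\<close> is the value for y = 0 and restores zero
  boundary values when \<open>\<psi>\<close> does not vanish. The bound on \<open>h'\<close> makes h
  Lipschitz, which settles the values; as \<open>h'\<close> is merely continuous, the gradients need
  an almost everywhere convergent subsequence.\<close>

lemma H10_grad_compose:
  assumes yg: "H10_grad S y g" and \<psi>: "smooth \<psi>"
    and h: "\<And>t. (h has_real_derivative h' t) (at t)" "continuous_on UNIV h'" "\<And>t. \<bar>h' t\<bar> \<le> C"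
  shows "H10_grad S (\<lambda>x. h (y x - \<psi> x) - h (- \<psi> x))
    (\<lambda>x. h' (y x - \<psi> x) *\<^sub>R (g x - grad \<psi> x) + h' (- \<psi> x) *\<^sub>R grad \<psi> x)"
proof -
  have C: "0 \<le> C"
    using h(3)[of 0] by linarith
  have y: "square_integrable M y"
    by (rule H10_grad_L2[OF yg])
  have gi: "square_integrable M (\<lambda>x. g x $ i)" for i
    by (rule H10_grad_grad_L2[OF yg])
  have \<psi>i: "square_integrable M (partial_deriv i \<psi>)" for i
    by (intro smooth_square_integrable' smooth_partial_deriv \<psi>)
  have ch: "continuous_on UNIV h"
    by (intro continuous_at_imp_continuous_on ballI DERIV_isCont[OF h(1)])
  note [measurable] = borel_measurable_continuous_onI[OF h(2)] borel_measurable_continuous_onI[OF ch]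
    square_integrable_measurable[OF y] square_integrable_measurable[OF gi] square_integrable_measurable[OF \<psi>i]
    smooth_measurable[OF \<psi>, of S]
  have lip: "\<bar>h s - h t\<bar> \<le> C * \<bar>s - t\<bar>" for s t
    by (rule lipschitz_from_bounded_deriv[OF h(1,3)])
  obtain \<phi>0 where \<phi>0: "\<And>k::nat. \<phi>0 k \<in> test_functions S" "(\<lambda>k. norm_L2 M (\<lambda>x. y x - \<phi>0 k x)) \<longlonglongrightarrow> 0"
    "\<And>i. (\<lambda>k. norm_L2 M (\<lambda>x. g x $ i - partial_deriv i (\<phi>0 k) x)) \<longlonglongrightarrow> 0"
    using H10_gradE[OF yg] by blast
  obtain r :: "nat \<Rightarrow> nat" where r: "strict_mono r" "AE x in M. (\<lambda>k. \<phi>0 (r k) x) \<longlonglongrightarrow> y x"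
    using tendsto_norm_L2_AE_subseq[OF test_square_integrable[OF \<phi>0(1)] y \<phi>0(2)] by blast
  define \<phi> where "\<phi> k = \<phi>0 (r k)" for k
  have \<phi>: "\<phi> k \<in> test_functions S" "(\<lambda>k. norm_L2 M (\<lambda>x. y x - \<phi> k x)) \<longlonglongrightarrow> 0"
    "(\<lambda>k. norm_L2 M (\<lambda>x. g x $ i - partial_deriv i (\<phi> k) x)) \<longlonglongrightarrow> 0"
    "AE x in M. (\<lambda>k. \<phi> k x) \<longlonglongrightarrow> y x" for k i
    using \<phi>0(1) LIMSEQ_subseq_LIMSEQ[OF \<phi>0(2) r(1)] LIMSEQ_subseq_LIMSEQ[OF \<phi>0(3)[of i] r(1)] r(2)
    by (simp_all add: \<phi>_def o_def)
  have sq\<phi>: "square_integrable M (\<phi> k)" "square_integrable M (partial_deriv i (\<phi> k))" for k i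
    by (intro test_square_integrable test_functions_partial_deriv \<phi>)+
  note [measurable] = square_integrable_measurable[OF sq\<phi>(1)] square_integrable_measurable[OF sq\<phi>(2)]
  show ?thesis
  proof (rule H10_grad_limit)
    show "H10_grad S (\<lambda>x. h (\<phi> k x - \<psi> x) - h (- \<psi> x))
        (\<lambda>x. h' (\<phi> k x - \<psi> x) *\<^sub>R (grad (\<phi> k) x - grad \<psi> x) + h' (- \<psi> x) *\<^sub>R grad \<psi> x)" for k
      by (rule H10_grad_compose_test[OF \<phi>(1) \<psi> h(1,2)])
    show "square_integrable M (\<lambda>x. h (y x - \<psi> x) - h (- \<psi> x))"
    proof (rule square_integrable_bound[OF square_integrable_cmult[OF y, of C]])
      show "AE x in M. \<bar>h (y x - \<psi> x) - h (- \<psi> x)\<bar> \<le> \<bar>C * y x\<bar>"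
        using lip[of "y x - \<psi> x" "- \<psi> x" for x] C by (intro AE_I2) (simp add: abs_mult)
    qed measurable
    have 1: "square_integrable M (\<lambda>x. h' (y x - \<psi> x) * (g x $ i - partial_deriv i \<psi> x))" for i
      by (rule square_integrable_mult_bounded[of _ _ _ C], intro square_integrable_diff gi \<psi>i, measurable)
        (use h(3) in auto)
    have 2: "square_integrable M (\<lambda>x. h' (- \<psi> x) * partial_deriv i \<psi> x)" for i
      by (rule square_integrable_mult_bounded[of _ _ _ C], rule \<psi>i, measurable) (use h(3) in auto)
    show "square_integrable M (\<lambda>x. (h' (y x - \<psi> x) *\<^sub>R (g x - grad \<psi> x) + h' (- \<psi> x) *\<^sub>R grad \<psi> x) $ i)" for i
      using square_integrable_add[OF 1 2, of i i] by simp
    show "(\<lambda>k. norm_L2 M (\<lambda>x. h (y x - \<psi> x) - h (- \<psi> x) - (h (\<phi> k x - \<psi> x) - h (- \<psi> x)))) \<longlonglongrightarrow> 0"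
    proof (rule tendsto_norm_L2_mono)
      show "square_integrable M (\<lambda>x. C * (y x - \<phi> k x))" for k
        by (intro square_integrable_cmult square_integrable_diff y sq\<phi>)
      show "(\<lambda>k. norm_L2 M (\<lambda>x. C * (y x - \<phi> k x))) \<longlonglongrightarrow> 0"
        unfolding norm_L2_cmult by (intro tendsto_mult_right_zero \<phi>(2))
      show "AE x in M. \<bar>h (y x - \<psi> x) - h (- \<psi> x) - (h (\<phi> k x - \<psi> x) - h (- \<psi> x))\<bar> \<le> \<bar>C * (y x - \<phi> k x)\<bar>" for k
        using lip[of "y x - \<psi> x" "\<phi> k x - \<psi> x" for x] C by (intro AE_I2) (simp add: abs_mult)
    qed measurable
    fix i
    \<comment> \<open>The error of the gradient is split. In \<open>?A\<close> the gradients
      converge in L^2 with a bounded factor; in \<open>?B\<close> the factor converges pointwise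
      against a fixed square integrable function, so dominated convergence applies.\<close>
    let ?A = "\<lambda>k x. h' (\<phi> k x - \<psi> x) * (g x $ i - partial_deriv i (\<phi> k) x)"
    let ?B = "\<lambda>k x. (h' (y x - \<psi> x) - h' (\<phi> k x - \<psi> x)) * (g x $ i - partial_deriv i \<psi> x)"
    have sqA: "square_integrable M (?A k)" for k
      by (rule square_integrable_mult_bounded[of _ _ _ C], intro square_integrable_diff gi sq\<phi>, measurable)
        (use h(3) in auto)
    have h2: "\<bar>h' s - h' t\<bar> \<le> 2 * C" for s t
      using h(3)[of s] h(3)[of t] by linarith
    have sqB: "square_integrable M (?B k)" for k
      by (rule square_integrable_mult_bounded[of _ _ _ "2 * C"], intro square_integrable_diff gi \<psi>i, measurable)
        (use h2 in auto)
    have limA: "(\<lambda>k. norm_L2 M (?A k)) \<longlonglongrightarrow> 0"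
    proof (rule tendsto_norm_L2_mono)
      show "square_integrable M (\<lambda>x. C * (g x $ i - partial_deriv i (\<phi> k) x))" for k
        by (intro square_integrable_cmult square_integrable_diff gi sq\<phi>)
      show "(\<lambda>k. norm_L2 M (\<lambda>x. C * (g x $ i - partial_deriv i (\<phi> k) x))) \<longlonglongrightarrow> 0"
        unfolding norm_L2_cmult by (intro tendsto_mult_right_zero \<phi>(3))
      show "AE x in M. \<bar>?A k x\<bar> \<le> \<bar>C * (g x $ i - partial_deriv i (\<phi> k) x)\<bar>" for k
        unfolding abs_mult using h(3) C by (intro AE_I2 mult_right_mono) auto
    qed measurable
    have limB: "(\<lambda>k. norm_L2 M (?B k)) \<longlonglongrightarrow> 0"
    proof (rule tendsto_norm_L2_dominated)
      show "square_integrable M (\<lambda>x. 2 * C * (g x $ i - partial_deriv i \<psi> x))"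
        by (intro square_integrable_cmult square_integrable_diff gi \<psi>i)
      show "AE x in M. (\<lambda>k. ?B k x) \<longlonglongrightarrow> 0"
        using \<phi>(4)
      proof eventually_elim
        case (elim x)
        have "isCont h' (y x - \<psi> x)"
          using h(2) by (simp add: continuous_on_eq_continuous_at)
        moreover have "(\<lambda>k. \<phi> k x - \<psi> x) \<longlonglongrightarrow> y x - \<psi> x"
          by (intro tendsto_diff elim tendsto_const)
        ultimately have "(\<lambda>k. h' (\<phi> k x - \<psi> x)) \<longlonglongrightarrow> h' (y x - \<psi> x)"
          by (rule isCont_tendsto_compose)
        from tendsto_diff[OF tendsto_const[of "h' (y x - \<psi> x)"] this] have "(\<lambda>k. h' (y x - \<psi> x) - h' (\<phi> k x - \<psi> x)) \<longlonglongrightarrow> 0"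
          by simp
        then show ?case
          by (rule tendsto_mult_left_zero)
      qed
      show "AE x in M. \<bar>?B k x\<bar> \<le> \<bar>2 * C * (g x $ i - partial_deriv i \<psi> x)\<bar>" for k
        unfolding abs_mult using h2 C by (intro AE_I2 mult_right_mono) auto
    qed measurable
    have "(\<lambda>k. norm_L2 M (\<lambda>x. ?A k x + ?B k x)) \<longlonglongrightarrow> 0"
      by (rule tendsto_norm_L2_add[OF sqA sqB limA limB])
    then show "(\<lambda>k. norm_L2 M (\<lambda>x. (h' (y x - \<psi> x) *\<^sub>R (g x - grad \<psi> x) + h' (- \<psi> x) *\<^sub>R grad \<psi> x) $ i
      - (h' (\<phi> k x - \<psi> x) *\<^sub>R (grad (\<phi> k) x - grad \<psi> x) + h' (- \<psi> x) *\<^sub>R grad \<psi> x) $ i)) \<longlonglongrightarrow> 0"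
      by (simp add: algebra_simps)
  qed
qed

lemma H10_grad_compose_0:
  assumes yg: "H10_grad S y g"
    and h: "\<And>t. (h has_real_derivative h' t) (at t)" "continuous_on UNIV h'" "\<And>t. \<bar>h' t\<bar> \<le> C" "h 0 = 0"
  shows "H10_grad S (\<lambda>x. h (y x)) (\<lambda>x. h' (y x) *\<^sub>R g x)"
proof -
  have "grad (\<lambda>x::real^'n. 0) = (\<lambda>x. 0)"
    by (intro ext) (simp add: vec_eq_iff)
  then show ?thesis
    using H10_grad_compose[OF yg smooth_const[of 0] h(1-3)] h(4) by simp
qed

end

section \<open>Existence of weak solutions\<close>

lemma lipschitz_continuous:
  fixes f :: "real \<Rightarrow> real"
  assumes "\<And>s t. \<bar>f s - f t\<bar> \<le> L * \<bar>s - t\<bar>"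
  shows "continuous_on UNIV f"
proof (rule lipschitz_on_continuous_on[of L])
  have "0 \<le> L"
    using assms[of 1 0] by simp
  then show "L-lipschitz_on UNIV f"
    using assms by (intro lipschitz_onI) (simp_all add: dist_real_def)
qed

text \<open>F is the primitive of f with F(0) = 0. Monotonicity of f puts F above its tangent lines,
  hence midpoint convexity and F \<ge> 0; the Lipschitz bound and the mean value theorem give the
  quadratic upper bound.\<close>

lemma convex_antiderivative:
  fixes f :: "real \<Rightarrow> real"
  assumes mono: "\<And>s t. s \<le> t \<Longrightarrow> f s \<le> f t" and lip: "\<And>s t. \<bar>f s - f t\<bar> \<le> L * \<bar>s - t\<bar>" and "f 0 = 0"
  obtains F where "continuous_on UNIV F" "\<And>t. 0 \<le> F t"
    "\<And>a b. F ((1/2) * a + (1/2) * b) \<le> (1/2) * F a + (1/2) * F b"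
    "\<And>a b. F (a + b) \<le> F a + f a * b + L * b\<^sup>2"
proof -
  have "continuous_on UNIV f"
    by (rule lipschitz_continuous[OF lip])
  then have "isCont f x" for x
    by (simp add: continuous_on_eq_continuous_at)
  with einterval_antiderivative[of "-\<infinity>" "\<infinity>" f] obtain F0 where "\<forall>x. (F0 has_vector_derivative f x) (at x)"
    by auto
  then have F0: "(F0 has_real_derivative f x) (at x)" for x
    by (simp add: has_real_derivative_iff_has_vector_derivative)
  define F where "F t = F0 t - F0 0" for t
  have F: "(F has_real_derivative f x) (at x)" for x
    unfolding F_def by (rule DERIV_cong[OF DERIV_diff[OF F0 DERIV_const]]) simp
  have mvt: "\<exists>z. min a b \<le> z \<and> z \<le> max a b \<and> F b - F a = (b - a) * f z" for a b
  proof (cases a b rule: linorder_cases)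
    case less
    with MVT2[of a b F f] F obtain z where "a < z" "z < b" "F b - F a = (b - a) * f z"
      by auto
    then show ?thesis
      using less by (intro exI[of _ z]) auto
  next
    case equal
    then show ?thesis
      by (intro exI[of _ a]) auto
  next
    case greater
    with MVT2[of b a F f] F obtain z where "b < z" "z < a" "F a - F b = (a - b) * f z"
      by auto
    then show ?thesis
      using greater by (intro exI[of _ z]) (auto simp: algebra_simps)
  qed
  have lower: "F a + f a * (b - a) \<le> F b" for a b
  proof -
    obtain z where z: "min a b \<le> z" "z \<le> max a b" "F b - F a = (b - a) * f z"
      using mvt[of a b] by auto
    have "0 \<le> (b - a) * (f z - f a)"
    proof (cases "a \<le> b")
      case True
      then show ?thesis
        using z mono[of a z] by (intro mult_nonneg_nonneg) auto
    next
      case False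
      then show ?thesis
        using z mono[of z a] by (intro mult_nonpos_nonpos) auto
    qed
    with z(3) show ?thesis
      by (simp add: algebra_simps)
  qed
  have upper: "F b \<le> F a + f a * (b - a) + L * (b - a)\<^sup>2" for a b
  proof -
    obtain z where z: "min a b \<le> z" "z \<le> max a b" "F b - F a = (b - a) * f z"
      using mvt[of a b] by auto
    have L: "0 \<le> L"
      using lip[of 1 0] by simp
    have "(b - a) * (f z - f a) \<le> \<bar>b - a\<bar> * \<bar>f z - f a\<bar>"
      by (metis abs_ge_self abs_mult)
    also have "\<dots> \<le> \<bar>b - a\<bar> * (L * \<bar>z - a\<bar>)"
      by (intro mult_left_mono lip) auto
    also have "\<dots> \<le> \<bar>b - a\<bar> * (L * \<bar>b - a\<bar>)"
      using z L by (intro mult_left_mono) auto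
    also have "\<dots> = L * (b - a)\<^sup>2"
      by (simp add: power2_eq_square abs_mult_self_eq flip: abs_mult)
    finally show ?thesis
      using z(3) by (simp add: algebra_simps)
  qed
  show ?thesis
  proof (rule that[of F])
    show "continuous_on UNIV F"
      by (intro continuous_at_imp_continuous_on ballI DERIV_isCont[OF F])
    show "0 \<le> F t" for t
      using lower[of 0 t] \<open>f 0 = 0\<close> by (simp add: F_def)
    show "F ((1/2) * a + (1/2) * b) \<le> (1/2) * F a + (1/2) * F b" for a b
      using lower[of "(1/2) * a + (1/2) * b" a] lower[of "(1/2) * a + (1/2) * b" b] by (simp add: algebra_simps)
    show "F (a + b) \<le> F a + f a * b + L * b\<^sup>2" for a b
      using upper[of "a + b" a] by simp
  qed
qed

context bounded_open
begin

text \<open>Writing 1 as the derivative of the coordinate x_i and integrating \<phi>^2 by parts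
  gives -2 times the integral of x_i \<phi> d_i \<phi>. Cauchy-Schwarz and the bound \<rho> for x_i
  on S lead to D = 2 \<rho>; a single direction suffices.\<close>

lemma Poincare_test:
  obtains D where "D > 0" "\<And>\<phi> i. \<phi> \<in> test_functions S \<Longrightarrow> norm_L2 M \<phi> \<le> D * norm_L2 M (partial_deriv i \<phi>)"
proof -
  obtain \<rho> where \<rho>: "\<rho> > 0" "\<And>x. x \<in> S \<Longrightarrow> norm x \<le> \<rho>"
    using bounded_S by (auto simp: bounded_pos)
  have "norm_L2 M \<phi> \<le> 2 * \<rho> * norm_L2 M (partial_deriv i \<phi>)" if \<phi>: "\<phi> \<in> test_functions S" for \<phi> i
  proof (cases "norm_L2 M \<phi> = 0")
    case False
    note s\<phi> = test_functions_smooth[OF \<phi>]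
    note sq = test_square_integrable[OF \<phi>] test_square_integrable[OF test_functions_partial_deriv[OF \<phi>], of i]
    have d: "partial_deriv i (\<lambda>x. \<phi> x * \<phi> x) x = 2 * (\<phi> x * partial_deriv i \<phi> x)" for x
      by (subst partial_deriv_mult[OF smooth_differentiable[OF s\<phi>] smooth_differentiable[OF s\<phi>]]) simp
    have "(norm_L2 M \<phi>)\<^sup>2 = (LINT x|M. \<phi> x * \<phi> x)"
      by (simp add: norm_L2_power2 power2_eq_square[of "\<phi> _"])
    also have "\<dots> = - (LINT x|M. x $ i * partial_deriv i (\<lambda>x. \<phi> x * \<phi> x) x)"
      using integration_by_parts_test[OF bounded_S S_lebesgue smooth_coord[of i] test_functions_smooth_mult[OF s\<phi> \<phi>], of i]
      by simp
    also have "\<dots> = 2 * (LINT x|M. \<phi> x * ((- x $ i) * partial_deriv i \<phi> x))"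
      unfolding d by (simp add: algebra_simps flip: Bochner_Integration.integral_mult_right_zero Bochner_Integration.integral_minus)
    also have "\<dots> \<le> 2 * (norm_L2 M \<phi> * norm_L2 M (\<lambda>x. (- x $ i) * partial_deriv i \<phi> x))"
      using Cauchy_Schwarz_L2[OF sq(1) test_square_integrable[OF test_functions_smooth_mult[OF smooth_uminus[OF smooth_coord[of i]]
        test_functions_partial_deriv[OF \<phi>]]], of i] by simp
    finally have 1: "(norm_L2 M \<phi>)\<^sup>2 \<le> 2 * (norm_L2 M \<phi> * norm_L2 M (\<lambda>x. (- x $ i) * partial_deriv i \<phi> x))" .
    have "norm_L2 M (\<lambda>x. (- x $ i) * partial_deriv i \<phi> x) \<le> norm_L2 M (\<lambda>x. \<rho> * partial_deriv i \<phi> x)"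
    proof (rule norm_L2_mono)
      show "square_integrable M (\<lambda>x. \<rho> * partial_deriv i \<phi> x)"
        by (rule square_integrable_cmult[OF sq(2)])
      show "(\<lambda>x. - x $ i * partial_deriv i \<phi> x) \<in> borel_measurable M"
        by (rule square_integrable_measurable[OF test_square_integrable[OF test_functions_smooth_mult[OF smooth_uminus[OF smooth_coord[of i]]
          test_functions_partial_deriv[OF \<phi>]]]])
      have "\<bar>- x $ i * partial_deriv i \<phi> x\<bar> \<le> \<bar>\<rho> * partial_deriv i \<phi> x\<bar>" if "x \<in> S" for x
        using order_trans[OF component_le_norm_cart[of x i] \<rho>(2)[OF that]] \<rho>(1)
        by (simp add: abs_mult mult_right_mono)
      then show "AE x in M. \<bar>- x $ i * partial_deriv i \<phi> x\<bar> \<le> \<bar>\<rho> * partial_deriv i \<phi> x\<bar>"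
        by (intro AE_I2) simp
    qed
    also have "\<dots> = \<rho> * norm_L2 M (partial_deriv i \<phi>)"
      using \<rho>(1) by (simp add: norm_L2_cmult)
    finally have "norm_L2 M \<phi> * norm_L2 M (\<lambda>x. (- x $ i) * partial_deriv i \<phi> x) \<le> norm_L2 M \<phi> * (\<rho> * norm_L2 M (partial_deriv i \<phi>))"
      by (rule mult_left_mono) simp
    with 1 have "norm_L2 M \<phi> * norm_L2 M \<phi> \<le> norm_L2 M \<phi> * (2 * \<rho> * norm_L2 M (partial_deriv i \<phi>))"
      unfolding power2_eq_square by linarith
    then show ?thesis
      using False norm_L2_nonneg[of M \<phi>] by (simp add: mult_le_cancel_left)
  qed (use \<rho> in simp)
  with \<rho>(1) show ?thesis
    by (intro that[of "2 * \<rho>"]) auto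
qed

section \<open>The Dirichlet form, the weak equation and its solution by minimization\<close>

definition Dirichlet :: "(real^'n \<Rightarrow> real) \<Rightarrow> (real^'n \<Rightarrow> real) \<Rightarrow> real" where
  "Dirichlet \<phi> \<psi> = (\<Sum>i\<in>UNIV. LINT x|M. partial_deriv i \<phi> x * partial_deriv i \<psi> x)"

lemma Dirichlet_self: "Dirichlet \<phi> \<phi> = (\<Sum>i\<in>UNIV. (norm_L2 M (partial_deriv i \<phi>))\<^sup>2)"
  by (simp add: Dirichlet_def norm_L2_power2 power2_eq_square[of "partial_deriv _ _ _"])

lemma norm_L2_partial_deriv_le_Dirichlet: "(norm_L2 M (partial_deriv i \<phi>))\<^sup>2 \<le> Dirichlet \<phi> \<phi>"
  unfolding Dirichlet_self by (rule member_le_sum) auto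

lemma Dirichlet_nonneg: "0 \<le> Dirichlet \<phi> \<phi>"
  unfolding Dirichlet_self by (simp add: sum_nonneg)

lemma partial_deriv_combination:
  assumes "\<phi> \<in> test_functions S" "\<psi> \<in> test_functions S"
  shows "partial_deriv i (\<lambda>x. a * \<phi> x + b * \<psi> x) x = a * partial_deriv i \<phi> x + b * partial_deriv i \<psi> x"
proof -
  note d = smooth_differentiable[OF test_functions_smooth[OF assms(1)], of x]
    smooth_differentiable[OF test_functions_smooth[OF assms(2)], of x]
  have c: "(\<lambda>x::real^'n. c) differentiable at x" for c :: real
    by simp
  have "partial_deriv i (\<lambda>x. a * \<phi> x + b * \<psi> x) x = partial_deriv i (\<lambda>x. a * \<phi> x) x + partial_deriv i (\<lambda>x. b * \<psi> x) x"
    by (intro partial_deriv_add differentiable_mult d c)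
  then show ?thesis
    using partial_deriv_mult[OF c d(1), of i a] partial_deriv_mult[OF c d(2), of i b] by simp
qed

lemma test_functions_combination:
  "\<phi> \<in> test_functions S \<Longrightarrow> \<psi> \<in> test_functions S \<Longrightarrow> (\<lambda>x. a * \<phi> x + b * \<psi> x) \<in> test_functions S"
  by (intro test_functions_add test_functions_cmult)

lemma Dirichlet_combination:
  assumes "\<phi> \<in> test_functions S" "\<psi> \<in> test_functions S"
  shows "Dirichlet (\<lambda>x. a * \<phi> x + b * \<psi> x) (\<lambda>x. a * \<phi> x + b * \<psi> x) =
    a\<^sup>2 * Dirichlet \<phi> \<phi> + 2 * a * b * Dirichlet \<phi> \<psi> + b\<^sup>2 * Dirichlet \<psi> \<psi>"
proof -
  have sq: "square_integrable M (partial_deriv i \<phi>)" "square_integrable M (partial_deriv i \<psi>)" for i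
    by (intro test_square_integrable test_functions_partial_deriv assms)+
  have "(LINT x|M. (a * partial_deriv i \<phi> x + b * partial_deriv i \<psi> x) * (a * partial_deriv i \<phi> x + b * partial_deriv i \<psi> x))
    = a\<^sup>2 * (LINT x|M. partial_deriv i \<phi> x * partial_deriv i \<phi> x) + 2 * a * b * (LINT x|M. partial_deriv i \<phi> x * partial_deriv i \<psi> x)
      + b\<^sup>2 * (LINT x|M. partial_deriv i \<psi> x * partial_deriv i \<psi> x)" (is "?l = ?r") for i
  proof -
    note int = integrable_mult_L2[OF sq(1) sq(1)] integrable_mult_L2[OF sq(1) sq(2)] integrable_mult_L2[OF sq(2) sq(2)]
    have "?l = (LINT x|M. a\<^sup>2 * (partial_deriv i \<phi> x * partial_deriv i \<phi> x) + 2 * a * b * (partial_deriv i \<phi> x * partial_deriv i \<psi> x)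
      + b\<^sup>2 * (partial_deriv i \<psi> x * partial_deriv i \<psi> x))"
      by (intro Bochner_Integration.integral_cong refl) (simp add: power2_eq_square algebra_simps)
    also have "\<dots> = ?r"
      using int by simp
    finally show ?thesis .
  qed
  then show ?thesis
    by (simp add: Dirichlet_def partial_deriv_combination[OF assms] sum.distrib sum_distrib_left)
qed

definition solves_weakly :: "(real^'n \<Rightarrow> real^'n) \<Rightarrow> (real^'n \<Rightarrow> real) \<Rightarrow> bool" where
  "solves_weakly g w \<longleftrightarrow> (\<forall>\<phi> \<gamma>. H10_grad S \<phi> \<gamma> \<longrightarrow> (LINT x|M. g x \<bullet> \<gamma> x) = (LINT x|M. w x * \<phi> x))"

text \<open>Density: both sides converge along the test functions that approximate
  \<open>\<phi>\<close> together with its gradient.\<close>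

lemma solves_weaklyI:
  assumes g: "\<And>i. square_integrable M (\<lambda>x. g x $ i)" and w: "square_integrable M w"
    and eq: "\<And>\<phi>. \<phi> \<in> test_functions S \<Longrightarrow> (\<Sum>i\<in>UNIV. LINT x|M. g x $ i * partial_deriv i \<phi> x) = (LINT x|M. w x * \<phi> x)"
  shows "solves_weakly g w"
  unfolding solves_weakly_def
proof (intro allI impI)
  fix \<phi> \<gamma>
  assume \<phi>\<gamma>: "H10_grad S \<phi> \<gamma>"
  obtain \<theta> where \<theta>: "\<And>k::nat. \<theta> k \<in> test_functions S" "(\<lambda>k. norm_L2 M (\<lambda>x. \<phi> x - \<theta> k x)) \<longlonglongrightarrow> 0"
    "\<And>i. (\<lambda>k. norm_L2 M (\<lambda>x. \<gamma> x $ i - partial_deriv i (\<theta> k) x)) \<longlonglongrightarrow> 0"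
    using H10_gradE[OF \<phi>\<gamma>] by blast
  have "(\<lambda>k. LINT x|M. \<theta> k x * w x) \<longlonglongrightarrow> (LINT x|M. \<phi> x * w x)"
    by (rule tendsto_integral_mult_L2[OF test_square_integrable[OF \<theta>(1)] H10_grad_L2[OF \<phi>\<gamma>] w \<theta>(2)])
  moreover have "(\<lambda>k. \<Sum>i\<in>UNIV. LINT x|M. partial_deriv i (\<theta> k) x * g x $ i) \<longlonglongrightarrow> (\<Sum>i\<in>UNIV. LINT x|M. \<gamma> x $ i * g x $ i)"
    by (intro tendsto_sum tendsto_integral_mult_L2[OF test_square_integrable[OF test_functions_partial_deriv[OF \<theta>(1)]]
      H10_grad_grad_L2[OF \<phi>\<gamma>] g \<theta>(3)])
  moreover have "(\<Sum>i\<in>UNIV. LINT x|M. partial_deriv i (\<theta> k) x * g x $ i) = (LINT x|M. \<theta> k x * w x)" for k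
    using eq[OF \<theta>(1)[of k]] by (simp add: mult.commute)
  ultimately have "(\<lambda>k. LINT x|M. \<theta> k x * w x) \<longlonglongrightarrow> (LINT x|M. \<phi> x * w x)"
    and "(\<lambda>k. LINT x|M. \<theta> k x * w x) \<longlonglongrightarrow> (\<Sum>i\<in>UNIV. LINT x|M. \<gamma> x $ i * g x $ i)"
    by simp_all
  then have "(LINT x|M. \<phi> x * w x) = (\<Sum>i\<in>UNIV. LINT x|M. \<gamma> x $ i * g x $ i)"
    by (rule LIMSEQ_unique)
  then show "(LINT x|M. g x \<bullet> \<gamma> x) = (LINT x|M. w x * \<phi> x)"
    unfolding integrable_inner_L2(2)[OF g H10_grad_grad_L2[OF \<phi>\<gamma>]] by (simp add: mult.commute)
qed

text \<open>The energy is minimized over test functions only; convexity makes a minimizing sequence a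
  Cauchy sequence in $H^1_0$, and the limit solves the Euler equation.\<close>

lemma weak_solution_exists:
  fixes f :: "real \<Rightarrow> real"
  assumes mono: "\<And>s t. s \<le> t \<Longrightarrow> f s \<le> f t" and lip: "\<And>s t. \<bar>f s - f t\<bar> \<le> L * \<bar>s - t\<bar>" and f0: "f 0 = 0"
    and u: "square_integrable M u"
  obtains y g where "H10_grad S y g" "square_integrable M (\<lambda>x. f (y x))" "solves_weakly g (\<lambda>x. u x - f (y x))"
proof -
  obtain F where F: "continuous_on UNIV F" "\<And>t. 0 \<le> F t"
    "\<And>a b. F ((1/2) * a + (1/2) * b) \<le> (1/2) * F a + (1/2) * F b"
    "\<And>a b. F (a + b) \<le> F a + f a * b + L * b\<^sup>2"
    by (rule convex_antiderivative[OF mono lip f0], assumption, rule that)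
  obtain D where D: "D > 0" "\<And>\<phi> i. \<phi> \<in> test_functions S \<Longrightarrow> norm_L2 M \<phi> \<le> D * norm_L2 M (partial_deriv i \<phi>)"
    by (rule Poincare_test) (rule that)
  have cf: "continuous_on UNIV f"
    by (rule lipschitz_continuous[OF lip])
  note [measurable] = borel_measurable_continuous_onI[OF cf] borel_measurable_continuous_onI[OF F(1)]
    square_integrable_measurable[OF u]
  have L: "0 \<le> L"
    using lip[of 1 0] by simp
  have f_sq: "square_integrable M (\<lambda>x. f (v x))" if v: "square_integrable M v" for v
  proof (rule square_integrable_bound[OF square_integrable_cmult[OF v, of L]])
    note [measurable] = square_integrable_measurable[OF v]
    show "(\<lambda>x. f (v x)) \<in> borel_measurable M"
      by measurable
    show "AE x in M. \<bar>f (v x)\<bar> \<le> \<bar>L * v x\<bar>"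
      using lip[of "v x" 0 for x] f0 L by (intro AE_I2) (simp add: abs_mult)
  qed
  have F_int: "integrable M (\<lambda>x. F (\<phi> x))" if "\<phi> \<in> test_functions S" for \<phi>
    by (rule square_integrable_integrable[OF finite_M continuous_square_integrable],
        rule continuous_on_compose2[OF F(1) smooth_continuous[OF test_functions_smooth[OF that]]]) simp
  note sq = test_square_integrable
  define E where "E \<phi> = (1/2) * Dirichlet \<phi> \<phi> + (LINT x|M. F (\<phi> x)) - (LINT x|M. u x * \<phi> x)" for \<phi>
  \<comment> \<open>The minimum over s of s^2/2 - D ||u|| s, where s is the square root of the
    Dirichlet integral.\<close>
  define B where "B = - (1/2) * (D * norm_L2 M u)\<^sup>2"
  have E_bound: "B \<le> E \<phi>" if \<phi>: "\<phi> \<in> test_functions S" for \<phi>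
  proof -
    define s where "s = sqrt (Dirichlet \<phi> \<phi>)"
    have s: "s\<^sup>2 = Dirichlet \<phi> \<phi>" "0 \<le> s"
      using Dirichlet_nonneg[of \<phi>] by (auto simp: s_def)
    \<comment> \<open>\<open>undefined\<close> stands for an arbitrary coordinate direction, since
      the Poincare inequality is available in each.\<close>
    have "norm_L2 M (partial_deriv undefined \<phi>) \<le> s"
      by (rule power2_le_imp_le[OF _ s(2)]) (simp add: s(1) norm_L2_partial_deriv_le_Dirichlet)
    then have "norm_L2 M \<phi> \<le> D * s"
      using D(2)[OF \<phi>, of undefined] D(1) by (meson less_imp_le mult_left_mono order_trans)
    then have "norm_L2 M u * norm_L2 M \<phi> \<le> norm_L2 M u * (D * s)"
      by (intro mult_left_mono) auto
    moreover have "(LINT x|M. u x * \<phi> x) \<le> norm_L2 M u * norm_L2 M \<phi>"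
      using Cauchy_Schwarz_L2[OF u sq[OF \<phi>]] by linarith
    moreover have "0 \<le> (LINT x|M. F (\<phi> x))"
      by (simp add: F(2))
    moreover have "B \<le> (1/2) * s\<^sup>2 - norm_L2 M u * (D * s)"
      using zero_le_power2[of "s - D * norm_L2 M u"] by (simp add: B_def power2_eq_square algebra_simps)
    ultimately show ?thesis
      unfolding E_def s(1)[symmetric] by linarith
  qed
  define m where "m = Inf (E ` test_functions S)"
  have bdd: "bdd_below (E ` test_functions S)"
    by (rule bdd_belowI2[of _ B]) (rule E_bound)
  have m_le: "m \<le> E \<phi>" if "\<phi> \<in> test_functions S" for \<phi>
    unfolding m_def by (rule cInf_lower[OF imageI[OF that] bdd])
  have "\<forall>k. \<exists>\<phi>. \<phi> \<in> test_functions S \<and> E \<phi> < m + inverse (real (Suc k))"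
  proof
    fix k
    have "E ` test_functions S \<noteq> {}"
      using test_functions_zero by blast
    moreover have "Inf (E ` test_functions S) < m + inverse (real (Suc k))"
      by (simp add: m_def)
    ultimately have "\<exists>e\<in>E ` test_functions S. e < m + inverse (real (Suc k))"
      by (rule cInf_lessD)
    then show "\<exists>\<phi>. \<phi> \<in> test_functions S \<and> E \<phi> < m + inverse (real (Suc k))"
      by (auto simp: Bex_def)
  qed
  from choice[OF this] obtain \<phi> where \<phi>0: "\<forall>k. \<phi> k \<in> test_functions S \<and> E (\<phi> k) < m + inverse (real (Suc k))"
    by (rule exE)
  then have \<phi>: "\<phi> k \<in> test_functions S" "E (\<phi> k) < m + inverse (real (Suc k))" for k
    by simp_all
  \<comment> \<open>The energy of the midpoint is at least m, while convexity of F and the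
    parallelogram identity put it below the mean of the two energies by at least 1/8 of this
    Dirichlet integral. The energies exceed m by less than 1/(k+1) and 1/(l+1), hence the factor
    4.\<close>
  have Dir: "Dirichlet (\<lambda>x. \<phi> k x - \<phi> l x) (\<lambda>x. \<phi> k x - \<phi> l x) \<le> 4 * inverse (real (Suc k)) + 4 * inverse (real (Suc l))" for k l
  proof -
    let ?m = "\<lambda>x. (1/2) * \<phi> k x + (1/2) * \<phi> l x"
    have mt: "?m \<in> test_functions S"
      by (intro test_functions_combination \<phi>)
    have "(LINT x|M. F (?m x)) \<le> (LINT x|M. (1/2) * F (\<phi> k x) + (1/2) * F (\<phi> l x))"
    proof (rule integral_mono[OF F_int[OF mt]])
      show "integrable M (\<lambda>x. (1/2) * F (\<phi> k x) + (1/2) * F (\<phi> l x))"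
        using F_int[OF \<phi>(1)[of k]] F_int[OF \<phi>(1)[of l]] by simp
    qed (rule F(3))
    also have "\<dots> = (1/2) * (LINT x|M. F (\<phi> k x)) + (1/2) * (LINT x|M. F (\<phi> l x))"
      using F_int[OF \<phi>(1)[of k]] F_int[OF \<phi>(1)[of l]] by simp
    finally have 1: "(LINT x|M. F (?m x)) \<le> (1/2) * (LINT x|M. F (\<phi> k x)) + (1/2) * (LINT x|M. F (\<phi> l x))" .
    have "(LINT x|M. u x * ?m x) = (LINT x|M. (1/2) * (u x * \<phi> k x) + (1/2) * (u x * \<phi> l x))"
      by (intro Bochner_Integration.integral_cong refl) (simp add: algebra_simps)
    also have "\<dots> = (1/2) * (LINT x|M. u x * \<phi> k x) + (1/2) * (LINT x|M. u x * \<phi> l x)"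
      using integrable_mult_L2[OF u sq[OF \<phi>(1)[of k]]] integrable_mult_L2[OF u sq[OF \<phi>(1)[of l]]] by simp
    finally have 2: "(LINT x|M. u x * ?m x) = (1/2) * (LINT x|M. u x * \<phi> k x) + (1/2) * (LINT x|M. u x * \<phi> l x)" .
    have 3: "Dirichlet ?m ?m = (1/4) * Dirichlet (\<phi> k) (\<phi> k) + (1/2) * Dirichlet (\<phi> k) (\<phi> l) + (1/4) * Dirichlet (\<phi> l) (\<phi> l)"
      using Dirichlet_combination[OF \<phi>(1)[of k] \<phi>(1)[of l], of "1/2" "1/2"] by (simp add: power2_eq_square)
    have 4: "Dirichlet (\<lambda>x. \<phi> k x - \<phi> l x) (\<lambda>x. \<phi> k x - \<phi> l x) =
        Dirichlet (\<phi> k) (\<phi> k) - 2 * Dirichlet (\<phi> k) (\<phi> l) + Dirichlet (\<phi> l) (\<phi> l)"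
      using Dirichlet_combination[OF \<phi>(1)[of k] \<phi>(1)[of l], of 1 "-1"] by simp
    show ?thesis
      using m_le[OF mt] 1 \<phi>(2)[of k] \<phi>(2)[of l] unfolding E_def 2 3 4 by argo
  qed
  \<comment> \<open>Used with c = \<open>D\<^sup>2\<close> for the values and with c = 1 for the
    partial derivatives.\<close>
  have Cauchy: "\<exists>N. \<forall>k\<ge>N. \<forall>l\<ge>N. norm_L2 M (\<lambda>x. v k x - v l x) < e"
    if e: "e > 0" and v: "\<And>k l. (norm_L2 M (\<lambda>x. v k x - v l x))\<^sup>2 \<le> c * (4 * inverse (real (Suc k)) + 4 * inverse (real (Suc l)))"
      and c: "c > 0" for e c :: real and v :: "nat \<Rightarrow> real^'n \<Rightarrow> real"
  proof -
    have "0 < e\<^sup>2 / (8 * c)"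
      using e c by simp
    then obtain N where N: "inverse (real (Suc N)) < e\<^sup>2 / (8 * c)"
      using reals_Archimedean by blast
    have "norm_L2 M (\<lambda>x. v k x - v l x) < e" if "k \<ge> N" "l \<ge> N" for k l
    proof (rule power2_less_imp_less)
      have "inverse (real (Suc k)) \<le> inverse (real (Suc N))" "inverse (real (Suc l)) \<le> inverse (real (Suc N))"
        using that by (auto intro!: le_imp_inverse_le)
      then have "4 * inverse (real (Suc k)) + 4 * inverse (real (Suc l)) < 8 * (e\<^sup>2 / (8 * c))"
        using N by linarith
      then have "c * (4 * inverse (real (Suc k)) + 4 * inverse (real (Suc l))) < c * (8 * (e\<^sup>2 / (8 * c)))"
        by (rule mult_strict_left_mono[OF _ c])
      also have "\<dots> = e\<^sup>2"
        using c by simp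
      finally show "(norm_L2 M (\<lambda>x. v k x - v l x))\<^sup>2 < e\<^sup>2"
        using v[of k l] by linarith
    qed (use e in simp)
    then show ?thesis
      by blast
  qed
  have diff_test: "(\<lambda>x. \<phi> k x - \<phi> l x) \<in> test_functions S" for k l
    by (intro test_functions_diff \<phi>)
  have pd: "partial_deriv i (\<lambda>x. \<phi> k x - \<phi> l x) x = partial_deriv i (\<phi> k) x - partial_deriv i (\<phi> l) x" for i k l x
    by (intro partial_deriv_diff smooth_differentiable test_functions_smooth[OF \<phi>(1)])
  have grad_norm: "(norm_L2 M (\<lambda>x. partial_deriv i (\<phi> k) x - partial_deriv i (\<phi> l) x))\<^sup>2
      \<le> 4 * inverse (real (Suc k)) + 4 * inverse (real (Suc l))" for i k l
    using norm_L2_partial_deriv_le_Dirichlet[of i "\<lambda>x. \<phi> k x - \<phi> l x"] Dir[of k l]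
    unfolding pd by (rule order_trans)
  have val_norm: "(norm_L2 M (\<lambda>x. \<phi> k x - \<phi> l x))\<^sup>2 \<le> D\<^sup>2 * (4 * inverse (real (Suc k)) + 4 * inverse (real (Suc l)))" for k l
  proof -
    have "(norm_L2 M (\<lambda>x. \<phi> k x - \<phi> l x))\<^sup>2 \<le> (D * norm_L2 M (partial_deriv undefined (\<lambda>x. \<phi> k x - \<phi> l x)))\<^sup>2"
      by (rule power_mono[OF D(2)[OF diff_test] norm_L2_nonneg])
    also have "\<dots> \<le> D\<^sup>2 * (4 * inverse (real (Suc k)) + 4 * inverse (real (Suc l)))"
      unfolding power_mult_distrib pd by (intro mult_left_mono grad_norm zero_le_power2)
    finally show ?thesis .
  qed
  have "0 < D\<^sup>2"
    using D(1) by simp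
  obtain y where y: "square_integrable M y" "(\<lambda>k. norm_L2 M (\<lambda>x. y x - \<phi> k x)) \<longlonglongrightarrow> 0"
    by (rule complete_L2[of M \<phi>, OF sq[OF \<phi>(1)] Cauchy[OF _ val_norm \<open>0 < D\<^sup>2\<close>]], assumption, rule that)
  have "\<forall>i. \<exists>v. square_integrable M v \<and> (\<lambda>k. norm_L2 M (\<lambda>x. v x - partial_deriv i (\<phi> k) x)) \<longlonglongrightarrow> 0"
  proof
    fix i
    have *: "(norm_L2 M (\<lambda>x. partial_deriv i (\<phi> k) x - partial_deriv i (\<phi> l) x))\<^sup>2
      \<le> 1 * (4 * inverse (real (Suc k)) + 4 * inverse (real (Suc l)))" for k l
      using grad_norm[of i k l] by simp
    obtain v where "square_integrable M v" "(\<lambda>k. norm_L2 M (\<lambda>x. v x - partial_deriv i (\<phi> k) x)) \<longlonglongrightarrow> 0"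
      by (rule complete_L2[of M "\<lambda>k. partial_deriv i (\<phi> k)",
        OF sq[OF test_functions_partial_deriv[OF \<phi>(1)]] Cauchy[OF _ * zero_less_one]], assumption, rule that)
    then show "\<exists>v. square_integrable M v \<and> (\<lambda>k. norm_L2 M (\<lambda>x. v x - partial_deriv i (\<phi> k) x)) \<longlonglongrightarrow> 0"
      by (intro exI[of _ v] conjI)
  qed
  from choice[OF this] obtain v where v: "\<forall>i. square_integrable M (v i) \<and> (\<lambda>k. norm_L2 M (\<lambda>x. v i x - partial_deriv i (\<phi> k) x)) \<longlonglongrightarrow> 0"
    by (rule exE)
  define g where "g x = (\<chi> i. v i x)" for x
  have g: "square_integrable M (\<lambda>x. g x $ i)" "(\<lambda>k. norm_L2 M (\<lambda>x. g x $ i - partial_deriv i (\<phi> k) x)) \<longlonglongrightarrow> 0" for i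
    using v by (simp_all add: g_def)
  have yg: "H10_grad S y g"
    by (rule H10_gradI[OF y(1) g(1) \<phi>(1) y(2) g(2)])
  have fy: "square_integrable M (\<lambda>x. f (y x))"
    by (rule f_sq[OF y(1)])
  have "solves_weakly g (\<lambda>x. u x - f (y x))"
  proof (rule solves_weaklyI[OF g(1)])
    show "square_integrable M (\<lambda>x. u x - f (y x))"
      by (rule square_integrable_diff[OF u fy])
    fix \<theta> :: "real^'n \<Rightarrow> real"
    assume \<theta>: "\<theta> \<in> test_functions S"
    \<comment> \<open>The coefficient of \<tau>^2 in the bound for the energy of
      \<open>\<phi> k\<close> + \<tau> \<open>\<theta>\<close>; the added 1 keeps it positive, so
      that it can be divided by.\<close>
    define C where "C = (1/2) * Dirichlet \<theta> \<theta> + L * (norm_L2 M \<theta>)\<^sup>2 + 1"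
    have C: "C > 0"
      using Dirichlet_nonneg[of \<theta>] L by (simp add: C_def add_nonneg_pos)
    define d where "d k = Dirichlet (\<phi> k) \<theta> + (LINT x|M. f (\<phi> k x) * \<theta> x) - (LINT x|M. u x * \<theta> x)" for k
    \<comment> \<open>\<open>\<phi> k\<close> minimizes only up to 1/(k+1). What remains is a
      quadratic inequality in \<tau> whose linear coefficient \<open>d k\<close> is the residual of
      the Euler equation.\<close>
    have step: "0 \<le> \<tau> * d k + \<tau>\<^sup>2 * C + inverse (real (Suc k))" for k \<tau>
    proof -
      let ?p = "\<lambda>x. 1 * \<phi> k x + \<tau> * \<theta> x"
      have pt: "?p \<in> test_functions S"
        by (intro test_functions_combination \<phi> \<theta>)
      note int = F_int[OF \<phi>(1)[of k]] integrable_mult_L2[OF f_sq[OF sq[OF \<phi>(1)[of k]]] sq[OF \<theta>]]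
        square_integrable_power2[OF sq[OF \<theta>]]
      have "(LINT x|M. F (?p x)) \<le> (LINT x|M. F (\<phi> k x) + \<tau> * (f (\<phi> k x) * \<theta> x) + L * \<tau>\<^sup>2 * (\<theta> x)\<^sup>2)"
      proof (rule integral_mono[OF F_int[OF pt]])
        show "integrable M (\<lambda>x. F (\<phi> k x) + \<tau> * (f (\<phi> k x) * \<theta> x) + L * \<tau>\<^sup>2 * (\<theta> x)\<^sup>2)"
          using int by simp
        show "F (?p x) \<le> F (\<phi> k x) + \<tau> * (f (\<phi> k x) * \<theta> x) + L * \<tau>\<^sup>2 * (\<theta> x)\<^sup>2" for x
          using F(4)[of "\<phi> k x" "\<tau> * \<theta> x"] by (simp add: algebra_simps power_mult_distrib)
      qed
      also have "\<dots> = (LINT x|M. F (\<phi> k x)) + \<tau> * (LINT x|M. f (\<phi> k x) * \<theta> x) + L * \<tau>\<^sup>2 * (norm_L2 M \<theta>)\<^sup>2"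
        using int by (simp add: norm_L2_power2)
      finally have 1: "(LINT x|M. F (?p x)) \<le> \<dots>" .
      have "(LINT x|M. u x * ?p x) = (LINT x|M. u x * \<phi> k x + \<tau> * (u x * \<theta> x))"
        by (intro Bochner_Integration.integral_cong refl) (simp add: algebra_simps)
      also have "\<dots> = (LINT x|M. u x * \<phi> k x) + \<tau> * (LINT x|M. u x * \<theta> x)"
        using integrable_mult_L2[OF u sq[OF \<phi>(1)[of k]]] integrable_mult_L2[OF u sq[OF \<theta>]] by simp
      finally have 2: "(LINT x|M. u x * ?p x) = (LINT x|M. u x * \<phi> k x) + \<tau> * (LINT x|M. u x * \<theta> x)" .
      have 3: "Dirichlet ?p ?p = Dirichlet (\<phi> k) (\<phi> k) + 2 * \<tau> * Dirichlet (\<phi> k) \<theta> + \<tau>\<^sup>2 * Dirichlet \<theta> \<theta>"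
        using Dirichlet_combination[OF \<phi>(1)[of k] \<theta>, of 1 \<tau>] by simp
      have "0 \<le> E ?p - E (\<phi> k) + inverse (real (Suc k))"
        using m_le[OF pt] \<phi>(2)[of k] by linarith
      also have "\<dots> \<le> \<tau> * d k + \<tau>\<^sup>2 * (C - 1) + inverse (real (Suc k))"
        using 1 unfolding E_def 2 3 d_def C_def by (simp add: algebra_simps)
      also have "\<dots> \<le> \<tau> * d k + \<tau>\<^sup>2 * C + inverse (real (Suc k))"
        by (simp add: right_diff_distrib)
      finally show ?thesis .
    qed
    \<comment> \<open>The quadratic is evaluated at its minimizer \<tau> = - d k / (2 C).\<close>
    have d_bound: "(d k)\<^sup>2 \<le> 4 * C * inverse (real (Suc k))" for k
    proof -
      have "- d k / (2 * C) * d k + (- d k / (2 * C))\<^sup>2 * C = - (d k)\<^sup>2 / (4 * C)"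
        using C by (simp add: power2_eq_square field_simps)
      with step[of "- d k / (2 * C)" k] have "(d k)\<^sup>2 / (4 * C) \<le> inverse (real (Suc k))"
        by simp
      then show ?thesis
        using C by (simp add: pos_divide_le_eq mult.commute)
    qed
    have "(\<lambda>k. (d k)\<^sup>2) \<longlonglongrightarrow> 0"
    proof (rule tendsto_sandwich[OF _ _ tendsto_const])
      show "(\<lambda>k. 4 * C * inverse (real (Suc k))) \<longlonglongrightarrow> 0"
        by (intro tendsto_mult_right_zero LIMSEQ_inverse_real_of_nat)
    qed (use d_bound in auto)
    then have d0: "d \<longlonglongrightarrow> 0"
      by (simp add: tendsto_null_power)
    have "(\<lambda>k. Dirichlet (\<phi> k) \<theta>) \<longlonglongrightarrow> (\<Sum>i\<in>UNIV. LINT x|M. g x $ i * partial_deriv i \<theta> x)"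
      unfolding Dirichlet_def
      by (intro tendsto_sum tendsto_integral_mult_L2[OF sq[OF test_functions_partial_deriv[OF \<phi>(1)]]
        g(1) sq[OF test_functions_partial_deriv[OF \<theta>]] g(2)])
    moreover have "(\<lambda>k. LINT x|M. f (\<phi> k x) * \<theta> x) \<longlonglongrightarrow> (LINT x|M. f (y x) * \<theta> x)"
    proof (rule tendsto_integral_mult_L2[OF f_sq[OF sq[OF \<phi>(1)]] fy sq[OF \<theta>]])
      note [measurable] = square_integrable_measurable[OF y(1)] square_integrable_measurable[OF sq[OF \<phi>(1)]]
      show "(\<lambda>k. norm_L2 M (\<lambda>x. f (y x) - f (\<phi> k x))) \<longlonglongrightarrow> 0"
      proof (rule tendsto_norm_L2_mono)
        show "square_integrable M (\<lambda>x. L * (y x - \<phi> k x))" for k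
          by (intro square_integrable_cmult square_integrable_diff y(1) sq[OF \<phi>(1)])
        show "(\<lambda>k. norm_L2 M (\<lambda>x. L * (y x - \<phi> k x))) \<longlonglongrightarrow> 0"
          unfolding norm_L2_cmult by (intro tendsto_mult_right_zero y(2))
        show "AE x in M. \<bar>f (y x) - f (\<phi> k x)\<bar> \<le> \<bar>L * (y x - \<phi> k x)\<bar>" for k
          using lip[of "y x" "\<phi> k x" for x] L by (intro AE_I2) (simp add: abs_mult)
      qed measurable
    qed
    ultimately have "d \<longlonglongrightarrow> (\<Sum>i\<in>UNIV. LINT x|M. g x $ i * partial_deriv i \<theta> x) + (LINT x|M. f (y x) * \<theta> x) - (LINT x|M. u x * \<theta> x)"
      unfolding d_def[abs_def] by (intro tendsto_diff tendsto_add tendsto_const)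
    from LIMSEQ_unique[OF this d0]
    have "(\<Sum>i\<in>UNIV. LINT x|M. g x $ i * partial_deriv i \<theta> x) = (LINT x|M. u x * \<theta> x) - (LINT x|M. f (y x) * \<theta> x)"
      by simp
    also have "\<dots> = (LINT x|M. (u x - f (y x)) * \<theta> x)"
      using integrable_mult_L2[OF u sq[OF \<theta>]] integrable_mult_L2[OF fy sq[OF \<theta>]] by (simp add: left_diff_distrib)
    finally show "(\<Sum>i\<in>UNIV. LINT x|M. g x $ i * partial_deriv i \<theta> x) = (LINT x|M. (u x - f (y x)) * \<theta> x)" .
  qed
  with yg fy show ?thesis
    by (rule that)
qed

end

section \<open>Uniqueness and bounds\<close>

lemma flat_pos: "0 < t \<Longrightarrow> 0 < flat j t" and flat_nonpos [simp]: "t \<le> 0 \<Longrightarrow> flat j t = 0"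
  and flat_nonneg: "0 \<le> flat j t"
  by (auto simp: flat_def)

text \<open>With s = 1/t this is s^2 \<le> 2 exp s. It bounds the derivative of
  \<open>flat 0\<close>, as the chain rule requires.\<close>

lemma flat_2_le: "flat 2 t \<le> 2"
proof (cases "t > 0")
  case True
  define s where "s = 1 / t"
  have s: "s > 0"
    using True by (simp add: s_def)
  have "1 + s + s\<^sup>2 / 2 \<le> exp s"
    by (rule exp_lower_Taylor_quadratic) (use s in simp)
  then have "s\<^sup>2 \<le> 2 * exp s"
    using s by linarith
  then have "s\<^sup>2 * exp (- s) \<le> 2 * exp s * exp (- s)"
    by (rule mult_right_mono) simp
  also have "\<dots> = 2"
    by (simp add: exp_minus)
  finally show ?thesis
    using True by (simp add: flat_def s_def)
qed simp

lemma flat_0_deriv: "(flat 0 has_real_derivative flat 2 t) (at t)"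
  using flat_deriv[of 0 t] by (simp add: numeral_2_eq_2)

lemma continuous_on_flat: "continuous_on A (flat j)"
  by (intro continuous_at_imp_continuous_on ballI DERIV_isCont[OF flat_deriv])

lemma abs_flat_2_le: "\<bar>flat 2 t\<bar> \<le> 2"
  using flat_2_le[of t] flat_nonneg[of 2 t] by simp

lemma integrable_mult_bounded:
  fixes w \<phi> :: "'a \<Rightarrow> real"
  assumes "integrable M w" "\<phi> \<in> borel_measurable M" "\<And>x. \<bar>\<phi> x\<bar> \<le> C"
  shows "integrable M (\<lambda>x. w x * \<phi> x)"
proof (rule Bochner_Integration.integrable_bound)
  note [measurable] = borel_measurable_integrable[OF assms(1)] assms(2)
  show "integrable M (\<lambda>x. C * w x)"
    using assms(1) by simp
  show "(\<lambda>x. w x * \<phi> x) \<in> borel_measurable M"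
    by measurable
  have "\<bar>w x\<bar> * \<bar>\<phi> x\<bar> \<le> \<bar>w x\<bar> * \<bar>C\<bar>" for x
    using assms(3)[of x] by (intro mult_left_mono) auto
  then show "AE x in M. norm (w x * \<phi> x) \<le> norm (C * w x)"
    by (intro AE_I2) (simp add: abs_mult mult.commute)
qed

text \<open>The derivative of f is frozen outside [-B, B] and integrated again. The result is
  nondecreasing and globally Lipschitz, and on the interval where a bounded solution takes its
  values nothing changes.\<close>

lemma C1_truncation:
  fixes f :: "real \<Rightarrow> real"
  assumes C1: "f C1_differentiable_on UNIV" and mono: "mono f" and f0: "f 0 = 0" and B: "0 < B"
  obtains h h' L where "\<And>t. (h has_real_derivative h' t) (at t)" "continuous_on UNIV h'"
    "\<And>t. 0 \<le> h' t" "\<And>t. \<bar>h' t\<bar> \<le> L" "h 0 = 0" "\<And>t. \<bar>t\<bar> \<le> B \<Longrightarrow> h t = f t"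
proof -
  obtain d where d: "\<And>x. (f has_vector_derivative d x) (at x)" "continuous_on UNIV d"
    using C1 unfolding C1_differentiable_on_def by auto
  have f': "(f has_real_derivative d x) (at x)" for x
    using d(1) by (simp add: has_real_derivative_iff_has_vector_derivative)
  have d_nonneg: "0 \<le> d x" for x
    by (rule mono_on_imp_deriv_nonneg[of UNIV f]) (use mono f' in \<open>auto simp: mono_def mono_on_def\<close>)
  define h' where "h' t = d (max (- B) (min B t))" for t
  have h': "continuous_on UNIV h'"
    unfolding h'_def by (rule continuous_on_compose2[OF d(2)]) (auto intro!: continuous_intros)
  then have "isCont h' x" for x
    by (simp add: continuous_on_eq_continuous_at)
  with einterval_antiderivative[of "-\<infinity>" "\<infinity>" h'] obtain H where "\<forall>x. (H has_vector_derivative h' x) (at x)"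
    by auto
  then have H: "(H has_real_derivative h' x) (at x)" for x
    by (simp add: has_real_derivative_iff_has_vector_derivative)
  define h where "h t = H t - H 0" for t
  have h: "(h has_real_derivative h' t) (at t)" for t
    unfolding h_def by (rule DERIV_cong[OF DERIV_diff[OF H DERIV_const]]) simp
  have "compact (d ` {-B..B})"
    by (intro compact_continuous_image continuous_on_subset[OF d(2)]) auto
  then have "bounded (d ` {-B..B})"
    by (rule compact_imp_bounded)
  then obtain L where "\<forall>x\<in>{-B..B}. \<bar>d x\<bar> \<le> L"
    unfolding bounded_iff ball_simps real_norm_def by (rule exE)
  then have L: "\<bar>d x\<bar> \<le> L" if "x \<in> {-B..B}" for x
    using that by blast
  show ?thesis
  proof (rule that[OF h h'])
    show "0 \<le> h' t" "\<bar>h' t\<bar> \<le> L" for t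
      using B unfolding h'_def by (auto intro: d_nonneg L)
    show h0: "h 0 = 0"
      by (simp add: h_def)
    fix t :: real
    assume t: "\<bar>t\<bar> \<le> B"
    have "norm ((\<lambda>t. h t - f t) t - (\<lambda>t. h t - f t) 0) \<le> 0 * norm (t - 0)"
    proof (rule field_differentiable_bound[where S = "{-B..B}" and f' = "\<lambda>t. h' t - d t"])
      show "((\<lambda>t. h t - f t) has_real_derivative (h' s - d s)) (at s within {-B..B})" for s
        by (rule DERIV_diff[OF has_field_derivative_at_within[OF h] has_field_derivative_at_within[OF f']])
      show "norm (h' s - d s) \<le> 0" if "s \<in> {-B..B}" for s
      proof -
        have "max (- B) (min B s) = s"
          using that by auto
        then show ?thesis
          by (simp add: h'_def)
      qed
      show "t \<in> {-B..B}" "0 \<in> {-B..B}"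
        using t B by (auto simp: abs_le_iff)
    qed (rule convex_real_interval)
    then show "h t = f t"
      by (simp add: h0 f0)
  qed
qed

context bounded_open
begin

lemma solves_weaklyD:
  assumes "solves_weakly g w" "H10_grad S \<phi> \<gamma>"
  shows "(LINT x|M. g x \<bullet> \<gamma> x) = (LINT x|M. w x * \<phi> x)"
  using assms by (simp add: solves_weakly_def)

lemma solves_weakly_uminus:
  assumes "solves_weakly g w"
  shows "solves_weakly (\<lambda>x. - g x) (\<lambda>x. - w x)"
  using assms by (simp add: solves_weakly_def)

lemma H10_grad_uminus: "H10_grad S y g \<Longrightarrow> H10_grad S (\<lambda>x. - y x) (\<lambda>x. - g x)"
  using H10_grad_cmult[of y g "-1"] by simp

text \<open>The difference of two solutions need not be bounded, hence it is not admissible as a test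
  function; its arctangent is.\<close>

lemma weak_solution_unique:
  fixes f :: "real \<Rightarrow> real"
  assumes f: "strict_mono f"
    and yg: "H10_grad S y g" "H10_grad S z h"
    and int: "integrable M (\<lambda>x. f (y x))" "integrable M (\<lambda>x. f (z x))"
    and y: "\<And>\<phi> \<gamma> C. H10_grad S \<phi> \<gamma> \<Longrightarrow> (\<And>x. \<bar>\<phi> x\<bar> \<le> C) \<Longrightarrow>
      (LINT x|M. g x \<bullet> \<gamma> x) + (LINT x|M. f (y x) * \<phi> x) = U \<phi>"
    and z: "\<And>\<phi> \<gamma> C. H10_grad S \<phi> \<gamma> \<Longrightarrow> (\<And>x. \<bar>\<phi> x\<bar> \<le> C) \<Longrightarrow>
      (LINT x|M. h x \<bullet> \<gamma> x) + (LINT x|M. f (z x) * \<phi> x) = U \<phi>"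
  shows "AE x in M. y x = z x"
proof -
  let ?w = "\<lambda>x. y x - z x"
  let ?d = "\<lambda>t::real. inverse (1 + t\<^sup>2)"
  let ?\<phi> = "\<lambda>x. arctan (?w x)"
  let ?\<gamma> = "\<lambda>x. ?d (?w x) *\<^sub>R (g x - h x)"
  have w: "H10_grad S ?w (\<lambda>x. g x - h x)"
    by (rule H10_grad_diff[OF yg])
  have nz: "1 + t\<^sup>2 \<noteq> 0" for t :: real
    using zero_le_power2[of t] by linarith
  have \<phi>\<gamma>: "H10_grad S ?\<phi> ?\<gamma>"
  proof (rule H10_grad_compose_0[OF w])
    show "(arctan has_real_derivative ?d t) (at t)" for t
      by (rule DERIV_arctan)
    show "continuous_on UNIV ?d"
      by (intro continuous_intros) (use nz in auto)
    show "\<bar>?d t\<bar> \<le> 1" for t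
      using le_imp_inverse_le[of 1 "1 + t\<^sup>2"] by simp
  qed simp
  have bd: "\<bar>?\<phi> x\<bar> \<le> pi / 2" for x
    using arctan_lbound[of "?w x"] arctan_ubound[of "?w x"] by (simp only: abs_le_iff) linarith
  have m\<phi>: "?\<phi> \<in> borel_measurable M"
    by (rule square_integrable_measurable[OF H10_grad_L2[OF \<phi>\<gamma>]])
  note i1 = integrable_inner_L2(1)[OF H10_grad_grad_L2[OF yg(1)] H10_grad_grad_L2[OF \<phi>\<gamma>]]
    integrable_inner_L2(1)[OF H10_grad_grad_L2[OF yg(2)] H10_grad_grad_L2[OF \<phi>\<gamma>]]
  note i2 = integrable_mult_bounded[OF int(1) m\<phi> bd] integrable_mult_bounded[OF int(2) m\<phi> bd]
  have "(LINT x|M. g x \<bullet> ?\<gamma> x) - (LINT x|M. h x \<bullet> ?\<gamma> x) + ((LINT x|M. f (y x) * ?\<phi> x) - (LINT x|M. f (z x) * ?\<phi> x)) = 0"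
    using y[OF \<phi>\<gamma> bd] z[OF \<phi>\<gamma> bd] by simp
  moreover have "(LINT x|M. g x \<bullet> ?\<gamma> x) - (LINT x|M. h x \<bullet> ?\<gamma> x) = (LINT x|M. g x \<bullet> ?\<gamma> x - h x \<bullet> ?\<gamma> x)"
    by (rule Bochner_Integration.integral_diff[OF i1, symmetric])
  moreover have "(LINT x|M. f (y x) * ?\<phi> x) - (LINT x|M. f (z x) * ?\<phi> x) = (LINT x|M. f (y x) * ?\<phi> x - f (z x) * ?\<phi> x)"
    by (rule Bochner_Integration.integral_diff[OF i2, symmetric])
  moreover have "0 \<le> (LINT x|M. g x \<bullet> ?\<gamma> x - h x \<bullet> ?\<gamma> x)"
  proof (rule Bochner_Integration.integral_nonneg)
    fix x
    have "g x \<bullet> ?\<gamma> x - h x \<bullet> ?\<gamma> x = ?d (?w x) * ((g x - h x) \<bullet> (g x - h x))"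
      by (simp only: inner_scaleR_right right_diff_distrib inner_diff_left)
    then show "0 \<le> g x \<bullet> ?\<gamma> x - h x \<bullet> ?\<gamma> x"
      by simp
  qed
  \<comment> \<open>Both f s - f t and arctan (s - t) have the sign of s - t, and each vanishes only
    for s = t; a vanishing integral therefore forces equality.\<close>
  moreover have sign: "0 \<le> f s * arctan (s - t) - f t * arctan (s - t)" "f s * arctan (s - t) - f t * arctan (s - t) = 0 \<longleftrightarrow> s = t" for s t
  proof -
    have eq: "f s * arctan (s - t) - f t * arctan (s - t) = (f s - f t) * arctan (s - t)"
      by (simp add: left_diff_distrib)
    consider "s < t" | "s = t" | "t < s"
      by linarith
    then have "0 \<le> (f s - f t) * arctan (s - t) \<and> ((f s - f t) * arctan (s - t) = 0 \<longleftrightarrow> s = t)"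
    proof cases
      case 1
      then have "f s - f t < 0" "arctan (s - t) < 0"
        using strict_monoD[OF f, of s t] by auto
      then show ?thesis
        using 1 mult_neg_neg[of "f s - f t" "arctan (s - t)"] by auto
    next
      case 3
      then have "f s - f t > 0" "arctan (s - t) > 0"
        using strict_monoD[OF f, of t s] by auto
      then show ?thesis
        using 3 mult_pos_pos[of "f s - f t" "arctan (s - t)"] by auto
    qed simp
    then show "0 \<le> f s * arctan (s - t) - f t * arctan (s - t)" "f s * arctan (s - t) - f t * arctan (s - t) = 0 \<longleftrightarrow> s = t"
      unfolding eq by blast+
  qed
  moreover have "0 \<le> (LINT x|M. f (y x) * ?\<phi> x - f (z x) * ?\<phi> x)"
    by (rule Bochner_Integration.integral_nonneg) (rule sign(1))
  ultimately have "(LINT x|M. f (y x) * ?\<phi> x - f (z x) * ?\<phi> x) = 0"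
    by linarith
  then have "AE x in M. f (y x) * ?\<phi> x - f (z x) * ?\<phi> x = 0"
    using integral_nonneg_eq_0_iff_AE[OF Bochner_Integration.integrable_diff[OF i2]] sign(1) by simp
  then show ?thesis
    unfolding sign(2) .
qed

text \<open>A comparison with the supersolution $K (\rho^2 - x_i^2) / 2$ of the Poisson equation with
  right-hand side $K$.\<close>

lemma weak_solution_upper_bound:
  assumes yg: "H10_grad S y g" and u: "square_integrable M u" and w: "square_integrable M w"
    and sol: "solves_weakly g (\<lambda>x. u x - w x)"
    and sign: "\<And>x. x \<in> S \<Longrightarrow> 0 \<le> y x \<Longrightarrow> 0 \<le> w x"
    and K: "\<And>x. x \<in> S \<Longrightarrow> u x < K" "0 \<le> K" and \<rho>: "\<And>x. x \<in> S \<Longrightarrow> norm x \<le> \<rho>"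
  shows "AE x in M. y x \<le> K / 2 * \<rho>\<^sup>2"
proof -
  \<comment> \<open>One arbitrary coordinate; the barrier \<open>\<psi>\<close> depends on it
    alone.\<close>
  define i where "i = (undefined :: 'n)"
  define \<psi> where "\<psi> x = K / 2 * (\<rho>\<^sup>2 - (x $ i) ^ 2)" for x :: "real^'n"
  have s\<psi>: "smooth \<psi>"
    unfolding \<psi>_def by (intro smooth_mult smooth_diff smooth_power smooth_const smooth_coord)
  have \<psi>': "partial_deriv j \<psi> x = (if j = i then - K * x $ i else 0)" for j x
  proof -
    have "partial_deriv j (\<lambda>x. (\<lambda>t. K / 2 * (\<rho>\<^sup>2 - t\<^sup>2)) (x $ i)) x = (- K * x $ i) * partial_deriv j (\<lambda>x. x $ i) x"
      by (rule partial_deriv_compose(1)) (auto intro!: derivative_eq_intros smooth_differentiable)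
    then show ?thesis
      unfolding \<psi>_def[abs_def] by simp
  qed
  have \<psi>_nonneg: "0 \<le> \<psi> x" if "x \<in> S" for x
  proof -
    have "\<bar>x $ i\<bar> \<le> \<rho>"
      using component_le_norm_cart[of x i] \<rho>[OF that] by linarith
    then have "(x $ i)\<^sup>2 \<le> \<rho>\<^sup>2"
      by (metis abs_ge_zero power2_abs power_mono)
    then show ?thesis
      using K(2) by (simp add: \<psi>_def)
  qed
  \<comment> \<open>\<open>flat 0\<close> is a smooth substitute for the positive part: zero for
    nonpositive arguments, positive and increasing otherwise. The subtracted term vanishes on S
    because the barrier is nonnegative there.\<close>
  define \<phi> where "\<phi> x = flat 0 (y x - \<psi> x) - flat 0 (- \<psi> x)" for x
  define \<gamma> where "\<gamma> x = flat 2 (y x - \<psi> x) *\<^sub>R (g x - grad \<psi> x) + flat 2 (- \<psi> x) *\<^sub>R grad \<psi> x" for x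
  have \<phi>\<gamma>: "H10_grad S \<phi> \<gamma>"
    unfolding \<phi>_def[abs_def] \<gamma>_def[abs_def]
    by (rule H10_grad_compose[OF yg s\<psi> flat_0_deriv continuous_on_flat abs_flat_2_le])
  have \<phi>: "\<phi> x = flat 0 (y x - \<psi> x)" and \<gamma>: "\<gamma> x = flat 2 (y x - \<psi> x) *\<^sub>R (g x - grad \<psi> x)" if "x \<in> S" for x
    using \<psi>_nonneg[OF that] by (simp_all add: \<phi>_def \<gamma>_def)
  have g\<psi>: "square_integrable M (\<lambda>x. grad \<psi> x $ j)" for j
    unfolding grad_nth by (rule smooth_square_integrable'[OF smooth_partial_deriv[OF s\<psi>]])
  note i1 = integrable_inner_L2(1)[OF H10_grad_grad_L2[OF yg] H10_grad_grad_L2[OF \<phi>\<gamma>]]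
    integrable_inner_L2(1)[OF g\<psi> H10_grad_grad_L2[OF \<phi>\<gamma>]]
  note \<phi>_sq = H10_grad_L2[OF \<phi>\<gamma>]
  \<comment> \<open>The barrier has Laplacian -K. This enters through integration by parts of
    \<open>\<phi>\<close> against the coordinate function, where \<open>\<phi>\<close> has no
    boundary term.\<close>
  have "(LINT x|M. grad \<psi> x \<bullet> \<gamma> x) = (LINT x|M. - K * (\<gamma> x $ i * x $ i))"
  proof (rule Bochner_Integration.integral_cong[OF refl])
    fix x
    have "grad \<psi> x \<bullet> \<gamma> x = (\<Sum>j\<in>UNIV. if j = i then - K * x $ i * \<gamma> x $ i else 0)"
      unfolding inner_vec_def grad_nth \<psi>' by (intro sum.cong) auto
    then show "grad \<psi> x \<bullet> \<gamma> x = - K * (\<gamma> x $ i * x $ i)"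
      by simp
  qed
  also have "\<dots> = K * (LINT x|M. \<phi> x)"
    using H10_grad_integration_by_parts[OF \<phi>\<gamma> smooth_coord[of i], of i] by simp
  also have "\<dots> = (LINT x|M. K * \<phi> x)"
    by simp
  finally have 1: "(LINT x|M. grad \<psi> x \<bullet> \<gamma> x) = (LINT x|M. K * \<phi> x)" .
  have iK: "integrable M (\<lambda>x. K * \<phi> x)"
    using square_integrable_integrable[OF finite_M \<phi>_sq] by simp
  have iu: "integrable M (\<lambda>x. (u x - w x) * \<phi> x)"
    by (rule integrable_mult_L2[OF square_integrable_diff[OF u w] \<phi>_sq])
  have "0 \<le> (LINT x|M. g x \<bullet> \<gamma> x - grad \<psi> x \<bullet> \<gamma> x)"
  proof (rule integral_nonneg_AE, rule AE_I2)
    fix x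
    assume "x \<in> space M"
    then have "g x \<bullet> \<gamma> x - grad \<psi> x \<bullet> \<gamma> x = flat 2 (y x - \<psi> x) * ((g x - grad \<psi> x) \<bullet> (g x - grad \<psi> x))"
      by (simp only: \<gamma> space_restrict_space Int_iff inner_scaleR_right right_diff_distrib inner_diff_left)
    then show "0 \<le> g x \<bullet> \<gamma> x - grad \<psi> x \<bullet> \<gamma> x"
      by (simp add: flat_nonneg)
  qed
  also have "\<dots> = (LINT x|M. (u x - w x) * \<phi> x) - (LINT x|M. K * \<phi> x)"
    unfolding Bochner_Integration.integral_diff[OF i1] 1 solves_weaklyD[OF sol \<phi>\<gamma>] ..
  also have "\<dots> = - (LINT x|M. K * \<phi> x - (u x - w x) * \<phi> x)"
    unfolding Bochner_Integration.integral_diff[OF iK iu] by simp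
  finally have le: "(LINT x|M. K * \<phi> x - (u x - w x) * \<phi> x) \<le> 0"
    by simp
  \<comment> \<open>The strict inequality between u and K makes the integrand positive wherever y
    exceeds the barrier; as the integral is nonpositive, that set is null.\<close>
  have pos: "0 < K * \<phi> x - (u x - w x) * \<phi> x" if "x \<in> S" "\<psi> x < y x" for x
  proof -
    have "0 \<le> w x"
      using sign[OF that(1)] \<psi>_nonneg[OF that(1)] that(2) by linarith
    then have "0 < K - (u x - w x)"
      using K(1)[OF that(1)] by linarith
    moreover have "0 < \<phi> x"
      unfolding \<phi>[OF that(1)] by (rule flat_pos) (use that in simp)
    ultimately have "0 < (K - (u x - w x)) * \<phi> x"
      by (rule mult_pos_pos)
    then show ?thesis
      by (simp add: left_diff_distrib)
  qed
  have zero: "K * \<phi> x - (u x - w x) * \<phi> x = 0" if "x \<in> S" "\<not> \<psi> x < y x" for x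
    using that by (simp add: \<phi>)
  have nonneg: "AE x in M. 0 \<le> K * \<phi> x - (u x - w x) * \<phi> x"
  proof (rule AE_I2)
    fix x
    assume "x \<in> space M"
    then show "0 \<le> K * \<phi> x - (u x - w x) * \<phi> x"
      using pos[of x] zero[of x] by (cases "\<psi> x < y x") auto
  qed
  have "(LINT x|M. K * \<phi> x - (u x - w x) * \<phi> x) = 0"
    using le integral_nonneg_AE[OF nonneg] by linarith
  then have "AE x in M. K * \<phi> x - (u x - w x) * \<phi> x = 0"
    using integral_nonneg_eq_0_iff_AE[OF Bochner_Integration.integrable_diff[OF iK iu] nonneg] by simp
  moreover have "AE x in M. x \<in> S"
    by (rule AE_I2) simp
  ultimately show ?thesis
  proof eventually_elim
    case (elim x)
    then have "y x \<le> \<psi> x"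
      using pos[of x] by force
    also have "\<psi> x \<le> K / 2 * \<rho>\<^sup>2"
      using K(2) by (simp add: \<psi>_def mult_left_mono)
    finally show ?case .
  qed
qed

text \<open>The one-sided bound is used for y and for -y, whose equation has source -u and
  zero-order term -w.\<close>

lemma weak_solution_bounded:
  assumes yg: "H10_grad S y g" and u: "square_integrable M u" and w: "square_integrable M w"
    and sol: "solves_weakly g (\<lambda>x. u x - w x)"
    and sign: "\<And>x. x \<in> S \<Longrightarrow> 0 \<le> y x \<Longrightarrow> 0 \<le> w x" "\<And>x. x \<in> S \<Longrightarrow> y x \<le> 0 \<Longrightarrow> w x \<le> 0"
    and K: "\<And>x. x \<in> S \<Longrightarrow> \<bar>u x\<bar> < K" "0 \<le> K" and \<rho>: "\<And>x. x \<in> S \<Longrightarrow> norm x \<le> \<rho>"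
  shows "AE x in M. \<bar>y x\<bar> \<le> K / 2 * \<rho>\<^sup>2"
proof -
  have "AE x in M. y x \<le> K / 2 * \<rho>\<^sup>2"
    by (rule weak_solution_upper_bound[OF yg u w sol sign(1) _ K(2) \<rho>]) (use K(1) in \<open>auto simp: abs_less_iff\<close>)
  moreover have "AE x in M. - y x \<le> K / 2 * \<rho>\<^sup>2"
  proof (rule weak_solution_upper_bound[OF H10_grad_uminus[OF yg] square_integrable_uminus[OF u] square_integrable_uminus[OF w] _ _ _ K(2) \<rho>])
    show "solves_weakly (\<lambda>x. - g x) (\<lambda>x. - u x - - w x)"
      using solves_weakly_uminus[OF sol] by (simp add: algebra_simps)
    show "0 \<le> - w x" if "x \<in> S" "0 \<le> - y x" for x
      using sign(2)[OF that(1)] that(2) by simp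
    show "- u x < K" if "x \<in> S" for x
      using K(1)[OF that] by (simp add: abs_less_iff)
  qed
  ultimately show ?thesis
    by eventually_elim (simp add: abs_le_iff)
qed

text \<open>The comparison bound depends on K and the size of S but not on the Lipschitz constant of
  the nonlinearity. The level B can therefore be fixed before f is truncated, and almost everywhere
  the solution of the truncated problem stays in the range where f is unchanged.\<close>

lemma bounded_solution_exists:
  fixes f :: "real \<Rightarrow> real"
  assumes C1: "f C1_differentiable_on UNIV" and mono: "mono f" and f0: "f 0 = 0"
    and u: "u \<in> borel_measurable M" "\<And>x. \<bar>u x\<bar> < K"
  obtains y g B where "0 < B" "H10_grad S y g" "AE x in M. \<bar>y x\<bar> \<le> B" "square_integrable M (\<lambda>x. f (y x))"
    "solves_weakly g (\<lambda>x. u x - f (y x))"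
proof -
  have K: "0 < K"
    using u(2)[of undefined] by linarith
  have u_sq: "square_integrable M u"
    by (rule square_integrable_bounded[OF finite_M u(1), of K]) (use u(2) in \<open>auto intro!: AE_I2 less_imp_le\<close>)
  obtain \<rho> where \<rho>: "\<rho> > 0" "\<And>x. x \<in> S \<Longrightarrow> norm x \<le> \<rho>"
    using bounded_S by (auto simp: bounded_pos)
  define B where "B = K / 2 * \<rho>\<^sup>2"
  have B: "0 < B"
    using K \<rho>(1) by (simp add: B_def)
  obtain h h' L where h: "\<And>t. (h has_real_derivative h' t) (at t)" "continuous_on UNIV h'"
    "\<And>t. 0 \<le> h' t" "\<And>t. \<bar>h' t\<bar> \<le> L" "h 0 = 0" "\<And>t. \<bar>t\<bar> \<le> B \<Longrightarrow> h t = f t"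
    by (rule C1_truncation[OF C1 mono f0 B]) (rule that)
  have h_mono: "h s \<le> h t" if "s \<le> t" for s t
    by (rule DERIV_nonneg_imp_nondecreasing[OF that]) (use h in blast)
  have lip: "\<bar>h s - h t\<bar> \<le> L * \<bar>s - t\<bar>" for s t
    by (rule lipschitz_from_bounded_deriv[OF h(1,4)])
  obtain y g where yg: "H10_grad S y g" "square_integrable M (\<lambda>x. h (y x))" "solves_weakly g (\<lambda>x. u x - h (y x))"
    by (rule weak_solution_exists[OF h_mono lip h(5) u_sq], assumption, rule that)
  have y_bd: "AE x in M. \<bar>y x\<bar> \<le> B"
    unfolding B_def
  proof (rule weak_solution_bounded[OF yg(1) u_sq yg(2,3) _ _ u(2) _ \<rho>(2)])
    show "0 \<le> h (y x)" if "0 \<le> y x" for x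
      using h_mono[OF that] h(5) by simp
    show "h (y x) \<le> 0" if "y x \<le> 0" for x
      using h_mono[OF that] h(5) by simp
  qed (use K in simp_all)
  then have eq: "AE x in M. h (y x) = f (y x)"
    by eventually_elim (rule h(6))
  note [measurable] = borel_measurable_continuous_onI[OF C1_differentiable_imp_continuous_on[OF C1]] square_integrable_measurable[OF H10_grad_L2[OF yg(1)]]
    u(1) square_integrable_measurable[OF yg(2)]
  have fy: "square_integrable M (\<lambda>x. f (y x))"
    by (rule square_integrable_cong_AE[OF yg(2) eq]) measurable
  have "solves_weakly g (\<lambda>x. u x - f (y x))"
    unfolding solves_weakly_def
  proof (intro allI impI)
    fix \<phi> \<gamma>
    assume \<phi>\<gamma>: "H10_grad S \<phi> \<gamma>"
    note [measurable] = square_integrable_measurable[OF H10_grad_L2[OF \<phi>\<gamma>]]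
    have "(LINT x|M. g x \<bullet> \<gamma> x) = (LINT x|M. (u x - h (y x)) * \<phi> x)"
      by (rule solves_weaklyD[OF yg(3) \<phi>\<gamma>])
    also have "\<dots> = (LINT x|M. (u x - f (y x)) * \<phi> x)"
      by (rule integral_cong_AE) (measurable, use eq in auto)
    finally show "(LINT x|M. g x \<bullet> \<gamma> x) = (LINT x|M. (u x - f (y x)) * \<phi> x)" .
  qed
  then show ?thesis
    by (rule that[OF B yg(1) y_bd fy])
qed

lemma AE_not_sphere: "AE x in M. x \<notin> sphere a r"
proof -
  have "AE x in lebesgue. x \<notin> sphere a r"
    using negligible_sphere[of a r] by (intro AE_not_in) (simp add: negligible_iff_null_sets)
  then have "AE x in lebesgue. x \<in> S \<longrightarrow> x \<notin> sphere a r"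
    by eventually_elim simp
  then show ?thesis
    using S_lebesgue by (simp add: AE_restrict_space_iff)
qed

lemma open_not_AE_disjoint:
  assumes "open U" "U \<noteq> {}" "U \<subseteq> S"
  shows "\<not> (AE x in M. x \<notin> U)"
proof
  assume "AE x in M. x \<notin> U"
  then have "AE x in M. x \<in> U \<longrightarrow> False"
    by simp
  then have "AE x in lebesgue_on U. False"
    using assms by (subst AE_subset_lebesgue_on) auto
  then have "AE x in lebesgue. x \<in> U \<longrightarrow> False"
    using assms(1) by (subst (asm) AE_restrict_space_iff) auto
  then have "U \<in> null_sets lebesgue"
    using assms(1) by (simp add: AE_iff_null_sets)
  then show False
    using open_not_negligible[OF assms(1,2)] by (simp add: negligible_iff_null_sets)
qed

text \<open>The bound on y makes f(y) admissible in the equation: a truncation that agrees with f on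
  [-B, B] has the bounded derivative that the chain rule asks for. The gap between r and r' leaves
  room for the cutoff.\<close>

lemma constant_control_state_nonzero:
  fixes f :: "real \<Rightarrow> real"
  assumes C1: "f C1_differentiable_on UNIV" and f: "strict_mono f" and f0: "f 0 = 0"
    and r: "0 < r" "r < r'" "cball 0 r' \<subseteq> S"
    and yg: "H10_grad S y g" and y_bd: "AE x in M. \<bar>y x\<bar> \<le> B" "0 < B"
    and fy: "square_integrable M (\<lambda>x. f (y x))"
    and sol: "solves_weakly g (\<lambda>x. indicator (ball 0 r) x - f (y x))"
  shows "\<not> (AE x in M. x \<notin> ball 0 r \<longrightarrow> y x = 0)"
proof
  assume y0: "AE x in M. x \<notin> ball 0 r \<longrightarrow> y x = 0"
  let ?T = "ball 0 r :: (real^'n) set"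
  have T: "?T \<subseteq> S" "?T \<noteq> {}"
    using r by auto
  have T_not_null: "\<not> (AE x in M. x \<notin> ?T)"
    by (rule open_not_AE_disjoint) (use T in auto)
  have [measurable]: "?T \<in> sets M"
    using T S_lebesgue by (simp add: sets_restrict_space_iff)
  have ind_sq: "square_integrable M (indicator ?T)"
    by (rule square_integrable_bounded[OF finite_M, of _ 1], rule borel_measurable_indicator) (auto simp: indicator_def)
  note [measurable] = square_integrable_measurable[OF H10_grad_L2[OF yg]] square_integrable_measurable[OF fy]
  \<comment> \<open>The gradient is known to vanish on open sets where y is constant; the sphere of
    radius r is left out here and added back as a null set.\<close>
  have "AE x in M. x \<in> S - cball 0 r \<longrightarrow> g x = 0"
  proof (rule H10_grad_eq_0_on_constant[OF yg])
    show "open (S - cball 0 r)"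
      by (intro open_Diff open_S closed_cball)
    show "AE x in M. x \<in> S - cball 0 r \<longrightarrow> y x = 0"
      using y0 by eventually_elim auto
  qed auto
  moreover have "AE x in M. x \<in> S"
    by (rule AE_I2) simp
  moreover have "AE x in M. x \<notin> sphere 0 r"
    by (rule AE_not_sphere)
  ultimately have g0: "AE x in M. x \<notin> ?T \<longrightarrow> g x = 0"
    by eventually_elim (auto simp: dist_norm)

  obtain h h' L where h: "\<And>t. (h has_real_derivative h' t) (at t)" "continuous_on UNIV h'"
    "\<And>t. 0 \<le> h' t" "\<And>t. \<bar>h' t\<bar> \<le> L" "h 0 = 0" "\<And>t. \<bar>t\<bar> \<le> B \<Longrightarrow> h t = f t"
    by (rule C1_truncation[OF C1 strict_mono_mono[OF f] f0 y_bd(2)]) (rule that)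
  have hy: "H10_grad S (\<lambda>x. h (y x)) (\<lambda>x. h' (y x) *\<^sub>R g x)"
    by (rule H10_grad_compose_0[OF yg h(1,2,4,5)])
  have "0 \<le> (LINT x|M. g x \<bullet> (h' (y x) *\<^sub>R g x))"
    by (rule Bochner_Integration.integral_nonneg) (simp add: h(3))
  also have "\<dots> = (LINT x|M. (indicator ?T x - f (y x)) * h (y x))"
    by (rule solves_weaklyD[OF sol hy])
  also have "\<dots> = (LINT x|M. (indicator ?T x - f (y x)) * f (y x))"
  proof (rule integral_cong_AE)
    note [measurable] = square_integrable_measurable[OF H10_grad_L2[OF hy]]
    show "(\<lambda>x. (indicator ?T x - f (y x)) * h (y x)) \<in> borel_measurable M"
      "(\<lambda>x. (indicator ?T x - f (y x)) * f (y x)) \<in> borel_measurable M"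
      by measurable
    show "AE x in M. (indicator ?T x - f (y x)) * h (y x) = (indicator ?T x - f (y x)) * f (y x)"
      using y_bd(1) by eventually_elim (simp add: h(6))
  qed
  finally have 1: "0 \<le> (LINT x|M. (indicator ?T x - f (y x)) * f (y x))" .

  \<comment> \<open>\<open>m\<close> bounds \<open>bump 0 r'\<close> from below on the inner ball. A
    profile \<open>p\<close> with p(0) = 0 and p(t) = 1 for t \<ge> m thus turns the bump into a
    cutoff that is 1 there; \<open>c\<close> normalizes \<open>p\<close> at 0.\<close>
  define m where "m = flat 0 (r'\<^sup>2 - r\<^sup>2)"
  have m: "0 < m"
    unfolding m_def using r by (intro flat_pos) (simp add: power_strict_mono)
  define c where "c = flat 0 1"
  have c: "0 < c"
    unfolding c_def by (rule flat_pos) simp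
  define p where "p t = 1 - flat 0 (1 - t / m) / c" for t
  define p' where "p' t = flat 2 (1 - t / m) / (m * c)" for t
  have p_deriv: "(p has_real_derivative p' t) (at t)" for t
  proof -
    have "((\<lambda>t. 1 - t / m) has_real_derivative - (1 / m)) (at t)"
      using m by (auto intro!: derivative_eq_intros)
    from DERIV_chain2[OF flat_0_deriv this]
    have "((\<lambda>t. flat 0 (1 - t / m)) has_real_derivative flat 2 (1 - t / m) * - (1 / m)) (at t)" .
    from DERIV_diff[OF DERIV_const[of 1] DERIV_cdivide[OF this, of c]]
    have "(p has_real_derivative 0 - flat 2 (1 - t / m) * - (1 / m) / c) (at t)"
      unfolding p_def .
    then show ?thesis
      by (simp add: p'_def)
  qed
  have p'_cont: "continuous_on UNIV p'"
    unfolding p'_def using m c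
    by (intro continuous_on_divide continuous_on_const continuous_on_compose2[OF continuous_on_flat[of UNIV 2]]
        continuous_on_diff continuous_on_id) auto
  have p'_bound: "\<bar>p' t\<bar> \<le> 2 / (m * c)" for t
    unfolding p'_def abs_divide using m c abs_flat_2_le[of "1 - t / m"] by (simp add: divide_right_mono)
  have p0: "p 0 = 0"
    using c by (simp add: p_def c_def)
  have p_top: "p t = 1" "p' t = 0" if "m \<le> t" for t
  proof -
    have "1 - t / m \<le> 0"
      using that m by simp
    then show "p t = 1" "p' t = 0"
      by (simp_all add: p_def p'_def)
  qed
  have \<eta>: "bump 0 r' \<in> test_functions S"
    by (rule bump_test) (use r in auto)
  have \<eta>_ge: "m \<le> bump 0 r' x" if "x \<in> ?T" for x
  proof -
    have "(norm x)\<^sup>2 < r\<^sup>2"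
      using that by (intro power_strict_mono) auto
    moreover have "flat 0 s \<le> flat 0 t" if "s \<le> t" for s t
      using that by (rule DERIV_nonneg_imp_nondecreasing) (use flat_0_deriv flat_nonneg in blast)
    ultimately show ?thesis
      by (simp add: m_def bump_def)
  qed
  have \<chi>: "H10_grad S (\<lambda>x. p (bump 0 r' x)) (\<lambda>x. p' (bump 0 r' x) *\<^sub>R grad (bump 0 r') x)"
    by (rule H10_grad_compose_0[OF H10_grad_test[OF \<eta>] p_deriv p'_cont p'_bound p0])
  \<comment> \<open>The two gradients live on complementary sets: that of the cutoff vanishes on the
    inner ball, and g vanishes outside it almost everywhere.\<close>
  have "(LINT x|M. g x \<bullet> (p' (bump 0 r' x) *\<^sub>R grad (bump 0 r') x)) = (LINT x|M. 0)"
  proof (rule integral_cong_AE)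
    note [measurable] = H10_grad_measurable[OF yg] H10_grad_measurable[OF \<chi>]
    show "(\<lambda>x. g x \<bullet> (p' (bump 0 r' x) *\<^sub>R grad (bump 0 r') x)) \<in> borel_measurable M"
      by measurable
    show "AE x in M. g x \<bullet> (p' (bump 0 r' x) *\<^sub>R grad (bump 0 r') x) = 0"
      using g0
    proof eventually_elim
      case (elim x)
      then show ?case
        using p_top(2)[OF \<eta>_ge[of x]] by (cases "x \<in> ?T") auto
    qed
  qed simp
  then have "0 = (LINT x|M. (indicator ?T x - f (y x)) * p (bump 0 r' x))"
    using solves_weaklyD[OF sol \<chi>] by simp
  also have "\<dots> = (LINT x|M. indicator ?T x - f (y x))"
  proof (rule integral_cong_AE)
    note [measurable] = square_integrable_measurable[OF H10_grad_L2[OF \<chi>]]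
    show "(\<lambda>x. (indicator ?T x - f (y x)) * p (bump 0 r' x)) \<in> borel_measurable M"
      "(\<lambda>x. indicator ?T x - f (y x)) \<in> borel_measurable M"
      by measurable
    show "AE x in M. (indicator ?T x - f (y x)) * p (bump 0 r' x) = indicator ?T x - f (y x)"
      using y0
    proof eventually_elim
      case (elim x)
      then show ?case
        using p_top(1)[OF \<eta>_ge[of x]] f0 by (cases "x \<in> ?T") auto
    qed
  qed
  finally have 2: "(LINT x|M. indicator ?T x - f (y x)) = 0"
    by simp

  note d_sq = square_integrable_diff[OF ind_sq fy]
  \<comment> \<open>On the inner ball (1 - F)^2 = (1 - F) - (1 - F) F with F = f(y), and outside
    both sides are 0. The first integral on the right vanishes by the cutoff, the second is
    nonnegative by the test with f(y).\<close>
  have "(LINT x|M. (indicator ?T x - f (y x))\<^sup>2) =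
      (LINT x|M. (indicator ?T x - f (y x)) - (indicator ?T x - f (y x)) * f (y x))"
  proof (rule integral_cong_AE)
    show "AE x in M. (indicator ?T x - f (y x))\<^sup>2 = (indicator ?T x - f (y x)) - (indicator ?T x - f (y x)) * f (y x)"
      using y0
    proof eventually_elim
      case (elim x)
      then show ?case
        using f0 by (cases "x \<in> ?T") (auto simp: power2_eq_square algebra_simps)
    qed
  qed measurable
  also have "\<dots> = (LINT x|M. indicator ?T x - f (y x)) - (LINT x|M. (indicator ?T x - f (y x)) * f (y x))"
    by (rule Bochner_Integration.integral_diff[OF square_integrable_integrable[OF finite_M d_sq] integrable_mult_L2[OF d_sq fy]])
  finally have "(LINT x|M. (indicator ?T x - f (y x))\<^sup>2) \<le> 0"
    using 1 2 by simp
  then have "(LINT x|M. (indicator ?T x - f (y x))\<^sup>2) = 0"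
    by (intro antisym Bochner_Integration.integral_nonneg) auto
  then have "AE x in M. (indicator ?T x - f (y x))\<^sup>2 = 0"
    using integral_nonneg_eq_0_iff_AE[OF square_integrable_power2[OF d_sq]] by simp
  then have f1: "AE x in M. x \<in> ?T \<longrightarrow> f (y x) = 1"
    by eventually_elim auto

  \<comment> \<open>The inner ball is not null, so 1 is a value of f; strict monotonicity then makes
    y constant on the ball.\<close>
  have "\<exists>x. x \<in> ?T \<and> f (y x) = 1"
  proof (rule ccontr)
    assume "\<not> (\<exists>x. x \<in> ?T \<and> f (y x) = 1)"
    with f1 have "AE x in M. x \<notin> ?T"
      by (auto elim: eventually_mono)
    with T_not_null show False
      by blast
  qed
  then obtain a where a: "f a = 1"
    by blast
  have y_a: "AE x in M. x \<in> ?T \<longrightarrow> y x = a"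
    using f1 by eventually_elim (use a strict_mono_eq[OF f] in metis)
  have "AE x in M. x \<in> ?T \<longrightarrow> g x = 0"
    by (rule H10_grad_eq_0_on_constant[OF yg _ T(1) y_a]) simp
  with g0 have g00: "AE x in M. g x = 0"
    by eventually_elim blast
  define i where "i = (undefined :: 'n)"
  \<comment> \<open>A coordinate function as multiplier: zero boundary values and a vanishing
    gradient force the integral of y to be 0.\<close>
  have "(LINT x|M. y x * partial_deriv i (\<lambda>x. x $ i) x) = - (LINT x|M. g x $ i * x $ i)"
    by (rule H10_grad_integration_by_parts[OF yg smooth_coord])
  also have "(LINT x|M. g x $ i * x $ i) = (LINT x|M. 0)"
  proof (rule integral_cong_AE)
    note [measurable] = square_integrable_measurable[OF H10_grad_grad_L2[OF yg, of i]] smooth_measurable[OF smooth_coord[of i], of S]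
    show "(\<lambda>x. g x $ i * x $ i) \<in> borel_measurable M"
      by measurable
    show "AE x in M. g x $ i * x $ i = 0"
      using g00 by eventually_elim simp
  qed simp
  finally have "(LINT x|M. y x) = 0"
    by simp
  moreover have "(LINT x|M. y x) = (LINT x|M. a * indicator ?T x)"
  proof (rule integral_cong_AE)
    show "AE x in M. y x = a * indicator ?T x"
      using y0 y_a
    proof eventually_elim
      case (elim x)
      then show ?case
        by (cases "x \<in> ?T") auto
    qed
  qed measurable
  moreover have "a \<noteq> 0"
    using a f0 by auto
  ultimately have "(LINT x|M. indicator ?T x :: real) = 0"
    by simp
  then have "AE x in M. (indicator ?T x :: real) = 0"
    using integral_nonneg_eq_0_iff_AE[OF square_integrable_integrable[OF finite_M ind_sq]] by simp
  then have "AE x in M. x \<notin> ?T"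
    by eventually_elim (simp add: indicator_eq_0_iff)
  with T_not_null show False
    by blast
qed

end

section \<open>The control problem\<close>

lemma square_integrable_L2_subset:
  fixes y :: "real^'n \<Rightarrow> real"
  assumes "bounded_open S" "square_integrable (lebesgue_on S) y" "A \<subseteq> S" "A \<in> sets lebesgue"
  shows "square_integrable (lebesgue_on A) y"
proof -
  interpret bounded_open S by fact
  have "integrable M (\<lambda>x. indicator A x * (y x)\<^sup>2)"
  proof (rule Bochner_Integration.integrable_bound[OF square_integrable_power2[OF assms(2)]])
    have [measurable]: "A \<in> sets M"
      using assms(3,4) S_lebesgue by (simp add: sets_restrict_space_iff)
    note [measurable] = square_integrable_measurable[OF assms(2)]
    show "(\<lambda>x. indicator A x * (y x)\<^sup>2) \<in> borel_measurable M"
      by measurable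
    show "AE x in M. norm (indicator A x * (y x)\<^sup>2) \<le> norm ((y x)\<^sup>2)"
      by (intro AE_I2) (auto simp: indicator_def)
  qed
  then have "integrable (lebesgue_on A) (\<lambda>x. (y x)\<^sup>2)"
    using integrable_subset_lebesgue_on[OF assms(3,4)] by simp
  moreover have "y \<in> borel_measurable (lebesgue_on A)"
  proof -
    have "y \<in> borel_measurable (restrict_space (lebesgue_on S) A)"
      by (rule measurable_restrict_space1[OF square_integrable_measurable[OF assms(2)]])
    moreover have "restrict_space (lebesgue_on S) A = lebesgue_on A"
      using assms(3,4) S_lebesgue by (subst restrict_restrict_space) (auto simp: Int_absorb1)
    ultimately show ?thesis
      by simp
  qed
  ultimately show ?thesis
    by (simp add: square_integrable_def)
qed

lemma integral_power2_diff:
  assumes "square_integrable M a" "square_integrable M b"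
  shows "(\<integral>x. (a x - b x)\<^sup>2 \<partial>M) = (\<integral>x. (a x)\<^sup>2 \<partial>M) - 2 * (\<integral>x. a x * b x \<partial>M) + (\<integral>x. (b x)\<^sup>2 \<partial>M)"
proof -
  note int = square_integrable_power2[OF assms(1)] square_integrable_power2[OF assms(2)] integrable_mult_L2[OF assms]
  have "(\<integral>x. (a x - b x)\<^sup>2 \<partial>M) = (\<integral>x. (a x)\<^sup>2 - 2 * (a x * b x) + (b x)\<^sup>2 \<partial>M)"
    by (intro Bochner_Integration.integral_cong refl) (simp add: power2_diff)
  then show ?thesis
    using int by simp
qed

lemma integral_power2_convex:
  assumes "square_integrable M a" "square_integrable M b" "0 \<le> t" "t \<le> 1"
  shows "(\<integral>x. ((1 - t) * a x + t * b x)\<^sup>2 \<partial>M) \<le> (1 - t) * (\<integral>x. (a x)\<^sup>2 \<partial>M) + t * (\<integral>x. (b x)\<^sup>2 \<partial>M)"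
proof -
  note int = square_integrable_power2[OF assms(1)] square_integrable_power2[OF assms(2)]
  have "(\<integral>x. ((1 - t) * a x + t * b x)\<^sup>2 \<partial>M) \<le> (\<integral>x. (1 - t) * (a x)\<^sup>2 + t * (b x)\<^sup>2 \<partial>M)"
  proof (rule integral_mono)
    show "integrable M (\<lambda>x. ((1 - t) * a x + t * b x)\<^sup>2)"
      by (intro square_integrable_power2 square_integrable_add square_integrable_cmult assms)
    show "integrable M (\<lambda>x. (1 - t) * (a x)\<^sup>2 + t * (b x)\<^sup>2)"
      using int by simp
    fix x
    have "(1 - t) * (a x)\<^sup>2 + t * (b x)\<^sup>2 - ((1 - t) * a x + t * b x)\<^sup>2 = t * (1 - t) * (a x - b x)\<^sup>2"
      by (simp add: power2_eq_square algebra_simps)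
    moreover have "0 \<le> t * (1 - t) * (a x - b x)\<^sup>2"
      using assms(3,4) by simp
    ultimately show "((1 - t) * a x + t * b x)\<^sup>2 \<le> (1 - t) * (a x)\<^sup>2 + t * (b x)\<^sup>2"
      by linarith
  qed
  then show ?thesis
    using int by simp
qed

text \<open>The \<open>itself\<close> parameter fixes the type that carries the dimension, which
  none of the other parameters mentions.\<close>

locale control_problem =
  fixes f :: "real \<Rightarrow> real" and r R \<beta> :: real and dimension :: "'n::finite itself"
  assumes radii: "0 < r" "r < R" and beta: "0 < \<beta>"
    and C1: "f C1_differentiable_on UNIV" and f_mono: "strict_mono f" and f0: "f 0 = 0"

sublocale control_problem \<subseteq> bounded_open "ball 0 R :: (real^'n) set"
  by unfold_locales auto

context control_problem
begin

abbreviation "T \<equiv> ball 0 r :: (real^'n) set"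
abbreviation "S \<equiv> ball 0 R :: (real^'n) set"
abbreviation "A \<equiv> S - T"

lemma T_subset: "T \<subseteq> S" and T_lebesgue: "T \<in> sets lebesgue" and A_subset: "A \<subseteq> S" and A_lebesgue: "A \<in> sets lebesgue"
  using radii by auto

lemma bounded_open_S: "bounded_open S"
  by unfold_locales

lemma T_sets [measurable]: "T \<in> sets M"
  using T_subset S_lebesgue by (simp add: sets_restrict_space_iff)

section \<open>Weak solutions with explicit gradients as representatives of the state\<close>

lemma extend_control:
  assumes "u \<in> L2 T"
  shows "square_integrable M (\<lambda>x. indicator T x * u x)"
  unfolding square_integrable_def
proof
  have "u \<in> borel_measurable (lebesgue_on T)" "integrable (lebesgue_on T) (\<lambda>x. (u x)\<^sup>2)"
    using assms by (auto simp: L2_def)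
  then have "(\<lambda>x. indicator T x *\<^sub>R u x) \<in> borel_measurable lebesgue"
    using T_lebesgue by (subst (asm) borel_measurable_restrict_space_iff) auto
  then show "(\<lambda>x. indicator T x * u x) \<in> borel_measurable M"
    by (simp add: measurable_restrict_space1)
  have "integrable M (\<lambda>x. indicator T x * (u x)\<^sup>2)"
    using \<open>integrable (lebesgue_on T) (\<lambda>x. (u x)\<^sup>2)\<close> integrable_subset_lebesgue_on[OF T_subset T_lebesgue] by simp
  moreover have "indicator T x * (u x)\<^sup>2 = (indicator T x * u x)\<^sup>2" for x
    by (simp add: indicator_def)
  ultimately show "integrable M (\<lambda>x. (indicator T x * u x)\<^sup>2)"
    by simp
qed

text \<open>The definition integrates the control over the inner ball and uses chosen gradients;
  these are exchanged for the control extended by zero and for g. Square integrability of f(y) makes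
  every product integrable, so the integral of the sum splits.\<close>

lemma is_state_solutionI:
  assumes u: "u \<in> L2 T" and yg: "H10_grad S y g" and fy: "square_integrable M (\<lambda>x. f (y x))"
    and sol: "solves_weakly g (\<lambda>x. indicator T x * u x - f (y x))"
  shows "is_state_solution f r R u y"
  unfolding is_state_solution_def
proof (intro conjI ballI)
  show "y \<in> H10 S"
    by (rule H10_grad_imp_H10(1)[OF yg])
  show "integrable M (\<lambda>x. f (y x))"
    by (rule square_integrable_integrable[OF finite_M fy])
  fix \<phi>
  assume "\<phi> \<in> H10 S \<inter> Linfty S"
  then have \<phi>: "H10_grad S \<phi> (weak_gradient S \<phi>)"
    by (intro H10_imp_H10_grad) simp
  let ?\<gamma> = "weak_gradient S \<phi>"
  note \<phi>_sq = H10_grad_L2[OF \<phi>]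
  have wy: "H10_grad S y (weak_gradient S y)"
    by (rule H10_imp_H10_grad[OF H10_grad_imp_H10(1)[OF yg]])
  note i1 = integrable_inner_L2(1)[OF H10_grad_grad_L2[OF wy] H10_grad_grad_L2[OF \<phi>]]
  note i2 = integrable_mult_L2[OF fy \<phi>_sq]
  note i3 = integrable_mult_L2[OF extend_control[OF u] \<phi>_sq]
  have "(LINT x|M. weak_gradient S y x \<bullet> ?\<gamma> x + f (y x) * \<phi> x)
    = (LINT x|M. weak_gradient S y x \<bullet> ?\<gamma> x) + (LINT x|M. f (y x) * \<phi> x)"
    by (rule Bochner_Integration.integral_add[OF i1 i2])
  also have "(LINT x|M. weak_gradient S y x \<bullet> ?\<gamma> x) = (LINT x|M. g x \<bullet> ?\<gamma> x)"
  proof (rule integral_cong_AE)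
    note [measurable] = H10_grad_measurable[OF wy] H10_grad_measurable[OF \<phi>] H10_grad_measurable[OF yg]
    show "(\<lambda>x. weak_gradient S y x \<bullet> ?\<gamma> x) \<in> borel_measurable M" "(\<lambda>x. g x \<bullet> ?\<gamma> x) \<in> borel_measurable M"
      by measurable
    show "AE x in M. weak_gradient S y x \<bullet> ?\<gamma> x = g x \<bullet> ?\<gamma> x"
      using H10_grad_imp_H10(2)[OF yg] by eventually_elim simp
  qed
  also have "\<dots> = (LINT x|M. indicator T x * u x * \<phi> x) - (LINT x|M. f (y x) * \<phi> x)"
    unfolding solves_weaklyD[OF sol \<phi>] left_diff_distrib by (rule Bochner_Integration.integral_diff[OF i3 i2])
  also have "(LINT x|M. indicator T x * u x * \<phi> x) = (LINT x|lebesgue_on T. u x * \<phi> x)"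
    unfolding integral_subset_lebesgue_on[OF T_subset T_lebesgue] by (simp add: mult.assoc)
  finally show "(LINT x|M. weak_gradient S y x \<bullet> ?\<gamma> x + f (y x) * \<phi> x) = (LINT x|lebesgue_on T. u x * \<phi> x)"
    by simp
qed

text \<open>For an arbitrary solution f(y) is only known to be integrable, hence the restriction to
  bounded \<open>\<phi>\<close>. The separated integrals and the free choice of the gradient of
  \<open>\<phi>\<close> are what the uniqueness argument works with.\<close>

lemma is_state_solutionD:
  assumes sol: "is_state_solution f r R u y" and \<phi>: "H10_grad S \<phi> \<gamma>" and bd: "\<And>x. \<bar>\<phi> x\<bar> \<le> C"
  shows "(LINT x|M. weak_gradient S y x \<bullet> \<gamma> x) + (LINT x|M. f (y x) * \<phi> x) = (LINT x|lebesgue_on T. u x * \<phi> x)"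
proof -
  have y: "y \<in> H10 S" "integrable M (\<lambda>x. f (y x))"
    using sol by (auto simp: is_state_solution_def)
  have \<phi>_meas: "\<phi> \<in> borel_measurable M"
    by (rule square_integrable_measurable[OF H10_grad_L2[OF \<phi>]])
  have "\<phi> \<in> H10 S" "\<phi> \<in> Linfty S"
    using H10_grad_imp_H10(1)[OF \<phi>] bd \<phi>_meas by (auto simp: Linfty_def)
  then have eq: "(LINT x|M. weak_gradient S y x \<bullet> weak_gradient S \<phi> x + f (y x) * \<phi> x) = (LINT x|lebesgue_on T. u x * \<phi> x)"
    using sol by (auto simp: is_state_solution_def)
  note wy = H10_imp_H10_grad[OF y(1)] and w\<phi> = H10_imp_H10_grad[OF \<open>\<phi> \<in> H10 S\<close>]
  note i1 = integrable_inner_L2(1)[OF H10_grad_grad_L2[OF wy] H10_grad_grad_L2[OF w\<phi>]]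
  note i2 = integrable_mult_bounded[OF y(2) \<phi>_meas bd]
  have "(LINT x|M. weak_gradient S y x \<bullet> \<gamma> x) = (LINT x|M. weak_gradient S y x \<bullet> weak_gradient S \<phi> x)"
  proof (rule integral_cong_AE)
    note [measurable] = H10_grad_measurable[OF wy] H10_grad_measurable[OF \<phi>] H10_grad_measurable[OF w\<phi>]
    show "(\<lambda>x. weak_gradient S y x \<bullet> \<gamma> x) \<in> borel_measurable M"
      "(\<lambda>x. weak_gradient S y x \<bullet> weak_gradient S \<phi> x) \<in> borel_measurable M"
      by measurable
    show "AE x in M. weak_gradient S y x \<bullet> \<gamma> x = weak_gradient S y x \<bullet> weak_gradient S \<phi> x"
      using H10_grad_imp_H10(2)[OF \<phi>] by eventually_elim simp
  qed
  then show ?thesis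
    using eq Bochner_Integration.integral_add[OF i1 i2] by simp
qed

lemma is_state_solution_unique:
  assumes y: "is_state_solution f r R u y" and z: "is_state_solution f r R u z"
  shows "AE x in M. y x = z x"
proof (rule weak_solution_unique[OF f_mono])
  show "H10_grad S y (weak_gradient S y)" "H10_grad S z (weak_gradient S z)"
    "integrable M (\<lambda>x. f (y x))" "integrable M (\<lambda>x. f (z x))"
    using y z by (auto simp: is_state_solution_def intro: H10_imp_H10_grad)
qed (rule is_state_solutionD[OF y], assumption+, rule is_state_solutionD[OF z], assumption+)

text \<open>Exhibiting one solution makes the choice in \<open>state\<close> a solution as well, and
  uniqueness ties the two together.\<close>

lemma state_eq_AE:
  assumes "is_state_solution f r R u y"
  shows "AE x in M. state f r R u x = y x" "square_integrable M (state f r R u)"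
proof -
  have st: "is_state_solution f r R u (state f r R u)"
    unfolding state_def using assms by (rule someI[of "is_state_solution f r R u"])
  show "AE x in M. state f r R u x = y x"
    by (rule is_state_solution_unique[OF st assms])
  have "state f r R u \<in> H10 S"
    using st by (simp add: is_state_solution_def)
  then show "square_integrable M (state f r R u)"
    by (rule H10_grad_L2[OF H10_imp_H10_grad])
qed

lemma cost_eq: "cost f r R \<beta> z u = 1/2 * (LINT x|lebesgue_on T. (u x)\<^sup>2) + \<beta>/2 * (LINT x|lebesgue_on A. (state f r R u x - z x)\<^sup>2)"
  for u :: "real^'n \<Rightarrow> real"
  by (simp add: cost_def)

lemma solves_weakly_combination:
  assumes g: "\<And>i. square_integrable M (\<lambda>x. g1 x $ i)" "\<And>i. square_integrable M (\<lambda>x. g2 x $ i)"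
    and w: "square_integrable M w1" "square_integrable M w2"
    and sol: "solves_weakly g1 w1" "solves_weakly g2 w2"
  shows "solves_weakly (\<lambda>x. a *\<^sub>R g1 x + b *\<^sub>R g2 x) (\<lambda>x. a * w1 x + b * w2 x)"
  unfolding solves_weakly_def
proof (intro allI impI)
  fix \<phi> \<gamma>
  assume \<phi>: "H10_grad S \<phi> \<gamma>"
  note i1 = integrable_inner_L2(1)[OF g(1) H10_grad_grad_L2[OF \<phi>]] integrable_inner_L2(1)[OF g(2) H10_grad_grad_L2[OF \<phi>]]
  note i2 = integrable_mult_L2[OF w(1) H10_grad_L2[OF \<phi>]] integrable_mult_L2[OF w(2) H10_grad_L2[OF \<phi>]]
  have "(LINT x|M. (a *\<^sub>R g1 x + b *\<^sub>R g2 x) \<bullet> \<gamma> x) = a * (LINT x|M. g1 x \<bullet> \<gamma> x) + b * (LINT x|M. g2 x \<bullet> \<gamma> x)"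
    using i1 by (simp add: inner_add_left)
  also have "\<dots> = a * (LINT x|M. w1 x * \<phi> x) + b * (LINT x|M. w2 x * \<phi> x)"
    by (simp add: solves_weaklyD[OF sol(1) \<phi>] solves_weaklyD[OF sol(2) \<phi>])
  also have "\<dots> = (LINT x|M. a * (w1 x * \<phi> x) + b * (w2 x * \<phi> x))"
    using i2 by simp
  also have "\<dots> = (LINT x|M. (a * w1 x + b * w2 x) * \<phi> x)"
    by (simp add: algebra_simps)
  finally show "(LINT x|M. (a *\<^sub>R g1 x + b *\<^sub>R g2 x) \<bullet> \<gamma> x) = (LINT x|M. (a * w1 x + b * w2 x) * \<phi> x)" .
qed

lemma L2_combination:
  assumes "u \<in> L2 B" "v \<in> L2 B"
  shows "(\<lambda>x. a * u x + b * v x) \<in> L2 B"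
  using assms unfolding L2_iff_square_integrable by (intro square_integrable_add square_integrable_cmult)

text \<open>For f(x) = c x the combination of two states solves the equation of the combined
  control, so the state is affine in the control up to null sets, and squares of affine expressions
  are convex. Since f is Lipschitz with constant c, states exist for all square integrable
  controls.\<close>

lemma linear_imp_convex:
  assumes lin: "linear f" and z: "z \<in> L2 A"
  shows "convex_functional_on (L2 T) (cost f r R \<beta> z)"
  unfolding convex_functional_on_def
proof (intro ballI)
  fix u v :: "real^'n \<Rightarrow> real" and t :: real
  assume u: "u \<in> L2 T" and v: "v \<in> L2 T" and t: "t \<in> {0..1}"
  define c where "c = f 1"
  have f: "f x = c * x" for x
    using linear_cmul[OF lin, of x 1] by (simp add: c_def)
  have c: "0 < c"
    using strict_monoD[OF f_mono, of 0 1] f0 by (simp add: c_def)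
  have ex: "\<exists>y g. H10_grad S y g \<and> solves_weakly g (\<lambda>x. indicator T x * u x - f (y x))" if u: "u \<in> L2 T" for u
  proof -
    obtain y g where "H10_grad S y g" "square_integrable M (\<lambda>x. f (y x))" "solves_weakly g (\<lambda>x. indicator T x * u x - f (y x))"
    proof (rule weak_solution_exists[of f c, OF _ _ f0 extend_control[OF u]])
      show "f s \<le> f t" if "s \<le> t" for s t
        using that strict_mono_mono[OF f_mono] by (simp add: mono_def)
      show "\<bar>f s - f t\<bar> \<le> c * \<bar>s - t\<bar>" for s t
        using c by (simp add: f abs_mult flip: right_diff_distrib)
    qed (rule that)
    then show ?thesis
      by blast
  qed
  have sq: "square_integrable M (\<lambda>x. f (y x))" if "H10_grad S y g" for y g
    unfolding f by (rule square_integrable_cmult[OF H10_grad_L2[OF that]])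
  obtain yu gu where yu: "H10_grad S yu gu" "solves_weakly gu (\<lambda>x. indicator T x * u x - f (yu x))"
    using ex[OF u] by blast
  obtain yv gv where yv: "H10_grad S yv gv" "solves_weakly gv (\<lambda>x. indicator T x * v x - f (yv x))"
    using ex[OF v] by blast
  let ?m = "\<lambda>x. (1 - t) * u x + t * v x" and ?y = "\<lambda>x. (1 - t) * yu x + t * yv x"
  let ?g = "\<lambda>x. (1 - t) *\<^sub>R gu x + t *\<^sub>R gv x"
  have ym: "H10_grad S ?y ?g"
    by (intro H10_grad_add H10_grad_cmult yu(1) yv(1))
  have "solves_weakly ?g (\<lambda>x. (1 - t) * (indicator T x * u x - f (yu x)) + t * (indicator T x * v x - f (yv x)))"
    by (intro solves_weakly_combination H10_grad_grad_L2[OF yu(1)] H10_grad_grad_L2[OF yv(1)] yu(2) yv(2)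
      square_integrable_diff extend_control u v sq[OF yu(1)] sq[OF yv(1)])
  also have "(\<lambda>x. (1 - t) * (indicator T x * u x - f (yu x)) + t * (indicator T x * v x - f (yv x))) = (\<lambda>x. indicator T x * ?m x - f (?y x))"
    by (intro ext) (simp add: f algebra_simps)
  finally have "is_state_solution f r R ?m ?y"
    by (rule is_state_solutionI[OF L2_combination[OF u v] ym sq[OF ym]])
  note m = state_eq_AE[OF this]
  note su = state_eq_AE[OF is_state_solutionI[OF u yu(1) sq[OF yu(1)] yu(2)]]
  note sv = state_eq_AE[OF is_state_solutionI[OF v yv(1) sq[OF yv(1)] yv(2)]]
  let ?A = "lebesgue_on A"
  have zsq: "square_integrable ?A z"
    using z by (simp add: L2_iff_square_integrable)
  have sqA: "square_integrable ?A (state f r R u)" "square_integrable ?A (state f r R v)" "square_integrable ?A (state f r R ?m)"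
    by (intro square_integrable_L2_subset[OF bounded_open_S _ A_subset A_lebesgue] su(2) sv(2) m(2))+
  let ?a = "\<lambda>x. state f r R u x - z x" and ?b = "\<lambda>x. state f r R v x - z x"
  have ab: "square_integrable ?A ?a" "square_integrable ?A ?b"
    by (intro square_integrable_diff sqA zsq)+
  have "AE x in M. state f r R ?m x = (1 - t) * state f r R u x + t * state f r R v x"
    using m(1) su(1) sv(1) by eventually_elim simp
  then have "AE x in M. x \<in> A \<longrightarrow> state f r R ?m x = (1 - t) * state f r R u x + t * state f r R v x"
    by eventually_elim simp
  then have AE_A: "AE x in ?A. state f r R ?m x = (1 - t) * state f r R u x + t * state f r R v x"
    unfolding AE_subset_lebesgue_on[OF A_subset A_lebesgue] .
  have "(LINT x|?A. (state f r R ?m x - z x)\<^sup>2) = (LINT x|?A. ((1 - t) * ?a x + t * ?b x)\<^sup>2)"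
  proof (rule integral_cong_AE)
    note [measurable] = square_integrable_measurable[OF sqA(1)] square_integrable_measurable[OF sqA(2)]
      square_integrable_measurable[OF sqA(3)] square_integrable_measurable[OF zsq]
    show "(\<lambda>x. (state f r R ?m x - z x)\<^sup>2) \<in> borel_measurable ?A" "(\<lambda>x. ((1 - t) * ?a x + t * ?b x)\<^sup>2) \<in> borel_measurable ?A"
      by measurable
    show "AE x in ?A. (state f r R ?m x - z x)\<^sup>2 = ((1 - t) * ?a x + t * ?b x)\<^sup>2"
      using AE_A
    proof eventually_elim
      case (elim x)
      have "state f r R ?m x - z x = (1 - t) * ?a x + t * ?b x"
        unfolding elim by (simp add: algebra_simps)
      then show ?case
        by simp
    qed
  qed
  also have "\<dots> \<le> (1 - t) * (LINT x|?A. (?a x)\<^sup>2) + t * (LINT x|?A. (?b x)\<^sup>2)"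
    by (rule integral_power2_convex[OF ab]) (use t in auto)
  finally have "\<beta>/2 * (LINT x|?A. (state f r R ?m x - z x)\<^sup>2) \<le> \<beta>/2 * ((1 - t) * (LINT x|?A. (?a x)\<^sup>2) + t * (LINT x|?A. (?b x)\<^sup>2))"
    by (rule mult_left_mono) (use beta in simp)
  moreover have "(LINT x|lebesgue_on T. (?m x)\<^sup>2) \<le> (1 - t) * (LINT x|lebesgue_on T. (u x)\<^sup>2) + t * (LINT x|lebesgue_on T. (v x)\<^sup>2)"
    by (rule integral_power2_convex) (use u v t in \<open>auto simp: L2_iff_square_integrable\<close>)
  moreover have "1/2 * N + \<beta>/2 * Q \<le> (1 - t) * (1/2 * Nu + \<beta>/2 * Qu) + t * (1/2 * Nv + \<beta>/2 * Qv)"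
    if "\<beta>/2 * Q \<le> \<beta>/2 * ((1 - t) * Qu + t * Qv)" "N \<le> (1 - t) * Nu + t * Nv" for N Nu Nv Q Qu Qv
  proof -
    have "(1 - t) * (1/2 * Nu + \<beta>/2 * Qu) + t * (1/2 * Nv + \<beta>/2 * Qv)
        = 1/2 * ((1 - t) * Nu + t * Nv) + \<beta>/2 * ((1 - t) * Qu + t * Qv)"
      by (simp add: field_simps)
    moreover have "1/2 * N + \<beta>/2 * Q \<le> 1/2 * ((1 - t) * Nu + t * Nv) + \<beta>/2 * ((1 - t) * Qu + t * Qv)"
      by (rule add_mono[OF mult_left_mono[OF that(2)] that(1)]) simp
    ultimately show ?thesis
      by (simp only:)
  qed
  ultimately show "cost f r R \<beta> z ?m \<le> (1 - t) * cost f r R \<beta> z u + t * cost f r R \<beta> z v"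
    unfolding cost_eq by blast
qed

text \<open>The target enters $J$ only through a term that is affine in the state; a large multiple of
  the failure of affinity of the state is a target that destroys convexity.\<close>

lemma convex_imp_state_affine:
  assumes conv: "\<And>z. z \<in> L2 A \<Longrightarrow> convex_functional_on (L2 T) (cost f r R \<beta> z)"
    and u: "u \<in> L2 T" and v: "v \<in> L2 T" and t: "t \<in> {0..1}"
    and sq: "square_integrable M (state f r R u)" "square_integrable M (state f r R v)"
      "square_integrable M (state f r R (\<lambda>x. (1 - t) * u x + t * v x))"
  shows "AE x in M. x \<in> A \<longrightarrow> state f r R (\<lambda>x. (1 - t) * u x + t * v x) x = (1 - t) * state f r R u x + t * state f r R v x"
proof -
  let ?A = "lebesgue_on A"
  define m where "m x = (1 - t) * u x + t * v x" for x
  define yu yv ym where "yu = state f r R u" and "yv = state f r R v" and "ym = state f r R m"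
  have ysq: "square_integrable ?A yu" "square_integrable ?A yv" "square_integrable ?A ym"
    unfolding yu_def yv_def ym_def m_def[abs_def]
    by (intro square_integrable_L2_subset[OF bounded_open_S _ A_subset A_lebesgue] sq)+
  define w where "w x = ym x - ((1 - t) * yu x + t * yv x)" for x
  have w: "square_integrable ?A w"
    unfolding w_def by (intro square_integrable_diff square_integrable_add square_integrable_cmult ysq)
  define W where "W = (LINT x|?A. (w x)\<^sup>2)"
  define Q where "Q y = (LINT x|?A. (y x)\<^sup>2)" for y :: "real^'n \<Rightarrow> real"
  define P where "P y = (LINT x|?A. y x * w x)" for y :: "real^'n \<Rightarrow> real"
  define N where "N u = (LINT x|lebesgue_on T. (u x)\<^sup>2)" for u :: "real^'n \<Rightarrow> real"
  \<comment> \<open>The cost is a quadratic polynomial in the multiplier l of the target. Its l^2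
    coefficient is the same for all three controls and cancels in the convexity defect.\<close>
  have cost: "cost f r R \<beta> (\<lambda>x. l * w x) u' = 1/2 * N u' + \<beta>/2 * (Q y - 2 * l * P y + l\<^sup>2 * W)"
    if "y = state f r R u'" "square_integrable ?A y" for l u' y
  proof -
    have "(LINT x|?A. (y x - l * w x)\<^sup>2) = Q y - 2 * (LINT x|?A. y x * (l * w x)) + (LINT x|?A. (l * w x)\<^sup>2)"
      unfolding Q_def by (rule integral_power2_diff[OF that(2) square_integrable_cmult[OF w]])
    also have "\<dots> = Q y - 2 * l * P y + l\<^sup>2 * W"
      unfolding P_def W_def by (simp add: power_mult_distrib mult.left_commute[of _ l])
    finally show ?thesis
      unfolding cost_eq N_def that(1) by simp
  qed
  \<comment> \<open>In the part linear in l, the defect w of affinity is paired with itself.\<close>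
  have Pw: "P ym - (1 - t) * P yu - t * P yv = W"
  proof -
    note i = integrable_mult_L2[OF ysq(3) w] integrable_mult_L2[OF ysq(1) w] integrable_mult_L2[OF ysq(2) w]
    have "W = (LINT x|?A. ym x * w x - (1 - t) * (yu x * w x) - t * (yv x * w x))"
      unfolding W_def power2_eq_square
      by (intro Bochner_Integration.integral_cong refl) (simp add: w_def[of x for x] algebra_simps)
    also have "\<dots> = P ym - (1 - t) * P yu - t * P yv"
      unfolding P_def using i by simp
    finally show ?thesis
      by simp
  qed
  define K where "K = 1/2 * (N m - (1 - t) * N u - t * N v) + \<beta>/2 * (Q ym - (1 - t) * Q yu - t * Q yv)"
  have le: "K - \<beta> * l * W \<le> 0" for l
  proof -
    have "(\<lambda>x. l * w x) \<in> L2 A"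
      unfolding L2_iff_square_integrable by (rule square_integrable_cmult[OF w])
    from conv[OF this] u v t
    have "cost f r R \<beta> (\<lambda>x. l * w x) m \<le> (1 - t) * cost f r R \<beta> (\<lambda>x. l * w x) u + t * cost f r R \<beta> (\<lambda>x. l * w x) v"
      unfolding convex_functional_on_def m_def[abs_def] by blast
    moreover have "cost f r R \<beta> (\<lambda>x. l * w x) m - ((1 - t) * cost f r R \<beta> (\<lambda>x. l * w x) u + t * cost f r R \<beta> (\<lambda>x. l * w x) v)
        = K - \<beta> * l * (P ym - (1 - t) * P yu - t * P yv)"
      unfolding cost[OF ym_def ysq(3)] cost[OF yu_def ysq(1)] cost[OF yv_def ysq(2)] K_def
      by (simp add: field_simps)
    ultimately show ?thesis
      unfolding Pw by linarith
  qed
  have "W = 0"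
  proof (rule ccontr)
    assume "W \<noteq> 0"
    \<comment> \<open>The multiplier is chosen so that the convexity defect becomes 1, contrary to
      \<open>le\<close>.\<close>
    have "K - \<beta> * ((K - 1) / (\<beta> * W)) * W = 1"
      using \<open>W \<noteq> 0\<close> beta by simp
    with le[of "(K - 1) / (\<beta> * W)"] show False
      by simp
  qed
  then have "AE x in ?A. (w x)\<^sup>2 = 0"
    unfolding W_def using integral_nonneg_eq_0_iff_AE[OF square_integrable_power2[OF w]] by simp
  then show ?thesis
    unfolding AE_subset_lebesgue_on[OF A_subset A_lebesgue] m_def[abs_def, symmetric]
      yu_def[symmetric] yv_def[symmetric] ym_def[symmetric]
    by eventually_elim (simp add: w_def)
qed

lemma constant_control_L2: "(\<lambda>x. s) \<in> L2 T"
proof -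
  have "finite_measure (lebesgue_on T)"
    by (rule finite_measure_lebesgue_on_bounded) auto
  then show ?thesis
    unfolding L2_iff_square_integrable by (rule square_integrable_bounded[of _ _ "\<bar>s\<bar>"]) auto
qed

text \<open>A constant control is bounded, so the truncation argument applies. The gradient and the
  bound are returned with the solution because the nonvanishing in the annulus depends on
  them.\<close>

lemma constant_control_solution:
  obtains y g B where "0 < B" "H10_grad S y g" "AE x in M. \<bar>y x\<bar> \<le> B" "square_integrable M (\<lambda>x. f (y x))"
    "solves_weakly g (\<lambda>x. indicator T x * s - f (y x))" "is_state_solution f r R (\<lambda>x. s) y"
proof -
  obtain y g B where y: "0 < B" "H10_grad S y g" "AE x in M. \<bar>y x\<bar> \<le> B" "square_integrable M (\<lambda>x. f (y x))"
    "solves_weakly g (\<lambda>x. indicator T x * s - f (y x))"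
  proof (rule bounded_solution_exists[OF C1 strict_mono_mono[OF f_mono] f0, of "\<lambda>x. indicator T x * s" "\<bar>s\<bar> + 1"])
    show "(\<lambda>x. indicator T x * s) \<in> borel_measurable M"
      by measurable
    show "\<bar>indicator T x * s\<bar> < \<bar>s\<bar> + 1" for x
      by (auto simp: indicator_def intro: add_nonneg_pos)
  qed (rule that)
  show ?thesis
    by (rule that[OF y is_state_solutionI[OF constant_control_L2 y(2,4,5)]])
qed

text \<open>Homogeneity of the state in the annulus passes to its gradient, hence to $f(y)$ by the equation,
  which has no source there.\<close>

lemma homogeneous_on_annulus:
  assumes y: "H10_grad S y g" "square_integrable M (\<lambda>x. f (y x))" "solves_weakly g (\<lambda>x. indicator T x * 1 - f (y x))"
    and z: "H10_grad S z h" "square_integrable M (\<lambda>x. f (z x))" "solves_weakly h (\<lambda>x. indicator T x * s - f (z x))"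
    and hom: "AE x in M. x \<in> A \<longrightarrow> z x = s * y x"
  shows "AE x in M. x \<in> S - cball 0 r \<longrightarrow> f (s * y x) = s * f (y x)"
proof -
  let ?O = "S - cball 0 r"
  have O: "open ?O" "?O \<subseteq> S" "?O \<in> sets lebesgue"
    by (auto intro: open_Diff)
  let ?k = "\<lambda>x. h x - s *\<^sub>R g x" and ?e = "\<lambda>x. f (z x) - s * f (y x)"
  have d: "H10_grad S (\<lambda>x. z x - s * y x) ?k"
    by (intro H10_grad_diff H10_grad_cmult y z)
  have k0: "AE x in M. x \<in> ?O \<longrightarrow> ?k x = 0"
  proof (rule H10_grad_eq_0_on_constant[OF d O(1,2)])
    show "AE x in M. x \<in> ?O \<longrightarrow> z x - s * y x = 0"
      using hom by eventually_elim auto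
  qed
  have sqe: "square_integrable M ?e"
    by (intro square_integrable_diff square_integrable_cmult y z)
  have sqT: "square_integrable M (\<lambda>x. indicator T x * c)" for c :: real
    by (rule extend_control[OF constant_control_L2])
  have "AE x in lebesgue_on ?O. ?e x = 0"
  proof (rule AE_eq_0_if_integral_test_functions[OF O(1)])
    show "integrable (lebesgue_on ?O) ?e"
      by (rule square_integrable_integrable[OF finite_measure_lebesgue_on_bounded square_integrable_L2_subset[OF bounded_open_S sqe O(2,3)]])
        auto
    fix \<theta>
    assume \<theta>: "\<theta> \<in> test_functions ?O"
    have \<theta>S: "\<theta> \<in> test_functions S"
      by (rule test_functions_mono[OF \<theta> O(2)])
    note G = H10_grad_test[OF \<theta>S]
    \<comment> \<open>The source terms cancel in this combination, so \<open>?k\<close> solves the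
      equation with right-hand side \<open>- ?e\<close>.\<close>
    have "solves_weakly (\<lambda>x. 1 *\<^sub>R h x + (- s) *\<^sub>R g x)
        (\<lambda>x. 1 * (indicator T x * s - f (z x)) + (- s) * (indicator T x * 1 - f (y x)))"
      by (intro solves_weakly_combination H10_grad_grad_L2[OF y(1)] H10_grad_grad_L2[OF z(1)] y(3) z(3)
        square_integrable_diff sqT y(2) z(2))
    then have "solves_weakly ?k (\<lambda>x. - ?e x)"
      by (simp add: algebra_simps)
    from solves_weaklyD[OF this G] have "(LINT x|M. - ?e x * \<theta> x) = (LINT x|M. ?k x \<bullet> grad \<theta> x)"
      by simp
    also have "\<dots> = (LINT x|M. 0)"
    proof (rule integral_cong_AE)
      note [measurable] = H10_grad_measurable[OF d] H10_grad_measurable[OF G]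
      show "(\<lambda>x. ?k x \<bullet> grad \<theta> x) \<in> borel_measurable M"
        by measurable
      show "AE x in M. ?k x \<bullet> grad \<theta> x = 0"
        using k0
      proof eventually_elim
        case (elim x)
        have "grad \<theta> x = 0" if "x \<notin> ?O"
          using test_functions_eq_0[OF test_functions_partial_deriv[OF \<theta>] that] by (simp add: vec_eq_iff)
        with elim show ?case
          by (cases "x \<in> ?O") auto
      qed
    qed simp
    finally have "(LINT x|M. ?e x * \<theta> x) = 0"
      by (simp only: mult_minus_left Bochner_Integration.integral_minus Bochner_Integration.integral_zero neg_equal_0_iff_equal)
    moreover have "(LINT x|M. indicator ?O x * (?e x * \<theta> x)) = (LINT x|M. ?e x * \<theta> x)"
      using test_functions_eq_0[OF \<theta>] by (intro Bochner_Integration.integral_cong refl) (auto simp: indicator_def)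
    ultimately show "(LINT x|lebesgue_on ?O. ?e x * \<theta> x) = 0"
      unfolding integral_subset_lebesgue_on[OF O(2,3)] by simp
  qed
  then have "AE x in M. x \<in> ?O \<longrightarrow> ?e x = 0"
    unfolding AE_subset_lebesgue_on[OF O(2,3)] .
  with hom show ?thesis
  proof eventually_elim
    case (elim x)
    show ?case
    proof
      assume x: "x \<in> ?O"
      then have "x \<in> A"
        by auto
      with elim x show "f (s * y x) = s * f (y x)"
        by simp
    qed
  qed
qed

lemma convex_imp_linear:
  assumes conv: "\<And>z. z \<in> L2 A \<Longrightarrow> convex_functional_on (L2 T) (cost f r R \<beta> z)"
  shows "linear f"
proof -
  define Y where "Y s = state f r R (\<lambda>x::real^'n. s)" for s
  have Y_sq: "square_integrable M (Y s)" for s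
    unfolding Y_def by (rule constant_control_solution[of s]) (rule state_eq_AE(2))
  have aff: "AE x in M. x \<in> A \<longrightarrow> Y ((1 - t) * a + t * b) x = (1 - t) * Y a x + t * Y b x" if "t \<in> {0..1}" for t a b
    unfolding Y_def
    by (rule convex_imp_state_affine[OF conv constant_control_L2 constant_control_L2 that]) (use Y_sq in \<open>simp_all add: Y_def\<close>)
  have Y0: "AE x in M. Y 0 x = 0"
  proof -
    have "grad (\<lambda>x::real^'n. 0) = (\<lambda>x. 0)"
      by (intro ext) (simp add: vec_eq_iff)
    then have "is_state_solution f r R (\<lambda>x::real^'n. 0) (\<lambda>x. 0)"
      using H10_grad_test[OF test_functions_zero]
      by (intro is_state_solutionI[OF constant_control_L2, of _ "\<lambda>x. 0"]) (simp_all add: f0 solves_weakly_def)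
    then show ?thesis
      unfolding Y_def by (rule state_eq_AE(1))
  qed
  \<comment> \<open>For s \<le> 1 the control s lies between 0 and 1. For s > 1 the control 1 lies
    between 0 and s with weight 1/s, and the relation is solved for the state of s.\<close>
  have pos: "AE x in M. x \<in> A \<longrightarrow> Y s x = s * Y 1 x" if "0 \<le> s" for s
  proof (cases "s \<le> 1")
    case True
    have "AE x in M. x \<in> A \<longrightarrow> Y ((1 - s) * 0 + s * 1) x = (1 - s) * Y 0 x + s * Y 1 x"
      by (rule aff) (use that True in simp)
    with Y0 show ?thesis
      by eventually_elim simp
  next
    case False
    have "AE x in M. x \<in> A \<longrightarrow> Y ((1 - 1 / s) * 0 + 1 / s * s) x = (1 - 1 / s) * Y 0 x + 1 / s * Y s x"
      by (rule aff) (use False in simp)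
    with Y0 show ?thesis
      by eventually_elim (use False in \<open>simp add: field_simps\<close>)
  qed
  \<comment> \<open>For negative s, the midpoint of s and -s is the zero control, whose state
    vanishes.\<close>
  have hom: "AE x in M. x \<in> A \<longrightarrow> Y s x = s * Y 1 x" for s
  proof (cases "0 \<le> s")
    case False
    have "AE x in M. x \<in> A \<longrightarrow> Y ((1 - 1 / 2) * s + 1 / 2 * (- s)) x = (1 - 1 / 2) * Y s x + 1 / 2 * Y (- s) x"
      by (rule aff) simp
    moreover have "AE x in M. x \<in> A \<longrightarrow> Y (- s) x = - s * Y 1 x"
      by (rule pos) (use False in simp)
    ultimately show ?thesis
      using Y0 by eventually_elim simp
  qed (rule pos)
  obtain y g B where y: "0 < B" "H10_grad S y g" "AE x in M. \<bar>y x\<bar> \<le> B" "square_integrable M (\<lambda>x. f (y x))"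
    "solves_weakly g (\<lambda>x. indicator T x * 1 - f (y x))" "is_state_solution f r R (\<lambda>x. 1) y"
    by (rule constant_control_solution[of 1]) (rule that)
  have Yy: "AE x in M. Y 1 x = y x"
    unfolding Y_def by (rule state_eq_AE(1)[OF y(6)])
  have f_hom: "AE x in M. x \<in> S - cball 0 r \<longrightarrow> f (s * y x) = s * f (y x)" for s
  proof -
    obtain z h C where z: "0 < C" "H10_grad S z h" "AE x in M. \<bar>z x\<bar> \<le> C" "square_integrable M (\<lambda>x. f (z x))"
      "solves_weakly h (\<lambda>x. indicator T x * s - f (z x))" "is_state_solution f r R (\<lambda>x. s) z"
      by (rule constant_control_solution[of s]) (rule that)
    have "AE x in M. Y s x = z x"
      unfolding Y_def by (rule state_eq_AE(1)[OF z(6)])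
    with hom[of s] Yy have "AE x in M. x \<in> A \<longrightarrow> z x = s * y x"
      by eventually_elim simp
    then show ?thesis
      by (rule homogeneous_on_annulus[OF y(2,4,5) z(2,4,5)])
  qed
  have "AE x in M. \<forall>q\<in>\<rat>. x \<in> S - cball 0 r \<longrightarrow> f (q * y x) = q * f (y x)"
    using f_hom by (subst AE_ball_countable) (auto simp: countable_rat)
  then have all_q: "AE x in M. x \<in> S - cball 0 r \<longrightarrow> (\<forall>q\<in>\<rat>. f (q * y x) = q * f (y x))"
    by eventually_elim blast
  have sphere: "AE x in M. x \<notin> sphere 0 r"
    by (rule AE_not_sphere)
  \<comment> \<open>If 0 were the only such value, y would vanish almost everywhere outside the
    inner ball.\<close>
  have "\<exists>c. c \<noteq> 0 \<and> (\<forall>q\<in>\<rat>. f (q * c) = q * f c)"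
  proof (rule ccontr)
    assume "\<not> (\<exists>c. c \<noteq> 0 \<and> (\<forall>q\<in>\<rat>. f (q * c) = q * f c))"
    then have none: "c = 0" if "\<forall>q\<in>\<rat>. f (q * c) = q * f c" for c
      using that by blast
    have "AE x in M. x \<in> S"
      by (rule AE_I2) simp
    with all_q sphere have "AE x in M. x \<notin> T \<longrightarrow> y x = 0"
    proof eventually_elim
      case (elim x)
      show ?case
      proof
        assume "x \<notin> T"
        with elim have "x \<in> S - cball 0 r"
          by auto
        with elim show "y x = 0"
          by (intro none) blast
      qed
    qed
    moreover have "\<not> (AE x in M. x \<notin> T \<longrightarrow> y x = 0)"
    proof (rule constant_control_state_nonzero[OF C1 f_mono f0 radii(1) _ _ y(2,3,1,4)])
      \<comment> \<open>Any radius strictly between r and R leaves room for the cutoff; the midpoint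
        is taken.\<close>
      show "r < (r + R) / 2" "cball 0 ((r + R) / 2) \<subseteq> S"
        using radii by (auto simp: field_simps)
      show "solves_weakly g (\<lambda>x. indicator T x - f (y x))"
        using y(5) by simp
    qed
    ultimately show False
      by blast
  qed
  then obtain c where c: "c \<noteq> 0" "\<And>q. q \<in> \<rat> \<Longrightarrow> f (q * c) = q * f c"
    by blast
  have "f (s * c) = s * f c" for s
  proof -
    \<comment> \<open>The factors for which homogeneity holds at c form a closed set by continuity
      of f, and it contains the dense set of rationals.\<close>
    have "closed {s. f (s * c) = s * f c}"
      by (intro closed_Collect_eq continuous_on_compose2[OF C1_differentiable_imp_continuous_on[OF C1]] continuous_intros) auto
    moreover have "\<rat> \<subseteq> {s. f (s * c) = s * f c}"
      using c(2) by blast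
    ultimately have "closure \<rat> \<subseteq> {s. f (s * c) = s * f c}"
      by (rule closure_minimal[rotated])
    then show ?thesis
      using Rats_closure_real by blast
  qed
  then have "f t = t * (f c / c)" for t
    using \<open>c \<noteq> 0\<close> by (metis nonzero_eq_divide_eq times_divide_eq_left times_divide_eq_right)
  then have "f = (\<lambda>t. t * (f c / c))"
    by (rule ext)
  moreover have "linear (\<lambda>t::real. t * (f c / c))"
    by (intro linearI) (simp_all add: algebra_simps add_divide_distrib)
  ultimately show ?thesis
    by metis
qed

end

theorem theorem1p3:
  fixes f :: "real \<Rightarrow> real" and r R \<beta> :: real
  assumes dim: "CARD('n::finite) \<in> {1, 2, 3}"
    and radii: "0 < r" "r < R"
    and beta: "0 < \<beta>"
    and f_C1: "f C1_differentiable_on UNIV"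
    and f_C2: "deriv f C1_differentiable_on (UNIV - {0})"
    and f_mono: "strict_mono f"
    and f_zero: "f 0 = 0"
  shows "(linear f \<longrightarrow>
           (\<forall>z \<in> L2 (ball 0 R - ball 0 r :: (real^'n) set).
              convex_functional_on (L2 (ball 0 r)) (cost f r R \<beta> z)))
       \<and> (\<not> linear f \<longrightarrow>
           (\<exists>z \<in> L2 (ball 0 R - ball 0 r :: (real^'n) set).
              \<not> convex_functional_on (L2 (ball 0 r)) (cost f r R \<beta> z)))"
proof -
  interpret control_problem f r R \<beta> "TYPE('n)"
    by unfold_locales (rule radii beta f_C1 f_mono f_zero)+
  show ?thesis
    using linear_imp_convex convex_imp_linear by blast
qed

end
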